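(* Let $d\geq 2$ and let $r$ satisfy $\frac{4d}{d-1}<r<\infty$. Put $s=\frac d2-\frac dr-\frac12$. Then there is a constant $C>0$ (depending only on $d$ and $r$) such that for every orthonormal system $(f_j)_j$ in $L^2(\mathbb{R}^d)$ and every sequence $\lambda=(\lambda_j)_j\in\ell^2(\mathbb{C})$, $$\left\Vert\sum_j\lambda_j\left|e^{it\Delta}|\nabla|^{-s}f_j\right|^2\right\Vert_{L_t^{2}L_x^{r/2}(\mathbb{R}\times\mathbb{R}^d)}\leq C\,\Vert\lambda\Vert_{\ell^2}.$$
   Context: $e^{it\Delta}$ is the free Schrödinger propagator on $\mathbb{R}^d$, i.e. the Fourier multiplier with symbol $e^{-it|\xi|^2}$, and $|\nabla|^{-s}$ is the Fourier multiplier with symbol $|\xi|^{-s}$. The mixed norm is $\|F\|_{L^a_tL^b_x}=\big\|\,\|F(t,\cdot)\|_{L^b(\mathbb{R}^d)}\big\|_{L^a_t(\mathbb{R})}$. *)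

theory Defs
  imports "HOL-Analysis.Analysis"
begin

section \<open>Schwartz functions and the Fourier transform\<close>

fun iterated_deriv :: "'a::euclidean_space list \<Rightarrow> ('a \<Rightarrow> complex) \<Rightarrow> 'a \<Rightarrow> complex" where
  "iterated_deriv [] \<phi> = \<phi>"
| "iterated_deriv (v # vs) \<phi> = (\<lambda>x. frechet_derivative (iterated_deriv vs \<phi>) (at x) v)"

definition schwartz :: "('a::euclidean_space \<Rightarrow> complex) \<Rightarrow> bool" where
  "schwartz \<phi> \<longleftrightarrow> (\<forall>vs \<in> lists Basis.
     (\<forall>x. iterated_deriv vs \<phi> differentiable (at x)) \<and>
     (\<forall>k::nat. bounded (range (\<lambda>x. norm x ^ k *\<^sub>R iterated_deriv vs \<phi> x))))"

text \<open>
  The unitary transform with phase \<open>x \<bullet> \<xi>\<close> (no \<open>2 * pi\<close> in the exponent), so that the Laplacian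
  has symbol \<open>- (norm \<xi>)\<^sup>2\<close>.
\<close>

definition fourier :: "('a::euclidean_space \<Rightarrow> complex) \<Rightarrow> 'a \<Rightarrow> complex" where
  "fourier \<phi> \<xi> = of_real ((2 * pi) powr (- real DIM('a) / 2)) * (LINT x|lborel. cis (- (x \<bullet> \<xi>)) * \<phi> x)"

text \<open>
  Functions that define a tempered distribution by integration. Two of them define the same
  distribution iff they agree almost everywhere.
\<close>

definition tempered_fun :: "('a::euclidean_space \<Rightarrow> complex) \<Rightarrow> bool" where
  "tempered_fun u \<longleftrightarrow> u \<in> borel_measurable lborel \<and>
     (\<exists>N::nat. integrable lborel (\<lambda>x. u x / of_real ((1 + norm x) ^ N)))"

text \<open>
  \<open>g\<close> is the Fourier transform of \<open>u\<close> in the sense of tempered distributions. For \<open>u\<close> in \<open>L\<^sup>2\<close>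
  this is the Plancherel transform.
\<close>

definition has_fourier :: "('a::euclidean_space \<Rightarrow> complex) \<Rightarrow> ('a \<Rightarrow> complex) \<Rightarrow> bool" where
  "has_fourier u g \<longleftrightarrow> tempered_fun u \<and> tempered_fun g \<and>
     (\<forall>\<phi>. schwartz \<phi> \<longrightarrow>
        (LINT x|lborel. u x * fourier \<phi> x) = (LINT \<xi>|lborel. g \<xi> * \<phi> \<xi>))"

section \<open>Fourier multipliers\<close>

text \<open>
  The result is a representative of an almost-everywhere class: any two admissible choices of the
  inner function agree almost everywhere, and so do the results. Nothing is
  specified if the distribution with transform \<open>m * g\<close> is not given by a function.
  The definition is not limited to \<open>L\<^sup>2\<close>, because \<open>|\<nabla>|\<^sup>-\<^sup>s f\<close> with \<open>f\<close> in \<open>L\<^sup>2\<close> need not be in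
  \<open>L\<^sup>2\<close>; for \<open>0 < s < d / 2\<close> its transform is in \<open>L\<^sup>1 + L\<^sup>2\<close>, so it is still a function.
\<close>

definition fourier_multiplier ::
    "('a::euclidean_space \<Rightarrow> complex) \<Rightarrow> ('a \<Rightarrow> complex) \<Rightarrow> 'a \<Rightarrow> complex" where
  "fourier_multiplier m f = (SOME u. \<exists>g. has_fourier f g \<and> has_fourier u (\<lambda>\<xi>. m \<xi> * g \<xi>))"

definition schrodinger :: "real \<Rightarrow> ('a::euclidean_space \<Rightarrow> complex) \<Rightarrow> 'a \<Rightarrow> complex" where
  "schrodinger t = fourier_multiplier (\<lambda>\<xi>. cis (- t * (norm \<xi>)\<^sup>2))"

text \<open>The value \<open>0 powr (- s) = 0\<close> of the symbol at the origin is irrelevant.\<close>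

definition riesz_potential :: "real \<Rightarrow> ('a::euclidean_space \<Rightarrow> complex) \<Rightarrow> 'a \<Rightarrow> complex" where
  "riesz_potential s = fourier_multiplier (\<lambda>\<xi>. of_real (norm \<xi> powr (- s)))"

section \<open>Orthonormal systems and mixed norms\<close>

definition L2_fun :: "('a::euclidean_space \<Rightarrow> complex) \<Rightarrow> bool" where
  "L2_fun f \<longleftrightarrow> f \<in> borel_measurable lborel \<and> integrable lborel (\<lambda>x. (norm (f x))\<^sup>2)"

definition orthonormal_L2 :: "'i set \<Rightarrow> ('i \<Rightarrow> 'a::euclidean_space \<Rightarrow> complex) \<Rightarrow> bool" where
  "orthonormal_L2 J f \<longleftrightarrow> (\<forall>j\<in>J. L2_fun (f j)) \<and>
     (\<forall>j\<in>J. \<forall>k\<in>J. (LINT x|lborel. f j x * cnj (f k x)) = (if j = k then 1 else 0))"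

text \<open>Only used with a positive exponent.\<close>

definition ennreal_powr :: "ennreal \<Rightarrow> real \<Rightarrow> ennreal" where
  "ennreal_powr x p = (if x = \<infinity> then \<infinity> else ennreal (enn2real x powr p))"

definition Lp_norm :: "real \<Rightarrow> ('a::euclidean_space \<Rightarrow> ennreal) \<Rightarrow> ennreal" where
  "Lp_norm p g = ennreal_powr (\<integral>\<^sup>+ x. ennreal_powr (g x) p \<partial>lborel) (1 / p)"

definition mixed_norm ::
    "real \<Rightarrow> real \<Rightarrow> (real \<Rightarrow> 'a::euclidean_space \<Rightarrow> complex) \<Rightarrow> ennreal" where
  "mixed_norm a b F = Lp_norm a (\<lambda>t. Lp_norm b (\<lambda>x. ennreal (norm (F t x))))"

end

theory Submission
  imports Defs "HOL-Probability.Probability"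
begin

text \<open>
  For \<open>\<rho> = \<Sum>j. lam j * |u j|\<^sup>2\<close> with \<open>u j = e\<^sup>i\<^sup>t\<^sup>\<Delta> |\<nabla>|\<^sup>-\<^sup>s (f j)\<close>, the spatial Fourier transform of
  \<open>\<rho> t\<close> at \<open>\<zeta>\<close> is a constant times the integral over \<open>\<eta>\<close> of
  \<open>cis (- t * ((norm \<zeta>)\<^sup>2 + 2 * (\<zeta> \<bullet> \<eta>))) * |\<zeta> + \<eta>|\<^sup>-\<^sup>s * |\<eta>|\<^sup>-\<^sup>s * \<gamma> (\<zeta> + \<eta>) \<eta>\<close>, where \<open>\<gamma>\<close> is the
  Hilbert--Schmidt kernel of \<open>\<Sum>j. lam j\<close> times the projection on the Fourier transform of \<open>f j\<close>,
  whose \<open>L\<^sup>2\<close> norm is the \<open>\<ell>\<^sup>2\<close> norm of \<open>lam\<close>. The phase is affine in \<open>\<eta>\<close>, so Plancherel in \<open>t\<close>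
  and Cauchy--Schwarz on the slices \<open>\<zeta> \<bullet> \<eta> = const\<close> bound the \<open>L\<^sup>2\<close> norm in time by the integral of
  \<open>|\<zeta> + \<eta>|\<^sup>-\<^sup>2\<^sup>s * |\<eta>|\<^sup>-\<^sup>2\<^sup>s\<close> over a slice, which is of order \<open>|\<zeta>|\<close> to the power \<open>d - 1 - 4 * s\<close> because
  \<open>2 * s < d - 1 < 4 * s\<close>. Hence \<open>\<rho>\<close> lies in \<open>L\<^sup>2\<close> in time with values in the homogeneous Sobolev
  space of order \<open>\<alpha> = d / 2 - 2 * d / r\<close>, which embeds into \<open>L\<^sup>r\<^sup>/\<^sup>2\<close>.
\<close>

section \<open>Gaussians\<close>

text \<open>The two bounds on \<open>r\<close> are the two convergence conditions of the slice
  integral: \<open>r > 4 * d / (d - 1)\<close> says \<open>d - 1 < 4 * s\<close>, decay of the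
  weight at infinity inside a hyperplane, and finiteness of \<open>r\<close> says
  \<open>2 * s < d - 1\<close>, integrability of each singularity there. The order \<alpha> is the
  one at which the powers of \<open>norm \<zeta>\<close> cancel, so that only the Hilbert--Schmidt
  norm is left. Hyperplane measures are never constructed: a slice is probed by
  \<open>\<Phi> (2 * (\<zeta> \<bullet> \<eta>))\<close>, with bounds in terms of the integral of
  \<Phi>. Two obstacles shape the rest. Fourier integrals need integrable symbols, so the estimate
  is proved for frequencies in a ball of radius \<open>n\<close> and finitely many functions,
  uniformly in both. And \<open>schrodinger t\<close> is a choice made separately for each
  \<open>t\<close>, so measurability in \<open>t\<close> of the full density is not at hand; at each
  \<open>t\<close> it is bounded by a limit inferior of explicit measurable quantities. Replacing
  \<open>lam j\<close> by its modulus makes all terms nonnegative, so one bound yields both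
  convergence of the series almost everywhere and the estimate for complex coefficients.\<close>

lemma borel_measurable_cis [measurable (raw)]:
  assumes "f \<in> borel_measurable M"
  shows "(\<lambda>x. cis (f x)) \<in> borel_measurable M"
  using measurable_compose[OF assms borel_measurable_continuous_onI[of cis]]
  by (simp add: continuous_on_cis)

lemma borel_measurable_cnj [measurable (raw)]:
  assumes "f \<in> borel_measurable M"
  shows "(\<lambda>x. cnj (f x)) \<in> borel_measurable M"
  using measurable_compose[OF assms borel_measurable_continuous_onI[of cnj]]
  by (simp add: continuous_on_cnj)

text \<open>The heat kernel with variance \<open>a\<close> in each coordinate. The product form lets
  integrals factor over \<open>Basis\<close> into one-dimensional normal densities.\<close>

definition gauss :: "real \<Rightarrow> 'a::euclidean_space \<Rightarrow> real" where
  "gauss a y = (\<Prod>b\<in>Basis. normal_density 0 (sqrt a) (y \<bullet> b))"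

text \<open>\<open>lborel\<close> is by definition the image of the product of one-dimensional
  Lebesgue measures under the coordinate map, which reduces both claims to Fubini on the product
  space.\<close>

lemma lborel_integral_prod:
  fixes f :: "'a::euclidean_space \<Rightarrow> real \<Rightarrow> complex"
  assumes "\<And>b. b \<in> Basis \<Longrightarrow> integrable lborel (f b)"
  shows "integrable lborel (\<lambda>x::'a. \<Prod>b\<in>Basis. f b (x \<bullet> b))"
    and "(LINT x|lborel. (\<Prod>b\<in>Basis. f b (x \<bullet> b))) = (\<Prod>b\<in>Basis. LINT x|lborel. f b x)"
proof -
  interpret product_sigma_finite "\<lambda>_::'a. lborel :: real measure"
    by (standard; rule lborel.sigma_finite_measure_axioms)
  have [measurable]: "f b \<in> borel_measurable borel" if "b \<in> Basis" for b
    using borel_measurable_integrable[OF assms[OF that]] by simp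
  have meas: "(\<lambda>f. \<Sum>b\<in>Basis. f b *\<^sub>R b) \<in> measurable (\<Pi>\<^sub>M b\<in>(Basis::'a set). lborel) (borel :: 'a measure)"
    by measurable
  have eq: "lborel = distr (\<Pi>\<^sub>M b\<in>(Basis::'a set). lborel) borel (\<lambda>f. \<Sum>b\<in>Basis. f b *\<^sub>R b)"
    by (subst lborel_def) (simp add: lborel_eq_real)
  have inn: "(\<Prod>b\<in>Basis. f b ((\<Sum>c\<in>Basis. g c *\<^sub>R c) \<bullet> b)) = (\<Prod>b\<in>Basis. f b (g b))" for g :: "'a \<Rightarrow> real"
    by (rule prod.cong) (auto simp: inner_sum_left inner_Basis if_distrib cong: if_cong)
  show "integrable lborel (\<lambda>x::'a. \<Prod>b\<in>Basis. f b (x \<bullet> b))"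
    apply (subst eq)
    apply (subst integrable_distr_eq[OF meas])
     apply measurable
    apply (simp only: inn)
    by (rule product_integrable_prod) (use assms in auto)
  show "(LINT x|lborel. (\<Prod>b\<in>Basis. f b (x \<bullet> b))) = (\<Prod>b\<in>Basis. LINT x|lborel. f b x)"
    apply (subst eq)
    apply (subst integral_distr[OF meas])
     apply measurable
    apply (simp only: inn)
    by (rule product_integral_prod) (use assms in auto)
qed

lemma gauss_nonneg [simp]: "0 \<le> gauss a y"
  by (simp add: gauss_def prod_nonneg)

lemma gauss_measurable [measurable]: "gauss a \<in> borel_measurable borel"
  unfolding gauss_def by measurable

lemma gauss_even [simp]: "gauss a (- y) = gauss a y"
  by (simp add: gauss_def normal_density_def)

lemma gauss_commute: "gauss a (x - y) = gauss a (y - x)"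
  using gauss_even[of a "x - y"] by simp

lemma nn_integral_gauss [simp]:
  assumes "a > 0"
  shows "(\<integral>\<^sup>+ y. ennreal (gauss a (y :: 'a::euclidean_space)) \<partial>lborel) = 1"
proof -
  have "(\<integral>\<^sup>+ y. ennreal (gauss a (y :: 'a)) \<partial>lborel)
     = (\<integral>\<^sup>+ y. (\<Prod>b\<in>Basis. ennreal (normal_density 0 (sqrt a) (y \<bullet> b))) \<partial>(lborel::'a measure))"
    unfolding gauss_def by (subst prod_ennreal) auto
  also have "\<dots> = (\<Prod>b\<in>(Basis::'a set). (\<integral>\<^sup>+ y. ennreal (normal_density 0 (sqrt a) y) \<partial>lborel))"
    by (rule nn_integral_lborel_prod) auto
  also have "\<dots> = 1"
    using assms by (subst nn_integral_eq_integral) auto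
  finally show ?thesis .
qed

lemma integrable_gauss [simp]: "a > 0 \<Longrightarrow> integrable lborel (gauss a :: 'a::euclidean_space \<Rightarrow> real)"
  by (rule integrableI_nonneg) auto

lemma integral_gauss [simp]: "a > 0 \<Longrightarrow> (LINT y|lborel. gauss a (y :: 'a::euclidean_space)) = 1"
  using nn_integral_eq_integral[of lborel "gauss a :: 'a \<Rightarrow> real"]
  by (simp add: integral_nonneg_AE)

lemma norm_power2_sum: "(norm (y::'a::euclidean_space))\<^sup>2 = (\<Sum>b\<in>Basis. (y \<bullet> b)\<^sup>2)"
  unfolding power2_norm_eq_inner by (subst euclidean_inner) (simp add: power2_eq_square)

lemma gauss_eq:
  assumes "a > 0"
  shows "gauss a (y :: 'a::euclidean_space) = (2 * pi * a) powr (- real DIM('a) / 2) * exp (- (norm y)\<^sup>2 / (2 * a))"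
proof -
  have "gauss a y = (1 / sqrt (2 * pi * a)) ^ DIM('a) * exp (\<Sum>b\<in>Basis. - (y \<bullet> b)\<^sup>2 / (2 * a))"
  proof -
    have "normal_density 0 (sqrt a) (y \<bullet> b) = 1 / sqrt (2 * pi * a) * exp (- (y \<bullet> b)\<^sup>2 / (2 * a))" for b
      using assms by (simp add: normal_density_def)
    then show ?thesis
      by (simp only: gauss_def prod.distrib prod_constant exp_sum[OF finite_Basis])
  qed
  also have "(\<Sum>b\<in>Basis. - (y \<bullet> b)\<^sup>2 / (2 * a)) = - (norm y)\<^sup>2 / (2 * a)"
    unfolding norm_power2_sum by (simp only: minus_divide_left[symmetric] sum_negf sum_divide_distrib)
  also have "(1 / sqrt (2 * pi * a)) ^ DIM('a) = (2 * pi * a) powr (- real DIM('a) / 2)"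
  proof -
    define c where "c = 2 * pi * a"
    have c: "c > 0" using assms by (simp add: c_def)
    have "1 / sqrt c = c powr (- (1 / 2))"
      using c by (simp only: powr_minus_divide powr_half_sqrt less_imp_le)
    then have "(1 / sqrt c) ^ DIM('a) = (c powr (- (1 / 2))) powr real DIM('a)"
      using c by (simp add: powr_realpow)
    also have "\<dots> = c powr (- real DIM('a) / 2)"
      by (simp add: powr_powr)
    finally show ?thesis by (simp only: c_def)
  qed
  finally show ?thesis .
qed

text \<open>Substituting \<open>\<sigma> * t\<close> for \<open>t\<close> turns the integral into
  the characteristic function of the standard normal distribution at
  \<open>\<sigma> * y\<close>.\<close>

lemma normal_density_cis:
  assumes "\<sigma> > 0"
  shows "integrable lborel (\<lambda>t. cis (t * y) * of_real (normal_density 0 \<sigma> t))"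
    and "(LINT t|lborel. cis (t * y) * of_real (normal_density 0 \<sigma> t)) = of_real (exp (- (\<sigma> * y)\<^sup>2 / 2))"
proof -
  show 1: "integrable lborel (\<lambda>t. cis (t * y) * of_real (normal_density 0 \<sigma> t))"
    by (rule Bochner_Integration.integrable_bound[where f = "normal_density 0 \<sigma>"]) (use assms in \<open>auto simp: norm_mult\<close>)
  have nd: "of_real \<sigma> * (cis (\<sigma> * t * y) * of_real (normal_density 0 \<sigma> (\<sigma> * t))) = std_normal_density t *\<^sub>R cis (\<sigma> * y * t)" for t
    using assms by (simp add: normal_density_def scaleR_conv_of_real power_mult_distrib real_sqrt_mult mult_ac)
  have "(LINT t|lborel. cis (t * y) * of_real (normal_density 0 \<sigma> t))
     = \<sigma> *\<^sub>R (LINT t|lborel. cis ((0 + \<sigma> * t) * y) * of_real (normal_density 0 \<sigma> (0 + \<sigma> * t)))"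
    using assms by (subst lborel_integral_real_affine[of \<sigma> _ 0]) auto
  also have "\<dots> = (LINT t|lborel. std_normal_density t *\<^sub>R cis (\<sigma> * y * t))"
    by (simp add: scaleR_conv_of_real nd flip: integral_mult_right_zero)
  also have "\<dots> = char std_normal_distribution (\<sigma> * y)"
    unfolding char_def cis_conv_exp by (subst integral_density) auto
  finally show "(LINT t|lborel. cis (t * y) * of_real (normal_density 0 \<sigma> t)) = of_real (exp (- (\<sigma> * y)\<^sup>2 / 2))"
    by (simp add: char_std_normal_distribution)
qed

lemma fourier_gauss:
  fixes y :: "'a::euclidean_space"
  assumes "a > 0"
  shows "integrable lborel (\<lambda>t. cis (t \<bullet> y) * of_real (gauss a t))"
    and "(LINT t|lborel. cis (t \<bullet> y) * of_real (gauss a t)) = of_real (exp (- a * (norm y)\<^sup>2 / 2))"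
proof -
  have cis_sum: "cis (sum f A) = (\<Prod>b\<in>A. cis (f b))" if "finite A" for f :: "'a \<Rightarrow> real" and A
    using that by (induction rule: finite_induct) (auto simp flip: cis_mult)
  have eq: "cis (t \<bullet> y) * of_real (gauss a t) = (\<Prod>b\<in>Basis. cis ((t \<bullet> b) * (y \<bullet> b)) * of_real (normal_density 0 (sqrt a) (t \<bullet> b)))" for t
    by (subst euclidean_inner) (simp add: cis_sum gauss_def prod.distrib)
  note nd = normal_density_cis[of "sqrt a"]
  show "integrable lborel (\<lambda>t. cis (t \<bullet> y) * of_real (gauss a t))"
    unfolding eq by (rule lborel_integral_prod) (use nd assms in auto)
  have "(LINT t|lborel. cis (t \<bullet> y) * of_real (gauss a t)) = (\<Prod>b\<in>Basis. complex_of_real (exp (- (sqrt a * (y \<bullet> b))\<^sup>2 / 2)))"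
    unfolding eq by (subst lborel_integral_prod(2)) (use nd assms in auto)
  also have "\<dots> = of_real (exp (\<Sum>b\<in>Basis. - a * (y \<bullet> b)\<^sup>2 / 2))"
    using assms by (simp add: exp_sum power_mult_distrib)
  also have "(\<Sum>b\<in>Basis. - a * (y \<bullet> b)\<^sup>2 / 2) = - a * (norm y)\<^sup>2 / 2"
    unfolding norm_power2_sum by (simp only: sum_distrib_left sum_divide_distrib)
  finally show "(LINT t|lborel. cis (t \<bullet> y) * of_real (gauss a t)) = of_real (exp (- a * (norm y)\<^sup>2 / 2))" .
qed

text \<open>The exponential is a multiple of \<open>gauss (1 / a)\<close>, so its transform is again
  Gaussian, of variance \<open>a\<close>. As \<open>a\<close> tends to 0 the exponential tends to 1
  while its transform concentrates at the origin; this pair drives every regularization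
  below.\<close>

lemma fourier_exp_square:
  fixes y :: "'a::euclidean_space"
  assumes "a > 0"
  shows "integrable lborel (\<lambda>t. cis (t \<bullet> y) * of_real (exp (- a * (norm t)\<^sup>2 / 2)))"
    and "(LINT t|lborel. cis (t \<bullet> y) * of_real (exp (- a * (norm t)\<^sup>2 / 2))) = of_real ((2 * pi) ^ DIM('a) * gauss a y)"
    and "integrable lborel (\<lambda>t::'a. exp (- a * (norm t)\<^sup>2 / 2))"
proof -
  let ?c = "(2 * pi / a) powr (real DIM('a) / 2)"
  have eq: "exp (- a * (norm t)\<^sup>2 / 2) = ?c * gauss (1 / a) t" for t :: 'a
    using assms by (simp add: gauss_eq powr_minus mult.commute)
  show "integrable lborel (\<lambda>t. cis (t \<bullet> y) * of_real (exp (- a * (norm t)\<^sup>2 / 2)))"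
    using integrable_mult_left[OF fourier_gauss(1)[of "1/a" y], of "of_real ?c"] assms
    unfolding eq by (simp add: mult_ac)
  show "integrable lborel (\<lambda>t::'a. exp (- a * (norm t)\<^sup>2 / 2))"
    using assms unfolding eq by (auto simp: mult_ac)
  have "(LINT t|lborel. cis (t \<bullet> y) * of_real (exp (- a * (norm t)\<^sup>2 / 2)))
    = of_real ?c * (LINT t|lborel. cis (t \<bullet> y) * of_real (gauss (1/a) t))"
    unfolding eq by (subst integral_mult_right_zero[symmetric]) (simp add: mult_ac)
  also have "\<dots> = of_real (?c * exp (- (1/a) * (norm y)\<^sup>2 / 2))"
    using assms by (simp add: fourier_gauss(2))
  also have "?c * exp (- (1/a) * (norm y)\<^sup>2 / 2) = (2 * pi) ^ DIM('a) * gauss a y"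
  proof -
    have "(2 * pi) ^ DIM('a) * (2 * pi * a) powr (- real DIM('a) / 2) = (2 * pi) powr (real DIM('a)) * ((2 * pi) powr (- real DIM('a) / 2) * a powr (- real DIM('a) / 2))"
      using assms by (simp add: powr_realpow powr_mult)
    also have "\<dots> = (2 * pi) powr (real DIM('a) / 2) * a powr (- real DIM('a) / 2)"
      by (simp flip: powr_add mult.assoc)
    also have "\<dots> = ?c"
      using assms by (simp add: powr_divide powr_minus_divide)
    finally have "(2 * pi) ^ DIM('a) * (2 * pi * a) powr (- real DIM('a) / 2) = ?c" .
    moreover have "- (1/a) * (norm y)\<^sup>2 / 2 = - (norm y)\<^sup>2 / (2 * a)" by simp
    ultimately show ?thesis
      unfolding gauss_eq[OF assms] by (simp only: mult.assoc[symmetric])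
  qed
  finally show "(LINT t|lborel. cis (t \<bullet> y) * of_real (exp (- a * (norm t)\<^sup>2 / 2))) = of_real ((2 * pi) ^ DIM('a) * gauss a y)" .
qed

section \<open>A Plancherel inequality for general phases\<close>

lemma (in pair_sigma_finite) integrable_tensor:
  fixes f :: "'a \<Rightarrow> complex" and g :: "'b \<Rightarrow> complex"
  assumes f: "integrable M1 f" and g: "integrable M2 g"
  shows "integrable (M1 \<Otimes>\<^sub>M M2) (\<lambda>p. f (fst p) * g (snd p))"
    and "(LINT p|(M1 \<Otimes>\<^sub>M M2). f (fst p) * g (snd p)) = integral\<^sup>L M1 f * integral\<^sup>L M2 g"
proof -
  note [measurable] = borel_measurable_integrable[OF f] borel_measurable_integrable[OF g]
  show 1: "integrable (M1 \<Otimes>\<^sub>M M2) (\<lambda>p. f (fst p) * g (snd p))"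
    by (rule Fubini_integrable) (use f g in \<open>auto simp: norm_mult\<close>)
  show "(LINT p|(M1 \<Otimes>\<^sub>M M2). f (fst p) * g (snd p)) = integral\<^sup>L M1 f * integral\<^sup>L M2 g"
    by (subst integral_fst'[OF 1, symmetric]) simp
qed

text \<open>From \<open>(c * b - a * d)\<^sup>2 \<ge> 0\<close>. Each weight is paired with the
  density in the other variable, which gives the symmetric form of Schur's test.\<close>

lemma mult_le_half_sum_squares:
  fixes a b c d :: real
  assumes "0 \<le> a" "0 \<le> b" "0 \<le> c" "0 \<le> d"
  shows "(a * b) * (c * d) \<le> (c\<^sup>2 * b\<^sup>2 + a\<^sup>2 * d\<^sup>2) / 2"
  using zero_le_power2[of "c * b - a * d"] by (simp add: power2_diff power_mult_distrib algebra_simps)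

text \<open>Regularizing by \<open>exp (- a * (norm t)\<^sup>2 / 2)\<close> turns the integral over \<open>t\<close> into a Gaussian
  kernel in \<open>\<psi> \<eta> - \<psi> \<eta>'\<close>, to which Schur's test with weights \<open>w\<close> and \<open>\<kappa>\<close> applies.\<close>

lemma nn_integral_norm_fourier_le:
  fixes \<psi> :: "'m \<Rightarrow> 'b::euclidean_space" and k :: "'m \<Rightarrow> complex" and w \<kappa> :: "'m \<Rightarrow> real"
  assumes "sigma_finite_measure M"
    and [measurable]: "\<psi> \<in> borel_measurable M" "w \<in> borel_measurable M" "\<kappa> \<in> borel_measurable M"
    and k: "integrable M k"
    and nonneg: "\<And>\<eta>. 0 \<le> w \<eta>" "\<And>\<eta>. 0 \<le> \<kappa> \<eta>"
    and bound: "\<And>\<eta>. norm (k \<eta>) \<le> w \<eta> * \<kappa> \<eta>"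
    and B: "\<And>a y. a > 0 \<Longrightarrow> (\<integral>\<^sup>+ \<eta>. ennreal ((w \<eta>)\<^sup>2) * ennreal (gauss a (\<psi> \<eta> - y)) \<partial>M) \<le> B"
  shows "(\<integral>\<^sup>+ t. ennreal ((norm (LINT \<eta>|M. cis (t \<bullet> \<psi> \<eta>) * k \<eta>))\<^sup>2) \<partial>lborel)
    \<le> ennreal ((2 * pi) ^ DIM('b)) * B * (\<integral>\<^sup>+ \<eta>. ennreal ((\<kappa> \<eta>)\<^sup>2) \<partial>M)"
proof -
  interpret M: sigma_finite_measure M by fact
  interpret MM: pair_sigma_finite M M ..
  interpret MMs: sigma_finite_measure "M \<Otimes>\<^sub>M M" ..
  interpret L: pair_sigma_finite "lborel :: 'b measure" "M \<Otimes>\<^sub>M M" ..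
  have [measurable]: "k \<in> borel_measurable M" using k by auto
  define K where "K t = (LINT \<eta>|M. cis (t \<bullet> \<psi> \<eta>) * k \<eta>)" for t
  have [measurable]: "K \<in> borel_measurable lborel"
    unfolding K_def by measurable
  have ik: "integrable M (\<lambda>\<eta>. cis (t \<bullet> \<psi> \<eta>) * k \<eta>)" for t
    by (rule Bochner_Integration.integrable_bound[OF k]) (auto simp: norm_mult)
  define K2 where "K2 p = k (fst p) * cnj (k (snd p))" for p
  have iK2: "integrable (M \<Otimes>\<^sub>M M) K2"
    unfolding K2_def by (rule MM.integrable_tensor(1)[of k "\<lambda>x. cnj (k x)"]) (use k in auto)
  note [measurable] = borel_measurable_integrable[OF iK2]
  let ?S = "\<integral>\<^sup>+ \<eta>. ennreal ((\<kappa> \<eta>)\<^sup>2) \<partial>M"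
  have sq: "of_real ((norm (K t))\<^sup>2) = (LINT p|(M \<Otimes>\<^sub>M M). cis (t \<bullet> (\<psi> (fst p) - \<psi> (snd p))) * K2 p)" for t
  proof -
    have "of_real ((norm (K t))\<^sup>2) = K t * cnj (K t)"
      by (rule complex_norm_square)
    also have "cnj (K t) = (LINT \<eta>|M. cnj (cis (t \<bullet> \<psi> \<eta>) * k \<eta>))"
      unfolding K_def by (rule Bochner_Integration.integral_cnj[symmetric])
    also have "K t * \<dots> = (LINT p|(M \<Otimes>\<^sub>M M). (cis (t \<bullet> \<psi> (fst p)) * k (fst p)) * cnj (cis (t \<bullet> \<psi> (snd p)) * k (snd p)))"
      unfolding K_def by (rule MM.integrable_tensor(2)[symmetric]) (use ik in \<open>auto simp del: complex_cnj_mult\<close>)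
    also have "\<dots> = (LINT p|(M \<Otimes>\<^sub>M M). cis (t \<bullet> (\<psi> (fst p) - \<psi> (snd p))) * K2 p)"
    proof (rule Bochner_Integration.integral_cong[OF refl])
      fix p
      have "cis (t \<bullet> (\<psi> (fst p) - \<psi> (snd p))) = cis (t \<bullet> \<psi> (fst p)) * cnj (cis (t \<bullet> \<psi> (snd p)))"
        by (simp add: cis_cnj cis_mult inner_diff_right)
      then show "(cis (t \<bullet> \<psi> (fst p)) * k (fst p)) * cnj (cis (t \<bullet> \<psi> (snd p)) * k (snd p))
          = cis (t \<bullet> (\<psi> (fst p) - \<psi> (snd p))) * K2 p"
        by (simp only: K2_def complex_cnj_mult mult_ac)
    qed
    finally show ?thesis .
  qed
  have reg: "(\<integral>\<^sup>+ t. ennreal ((norm (K t))\<^sup>2 * exp (- a * (norm t)\<^sup>2 / 2)) \<partial>lborel)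
     \<le> ennreal ((2 * pi) ^ DIM('b)) * B * ?S" if a: "a > 0" for a
  proof -
    let ?e = "\<lambda>t::'b. exp (- a * (norm t)\<^sup>2 / 2)"
    let ?X = "\<integral>\<^sup>+ x. \<integral>\<^sup>+ y. ennreal ((\<kappa> x)\<^sup>2) * (ennreal ((w y)\<^sup>2) * ennreal (gauss a (\<psi> y - \<psi> x))) \<partial>M \<partial>M"
    let ?F = "\<lambda>q. of_real (?e (fst q)) * cis (fst q \<bullet> (\<psi> (fst (snd q)) - \<psi> (snd (snd q)))) * K2 (snd q)"
    have iF: "integrable (lborel \<Otimes>\<^sub>M (M \<Otimes>\<^sub>M M)) ?F"
      by (rule Bochner_Integration.integrable_bound[OF L.integrable_tensor(1)[of "\<lambda>t. of_real (?e t)" K2]])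
         (use fourier_exp_square(3)[OF a] iK2 in \<open>auto simp: norm_mult\<close>)
    have eK: "of_real (?e t * (norm (K t))\<^sup>2) = (LINT p|(M \<Otimes>\<^sub>M M). ?F (t, p))" for t
      unfolding of_real_mult sq by (subst integral_mult_right_zero[symmetric]) (simp add: mult_ac)
    have ieK: "integrable lborel (\<lambda>t. ?e t * (norm (K t))\<^sup>2)"
      using L.integrable_fst'[OF iF] unfolding eK[symmetric] by (simp only: complex_of_real_integrable_eq)
    have gp: "(LINT t|lborel. ?F (t, p)) = of_real ((2 * pi) ^ DIM('b) * gauss a (\<psi> (fst p) - \<psi> (snd p))) * K2 p" for p
      unfolding fourier_exp_square(2)[OF a, symmetric]
      by (subst integral_mult_left_zero[symmetric]) (simp add: mult_ac)
    have "integrable (M \<Otimes>\<^sub>M M) (\<lambda>p. LINT t|lborel. ?F (t, p))"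
      by (rule L.integrable_snd) (use iF in \<open>simp add: case_prod_beta'\<close>)
    then have iR: "integrable (M \<Otimes>\<^sub>M M) (\<lambda>p. of_real ((2 * pi) ^ DIM('b) * gauss a (\<psi> (fst p) - \<psi> (snd p))) * K2 p)"
      unfolding gp .
    have "complex_of_real (LINT t|lborel. ?e t * (norm (K t))\<^sup>2) = (LINT t|lborel. LINT p|(M \<Otimes>\<^sub>M M). ?F (t, p))"
      unfolding eK[symmetric] by (rule integral_complex_of_real[symmetric])
    also have "\<dots> = (LINT p|(M \<Otimes>\<^sub>M M). LINT t|lborel. ?F (t, p))"
      using L.Fubini_integral[of "\<lambda>t p. ?F (t, p)"] iF by (simp add: case_prod_beta')
    also have "\<dots> = (LINT p|(M \<Otimes>\<^sub>M M). of_real ((2 * pi) ^ DIM('b) * gauss a (\<psi> (fst p) - \<psi> (snd p))) * K2 p)" (is "_ = ?R")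
      unfolding gp ..
    finally have eq: "complex_of_real (LINT t|lborel. ?e t * (norm (K t))\<^sup>2) = ?R" .
    have "(\<integral>\<^sup>+ t. ennreal ((norm (K t))\<^sup>2 * ?e t) \<partial>lborel) = ennreal (LINT t|lborel. ?e t * (norm (K t))\<^sup>2)"
      using ieK by (subst nn_integral_eq_integral[symmetric]) (auto simp: mult.commute)
    also have "\<dots> = ennreal (norm ?R)"
      unfolding eq[symmetric] by (simp add: integral_nonneg_AE)
    also have "\<dots> \<le> (\<integral>\<^sup>+ p. ennreal (norm (of_real ((2 * pi) ^ DIM('b) * gauss a (\<psi> (fst p) - \<psi> (snd p))) * K2 p)) \<partial>(M \<Otimes>\<^sub>M M))"
      by (rule integral_norm_bound_ennreal[OF iR])
    also have "\<dots> = (\<integral>\<^sup>+ x. \<integral>\<^sup>+ y. ennreal (norm (of_real ((2 * pi) ^ DIM('b) * gauss a (\<psi> x - \<psi> y)) * (k x * cnj (k y)))) \<partial>M \<partial>M)"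
      unfolding K2_def by (subst M.nn_integral_fst[symmetric]) auto
    also have "\<dots> \<le> (\<integral>\<^sup>+ x. \<integral>\<^sup>+ y. ennreal ((2 * pi) ^ DIM('b) / 2) *
        (ennreal ((\<kappa> x)\<^sup>2) * (ennreal ((w y)\<^sup>2) * ennreal (gauss a (\<psi> y - \<psi> x)))
        + ennreal ((\<kappa> y)\<^sup>2) * (ennreal ((w x)\<^sup>2) * ennreal (gauss a (\<psi> x - \<psi> y)))) \<partial>M \<partial>M)"
    proof (intro nn_integral_mono)
      fix x y
      have "norm (k x) * norm (k y) \<le> (w x * \<kappa> x) * (w y * \<kappa> y)"
        by (intro mult_mono bound) (auto simp: nonneg)
      also have "\<dots> \<le> ((w y)\<^sup>2 * (\<kappa> x)\<^sup>2 + (w x)\<^sup>2 * (\<kappa> y)\<^sup>2) / 2"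
        by (rule mult_le_half_sum_squares) (auto simp: nonneg)
      finally have le: "norm (k x) * norm (k y) \<le> ((w y)\<^sup>2 * (\<kappa> x)\<^sup>2 + (w x)\<^sup>2 * (\<kappa> y)\<^sup>2) / 2" .
      have "ennreal (norm (of_real (C * gauss a (\<psi> x - \<psi> y)) * (k x * cnj (k y))))
        \<le> ennreal (C / 2) * (ennreal ((\<kappa> x)\<^sup>2) * (ennreal ((w y)\<^sup>2) * ennreal (gauss a (\<psi> y - \<psi> x)))
        + ennreal ((\<kappa> y)\<^sup>2) * (ennreal ((w x)\<^sup>2) * ennreal (gauss a (\<psi> x - \<psi> y))))"
        if C: "C \<ge> 0" for C
      proof -
        have "norm (of_real (C * gauss a (\<psi> x - \<psi> y)) * (k x * cnj (k y))) = C * gauss a (\<psi> x - \<psi> y) * (norm (k x) * norm (k y))"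
          using C by (simp add: norm_mult)
        also have "\<dots> \<le> C * gauss a (\<psi> x - \<psi> y) * (((w y)\<^sup>2 * (\<kappa> x)\<^sup>2 + (w x)\<^sup>2 * (\<kappa> y)\<^sup>2) / 2)"
          using le C by (intro mult_left_mono) auto
        also have "\<dots> = C / 2 * ((\<kappa> x)\<^sup>2 * ((w y)\<^sup>2 * gauss a (\<psi> y - \<psi> x)) + (\<kappa> y)\<^sup>2 * ((w x)\<^sup>2 * gauss a (\<psi> x - \<psi> y)))"
          by (simp add: gauss_commute[of a "\<psi> y"] algebra_simps)
        finally show ?thesis
          using C by (simp flip: ennreal_mult ennreal_plus)
      qed
      from this[of "(2 * pi) ^ DIM('b)"] show "ennreal (norm (of_real ((2 * pi) ^ DIM('b) * gauss a (\<psi> x - \<psi> y)) * (k x * cnj (k y))))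
        \<le> ennreal ((2 * pi) ^ DIM('b) / 2) *
        (ennreal ((\<kappa> x)\<^sup>2) * (ennreal ((w y)\<^sup>2) * ennreal (gauss a (\<psi> y - \<psi> x)))
        + ennreal ((\<kappa> y)\<^sup>2) * (ennreal ((w x)\<^sup>2) * ennreal (gauss a (\<psi> x - \<psi> y))))"
        by simp
    qed
    also have "\<dots> = ennreal ((2 * pi) ^ DIM('b) / 2) *
       ((\<integral>\<^sup>+ x. \<integral>\<^sup>+ y. ennreal ((\<kappa> x)\<^sup>2) * (ennreal ((w y)\<^sup>2) * ennreal (gauss a (\<psi> y - \<psi> x))) \<partial>M \<partial>M)
       + (\<integral>\<^sup>+ x. \<integral>\<^sup>+ y. ennreal ((\<kappa> y)\<^sup>2) * (ennreal ((w x)\<^sup>2) * ennreal (gauss a (\<psi> x - \<psi> y))) \<partial>M \<partial>M))"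
      by (simp add: nn_integral_cmult nn_integral_add)
    also have "(\<integral>\<^sup>+ x. \<integral>\<^sup>+ y. ennreal ((\<kappa> y)\<^sup>2) * (ennreal ((w x)\<^sup>2) * ennreal (gauss a (\<psi> x - \<psi> y))) \<partial>M \<partial>M)
      = (\<integral>\<^sup>+ x. \<integral>\<^sup>+ y. ennreal ((\<kappa> x)\<^sup>2) * (ennreal ((w y)\<^sup>2) * ennreal (gauss a (\<psi> y - \<psi> x))) \<partial>M \<partial>M)"
      by (rule MM.Fubini') measurable
    finally have le: "(\<integral>\<^sup>+ t. ennreal ((norm (K t))\<^sup>2 * ?e t) \<partial>lborel) \<le> ennreal ((2 * pi) ^ DIM('b) / 2) * (?X + ?X)" .
    \<comment> \<open>The hypothesis on \<open>B\<close> is applied with the Gaussian centred at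
      \<open>\<psi> x\<close>; its uniformity in the centre is what lets the inner integral be
      pulled out.\<close>
    have "?X \<le> (\<integral>\<^sup>+ x. ennreal ((\<kappa> x)\<^sup>2) * B \<partial>M)"
      by (intro nn_integral_mono) (auto simp: nn_integral_cmult intro!: mult_left_mono B a)
    also have "\<dots> = B * ?S"
      by (subst nn_integral_multc) (simp_all add: mult.commute)
    finally have X: "?X \<le> B * ?S" .
    note le
    also have "ennreal ((2 * pi) ^ DIM('b) / 2) * (?X + ?X) \<le> ennreal ((2 * pi) ^ DIM('b) / 2) * (B * ?S + B * ?S)"
      by (intro mult_left_mono add_mono X) simp
    also have "\<dots> = ennreal ((2 * pi) ^ DIM('b)) * B * ?S"
    proof -
      have "ennreal ((2 * pi) ^ DIM('b) / 2) * (B * ?S + B * ?S) = ennreal ((2 * pi) ^ DIM('b) / 2) * ennreal 2 * (B * ?S)"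
        by (simp only: mult_2[symmetric] mult.assoc ennreal_numeral)
      also have "ennreal ((2 * pi) ^ DIM('b) / 2) * ennreal 2 = ennreal ((2 * pi) ^ DIM('b))"
        by (subst ennreal_mult[symmetric]) auto
      finally show ?thesis by (simp add: mult.assoc)
    qed
    finally show ?thesis .
  qed
  \<comment> \<open>Fatou along \<open>a = 1 / (n + 1)\<close> removes the regularization, since the
    bound just obtained is independent of \<open>a\<close>.\<close>
  have "(\<integral>\<^sup>+ t. ennreal ((norm (K t))\<^sup>2) \<partial>lborel)
     = (\<integral>\<^sup>+ t. liminf (\<lambda>n. ennreal ((norm (K t))\<^sup>2 * exp (- (1 / real (Suc n)) * (norm t)\<^sup>2 / 2))) \<partial>lborel)"
  proof (rule nn_integral_cong)
    fix t :: 'b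
    have "(\<lambda>n. (norm (K t))\<^sup>2 * exp (- (1 / real (Suc n)) * (norm t)\<^sup>2 / 2)) \<longlonglongrightarrow> (norm (K t))\<^sup>2 * exp (- 0 * (norm t)\<^sup>2 / 2)"
      by (intro tendsto_intros LIMSEQ_Suc[OF lim_1_over_n]) auto
    then have "(\<lambda>n. ennreal ((norm (K t))\<^sup>2 * exp (- (1 / real (Suc n)) * (norm t)\<^sup>2 / 2))) \<longlonglongrightarrow> ennreal ((norm (K t))\<^sup>2)"
      by (intro tendsto_ennrealI) simp
    then show "ennreal ((norm (K t))\<^sup>2) = liminf (\<lambda>n. ennreal ((norm (K t))\<^sup>2 * exp (- (1 / real (Suc n)) * (norm t)\<^sup>2 / 2)))"
      by (intro lim_imp_Liminf[symmetric]) simp_all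
  qed
  also have "\<dots> \<le> liminf (\<lambda>n. \<integral>\<^sup>+ t. ennreal ((norm (K t))\<^sup>2 * exp (- (1 / real (Suc n)) * (norm t)\<^sup>2 / 2)) \<partial>lborel)"
    by (rule nn_integral_liminf) measurable
  also have "\<dots> \<le> ennreal ((2 * pi) ^ DIM('b)) * B * ?S"
    by (intro Liminf_le always_eventually allI reg) simp_all
  finally show ?thesis unfolding K_def .
qed

lemma ennreal_le_suminf:
  fixes f :: "nat \<Rightarrow> ennreal"
  shows "f k \<le> (\<Sum>k. f k)"
  using sum_le_suminf[of f "{k}"] by simp

lemma suminf_ennreal_geometric:
  assumes "0 \<le> c" "0 \<le> x" "x < 1"
  shows "(\<Sum>k. ennreal (c * x ^ k)) = ennreal (c / (1 - x))"
  using sums_mult[OF geometric_sums[of x], of c] assms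
  by (intro suminf_ennreal_eq) auto

section \<open>Uniqueness and completeness\<close>

lemma nn_integral_lborel_affine:
  fixes t :: "'a::euclidean_space"
  assumes c: "c \<noteq> 0" and [measurable]: "f \<in> borel_measurable borel"
  shows "(\<integral>\<^sup>+ x. f x \<partial>lborel) = ennreal (\<bar>c\<bar> ^ DIM('a)) * (\<integral>\<^sup>+ x. f (t + c *\<^sub>R x) \<partial>lborel)"
  by (subst lborel_affine[OF c, of t])
     (simp add: nn_integral_density nn_integral_distr nn_integral_cmult)

lemma integral_lborel_affine:
  fixes t :: "'a::euclidean_space" and f :: "'a \<Rightarrow> 'b::{banach, second_countable_topology}"
  assumes c: "c \<noteq> 0" and [measurable]: "f \<in> borel_measurable borel"
  shows "(LINT x|lborel. f x) = \<bar>c\<bar> ^ DIM('a) *\<^sub>R (LINT x|lborel. f (t + c *\<^sub>R x))"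
  by (subst lborel_affine[OF c, of t])
     (simp add: integral_density integral_distr)

lemma integrable_lborel_affine:
  fixes t :: "'a::euclidean_space" and f :: "'a \<Rightarrow> 'b::{banach, second_countable_topology}"
  assumes c: "c \<noteq> 0" and f: "integrable lborel f"
  shows "integrable lborel (\<lambda>x. f (t + c *\<^sub>R x))"
proof -
  have [measurable]: "f \<in> borel_measurable borel" using f by auto
  have "integrable (density (distr lborel borel (\<lambda>x. t + c *\<^sub>R x)) (\<lambda>_. \<bar>c\<bar> ^ DIM('a))) f"
    using f by (subst (asm) lborel_affine[OF c, of t])
  then have "integrable (distr lborel borel (\<lambda>x. t + c *\<^sub>R x)) (\<lambda>x. \<bar>c\<bar> ^ DIM('a) *\<^sub>R f x)"
    by (subst (asm) integrable_density) auto
  then have "integrable lborel (\<lambda>x. \<bar>c\<bar> ^ DIM('a) *\<^sub>R f (t + c *\<^sub>R x))"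
    by (subst (asm) integrable_distr_eq) auto
  from integrable_scaleR_right[OF this, of "inverse (\<bar>c\<bar> ^ DIM('a))"] show ?thesis
    using c by simp
qed

lemma nn_integral_gauss_diff:
  fixes y :: "'a::euclidean_space"
  assumes "a > 0"
  shows "(\<integral>\<^sup>+ x. ennreal (gauss a (x - y)) \<partial>lborel) = 1"
  using nn_integral_lborel_affine[of 1 "\<lambda>x. ennreal (gauss a (x - y))" y] nn_integral_gauss[OF assms, where 'a='a]
  by simp

lemma gauss_scale:
  fixes z :: "'a::euclidean_space"
  assumes "c > 0"
  shows "gauss (c\<^sup>2) (c *\<^sub>R z) = gauss 1 z / c ^ DIM('a)"
proof -
  have "normal_density 0 (sqrt (c\<^sup>2)) (c *\<^sub>R z \<bullet> b) = normal_density 0 (sqrt 1) (z \<bullet> b) / c" for b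
    using assms by (simp add: normal_density_def power_mult_distrib real_sqrt_mult)
  then show ?thesis
    unfolding gauss_def by (simp only: prod_dividef prod_constant)
qed

lemma integral_gauss_scale:
  fixes x :: "'a::euclidean_space" and k :: "'a \<Rightarrow> complex"
  assumes c: "c > 0" and [measurable]: "k \<in> borel_measurable borel"
  shows "(LINT y|lborel. k y * of_real (gauss (c\<^sup>2) (x - y))) = (LINT z|lborel. k (x + c *\<^sub>R z) * of_real (gauss 1 z))"
proof -
  have "(LINT y|lborel. k y * of_real (gauss (c\<^sup>2) (x - y)))
    = \<bar>c\<bar> ^ DIM('a) *\<^sub>R (LINT z|lborel. k (x + c *\<^sub>R z) * of_real (gauss (c\<^sup>2) (x - (x + c *\<^sub>R z))))"
    using c by (intro integral_lborel_affine) auto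
  also have "\<dots> = (LINT z|lborel. k (x + c *\<^sub>R z) * of_real (gauss 1 z))"
    using c by (simp add: gauss_scale scaleR_conv_of_real)
  finally show ?thesis .
qed

text \<open>After the substitution \<open>y = x + c n *\<^sub>R z\<close> the kernel is the fixed
  density \<open>gauss 1\<close>, and dominated convergence applies with majorant
  \<open>M * gauss 1 z\<close>.\<close>

lemma gauss_approximate_identity:
  fixes x :: "'a::euclidean_space" and k :: "'a \<Rightarrow> complex"
  assumes k: "continuous_on UNIV k" and M: "\<And>x. norm (k x) \<le> M"
    and c: "\<And>n. c n > 0" "c \<longlonglongrightarrow> 0"
  shows "(\<lambda>n. LINT y|lborel. k y * of_real (gauss ((c n)\<^sup>2) (x - y))) \<longlonglongrightarrow> k x"
proof -
  have [measurable]: "k \<in> borel_measurable borel"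
    using k by (rule borel_measurable_continuous_onI)
  have "(\<lambda>n. LINT z|lborel. k (x + c n *\<^sub>R z) * of_real (gauss 1 z)) \<longlonglongrightarrow> (LINT z|lborel. k x * of_real (gauss 1 (z::'a)))"
  proof (rule integral_dominated_convergence)
    show "integrable lborel (\<lambda>z::'a. M * gauss 1 z)" by simp
    have "(\<lambda>n. k (x + c n *\<^sub>R z) * of_real (gauss 1 z)) \<longlonglongrightarrow> k (x + 0 *\<^sub>R z) * of_real (gauss 1 z)" for z
      by (intro tendsto_intros continuous_on_tendsto_compose[OF k] c) auto
    then show "AE z in lborel. (\<lambda>n. k (x + c n *\<^sub>R z) * of_real (gauss 1 z)) \<longlonglongrightarrow> k x * of_real (gauss 1 z)"
      by simp
    show "AE z in lborel. norm (k (x + c n *\<^sub>R z) * of_real (gauss 1 z)) \<le> M * gauss 1 z" for n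
      using M by (auto simp: norm_mult intro!: mult_right_mono)
  qed measurable
  then show ?thesis
    using c by (simp add: integral_gauss_scale)
qed

text \<open>The Gaussian is itself a Fourier integral of an integrable exponential. Fubini then
  writes the convolution as an average of values of the transform of \<open>v\<close>, all of which
  vanish.\<close>

lemma integral_mult_gauss_eq_0:
  fixes v :: "'a::euclidean_space \<Rightarrow> complex"
  assumes v: "integrable lborel v" and zero: "\<And>\<xi>. (LINT x|lborel. cis (x \<bullet> \<xi>) * v x) = 0"
    and a: "a > 0"
  shows "(LINT x|lborel. v x * of_real (gauss a (y - x))) = 0"
proof -
  have [measurable]: "v \<in> borel_measurable borel" using v by auto
  let ?e = "\<lambda>t::'a. exp (- a * (norm t)\<^sup>2 / 2)"
  let ?F = "\<lambda>p. (cis (snd p \<bullet> (y - fst p)) * of_real (?e (snd p))) * v (fst p)"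
  have iF: "integrable (lborel \<Otimes>\<^sub>M lborel) ?F"
    by (rule Bochner_Integration.integrable_bound[OF lborel_pair.integrable_tensor(1)[of v "\<lambda>t. of_real (?e t)"]])
       (use fourier_exp_square(3)[OF a] v in \<open>auto simp: norm_mult\<close>)
  have "of_real ((2 * pi) ^ DIM('a)) * (LINT x|lborel. v x * of_real (gauss a (y - x)))
     = (LINT x|lborel. v x * of_real ((2 * pi) ^ DIM('a) * gauss a (y - x)))"
    by (subst integral_mult_right_zero[symmetric]) (simp add: mult_ac)
  also have "\<dots> = (LINT x|lborel. LINT t|lborel. ?F (x, t))"
    unfolding fourier_exp_square(2)[OF a, symmetric]
    by (intro Bochner_Integration.integral_cong refl, subst integral_mult_right_zero[symmetric]) (simp add: mult_ac)
  also have "\<dots> = (LINT t|lborel. LINT x|lborel. ?F (x, t))"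
    using lborel_pair.Fubini_integral[of "\<lambda>x t. ?F (x, t)"] iF by (simp add: case_prod_beta')
  also have "\<dots> = (LINT t|lborel. (cis (t \<bullet> y) * of_real (?e t)) * (LINT x|lborel. cis (x \<bullet> (-t)) * v x))"
  proof (intro Bochner_Integration.integral_cong refl, subst integral_mult_right_zero[symmetric], intro Bochner_Integration.integral_cong refl)
    fix t x :: 'a
    have "cis (t \<bullet> (y - x)) = cis (t \<bullet> y) * cis (x \<bullet> (-t))"
      by (simp add: cis_mult inner_diff_right inner_commute)
    then show "?F (x, t) = (cis (t \<bullet> y) * of_real (?e t)) * (cis (x \<bullet> (-t)) * v x)"
      by (simp add: mult_ac)
  qed
  also have "\<dots> = 0" by (simp only: zero) simp
  finally show ?thesis by (simp only: mult_eq_0_iff of_real_eq_0_iff) simp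
qed

text \<open>The function \<open>v\<close> annihilates Gaussians, hence by mollification all bounded
  continuous functions, hence indicators of closed sets. The closed sets are stable under
  intersection and generate the Borel sets, so the integral of \<open>v\<close> over every Borel set
  is 0.\<close>

lemma fourier_eq_0_imp_AE_eq_0:
  fixes v :: "'a::euclidean_space \<Rightarrow> complex"
  assumes v: "integrable lborel v" and zero: "\<And>\<xi>. (LINT x|lborel. cis (x \<bullet> \<xi>) * v x) = 0"
  shows "AE x in lborel. v x = 0"
proof -
  have [measurable]: "v \<in> borel_measurable borel" using v by auto
  have cont: "(LINT x|lborel. v x * k x) = 0"
    if k: "continuous_on UNIV k" and M: "\<And>x. norm (k x) \<le> M" for k :: "'a \<Rightarrow> complex" and M
  proof -
    have [measurable]: "k \<in> borel_measurable borel"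
      using k by (rule borel_measurable_continuous_onI)
    let ?c = "\<lambda>n. 1 / real (Suc n)"
    have "M \<ge> 0" using M[of 0] norm_ge_zero order_trans by blast
    have z: "(LINT x|lborel. v x * (LINT y|lborel. k y * of_real (gauss a (x - y)))) = 0" if a: "a > 0" for a
    proof -
      let ?F = "\<lambda>p. v (fst p) * (k (snd p) * of_real (gauss a (fst p - snd p)))"
      have nn: "(\<integral>\<^sup>+ y. ennreal (gauss a (x - y)) \<partial>lborel) = 1" for x :: 'a
        using nn_integral_gauss_diff[OF a, of x] by (simp add: gauss_commute)
      have ig: "integrable lborel (\<lambda>y. gauss a (x - y))" for x :: 'a
        by (rule integrableI_nonneg) (use nn[of x] in auto)
      have ikg: "integrable lborel (\<lambda>y. k y * of_real (gauss a (x - y)))" for x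
        by (rule Bochner_Integration.integrable_bound[OF integrable_mult_right[OF ig[of x], of M]])
           (use M in \<open>auto simp: norm_mult \<open>M \<ge> 0\<close> intro!: mult_right_mono\<close>)
      have "(\<integral>\<^sup>+ p. ennreal (norm (?F p)) \<partial>(lborel \<Otimes>\<^sub>M lborel))
         = (\<integral>\<^sup>+ x. \<integral>\<^sup>+ y. ennreal (norm (v x * (k y * of_real (gauss a (x - y))))) \<partial>lborel \<partial>lborel)"
        by (subst lborel.nn_integral_fst[symmetric]) auto
      also have "\<dots> \<le> (\<integral>\<^sup>+ x. \<integral>\<^sup>+ y. ennreal (norm (v x)) * ennreal M * ennreal (gauss a (x - y)) \<partial>lborel \<partial>lborel)"
        by (intro nn_integral_mono)
           (auto simp: norm_mult \<open>M \<ge> 0\<close> mult.assoc simp flip: ennreal_mult intro!: ennreal_leI mult_left_mono mult_right_mono M)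
      also have "\<dots> = (\<integral>\<^sup>+ x. ennreal (norm (v x)) \<partial>lborel) * ennreal M"
        by (simp add: nn_integral_cmult nn nn_integral_multc)
      also have "\<dots> < \<infinity>"
        using v by (auto simp: ennreal_mult_less_top integrable_iff_bounded)
      finally have iF: "integrable (lborel \<Otimes>\<^sub>M lborel) ?F"
        by (intro integrableI_bounded) auto
      have "(LINT x|lborel. v x * (LINT y|lborel. k y * of_real (gauss a (x - y)))) = (LINT x|lborel. LINT y|lborel. ?F (x, y))"
        by simp
      also have "\<dots> = (LINT y|lborel. LINT x|lborel. ?F (x, y))"
        using lborel_pair.Fubini_integral[of "\<lambda>x y. ?F (x, y)"] iF by (simp add: case_prod_beta')
      also have "\<dots> = (LINT y|lborel. k y * (LINT x|lborel. v x * of_real (gauss a (y - x))))"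
        by (intro Bochner_Integration.integral_cong refl, subst integral_mult_right_zero[symmetric])
           (simp add: mult_ac gauss_commute[of a])
      also have "\<dots> = 0"
        by (subst integral_mult_gauss_eq_0[OF v zero a]) simp
      finally show ?thesis .
    qed
    have "(\<lambda>n. LINT x|lborel. v x * (LINT y|lborel. k y * of_real (gauss ((?c n)\<^sup>2) (x - y)))) \<longlonglongrightarrow> (LINT x|lborel. v x * k x)"
    proof (rule integral_dominated_convergence)
      show "integrable lborel (\<lambda>x. norm (v x) * M)" using v by simp
      show "AE x in lborel. (\<lambda>n. v x * (LINT y|lborel. k y * of_real (gauss ((?c n)\<^sup>2) (x - y)))) \<longlonglongrightarrow> v x * k x"
        by (intro AE_I2 tendsto_intros gauss_approximate_identity[OF k M] LIMSEQ_Suc[OF lim_1_over_n]) auto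
      show "AE x in lborel. norm (v x * (LINT y|lborel. k y * of_real (gauss ((?c n)\<^sup>2) (x - y)))) \<le> norm (v x) * M" for n
      proof (intro AE_I2)
        fix x
        have "norm (LINT z|lborel. k (x + ?c n *\<^sub>R z) * of_real (gauss 1 z)) \<le> (LINT z|lborel. M * gauss 1 (z::'a))"
        proof (rule Bochner_Integration.integral_norm_bound_integral)
          show "integrable lborel (\<lambda>z. k (x + ?c n *\<^sub>R z) * of_real (gauss 1 z))"
            by (rule Bochner_Integration.integrable_bound[OF integrable_mult_right[OF integrable_gauss[of 1], of M]])
               (use M \<open>M \<ge> 0\<close> in \<open>auto simp: norm_mult intro!: mult_right_mono\<close>)
        qed (use M in \<open>auto simp: norm_mult intro!: mult_right_mono\<close>)
        also have "\<dots> = M" by simp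
        finally have "norm (LINT y|lborel. k y * of_real (gauss ((?c n)\<^sup>2) (x - y))) \<le> M"
          by (subst integral_gauss_scale) auto
        then show "norm (v x * (LINT y|lborel. k y * of_real (gauss ((?c n)\<^sup>2) (x - y)))) \<le> norm (v x) * M"
          by (simp add: norm_mult mult_left_mono)
      qed
    qed measurable
    moreover have "(LINT x|lborel. v x * (LINT y|lborel. k y * of_real (gauss ((?c n)\<^sup>2) (x - y)))) = 0" for n
      by (rule z) simp
    ultimately show ?thesis by (simp only: LIMSEQ_const_iff)
  qed
  have tot: "(LINT x|lborel. v x) = 0"
    using cont[of "\<lambda>_. 1" 1] by simp
  have closed: "(LINT x:F|lborel. v x) = 0" if F: "closed F" for F
  proof (cases "F = {}")
    case False
    have [measurable]: "F \<in> sets borel" using F by (rule borel_closed)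
    have [measurable]: "(\<lambda>x. infdist x F) \<in> borel_measurable borel"
      by (intro borel_measurable_continuous_onI continuous_intros)
    \<comment> \<open>Lipschitz cut-offs equal to 1 on \<open>F\<close>; at a point off
      \<open>F\<close> they vanish from some \<open>n\<close> on, because its distance to the closed
      set is positive.\<close>
    let ?k = "\<lambda>n x. max 0 (1 - real n * infdist x F)"
    have "(\<lambda>n. LINT x|lborel. v x * of_real (?k n x)) \<longlonglongrightarrow> (LINT x|lborel. v x * of_real (indicator F x))"
    proof (rule integral_dominated_convergence)
      show "integrable lborel (\<lambda>x. norm (v x))" using v by simp
      have lim: "(\<lambda>n. ?k n x) \<longlonglongrightarrow> indicator F x" for x
      proof (cases "x \<in> F")
        case False
        then have "infdist x F > 0"
          using infdist_pos_not_in_closed F \<open>F \<noteq> {}\<close> by blast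
        then have "eventually (\<lambda>n. real n * infdist x F > 1) sequentially"
          by (intro eventually_compose_filterlim[OF eventually_gt_at_top] filterlim_at_top_mult_tendsto_pos[OF tendsto_const] filterlim_real_sequentially)
        then have "eventually (\<lambda>n. ?k n x = indicator F x) sequentially"
          by eventually_elim (use False in auto)
        then show ?thesis by (rule tendsto_eventually)
      qed auto
      show "AE x in lborel. (\<lambda>n. v x * of_real (?k n x)) \<longlonglongrightarrow> v x * of_real (indicator F x)"
        by (intro AE_I2 tendsto_intros lim)
      show "AE x in lborel. norm (v x * of_real (?k n x)) \<le> norm (v x)" for n
        by (auto simp: norm_mult infdist_nonneg intro!: mult_left_le)
    qed measurable
    moreover have "(LINT x|lborel. v x * of_real (?k n x)) = 0" for n
      by (rule cont[where M = 1]) (auto intro!: continuous_intros simp: infdist_nonneg)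
    ultimately have "(LINT x|lborel. v x * of_real (indicator F x)) = 0"
      by (simp add: LIMSEQ_const_iff)
    then show ?thesis
      by (simp add: set_lebesgue_integral_def scaleR_conv_of_real mult.commute)
  qed (simp add: set_lebesgue_integral_def)
  have "(LINT x:A|lborel. v x) = 0" if "A \<in> sets lborel" for A
  proof -
    have "Int_stable {S::'a set. closed S}" "{S::'a set. closed S} \<subseteq> Pow UNIV"
      by (auto simp: Int_stable_def)
    moreover have "A \<in> sigma_sets UNIV {S. closed S}"
      using that by (simp add: borel_eq_closed)
    ultimately show ?thesis
    proof (induction rule: sigma_sets_induct_disjoint)
      case (basic A) then show ?case using closed by simp
    next
      case empty show ?case by (simp add: set_lebesgue_integral_def)
    next
      case (compl A)
      have [measurable]: "A \<in> sets borel" using compl(1) by (simp add: borel_eq_closed)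
      have "(LINT x:UNIV - A|lborel. v x) = (LINT x|lborel. v x - indicator A x *\<^sub>R v x)"
        unfolding set_lebesgue_integral_def
        by (rule Bochner_Integration.integral_cong) (auto split: split_indicator)
      also have "\<dots> = (LINT x|lborel. v x) - (LINT x:A|lborel. v x)"
        unfolding set_lebesgue_integral_def
        by (rule Bochner_Integration.integral_diff[OF v integrable_mult_indicator[OF _ v]]) simp
      finally show ?case using tot compl(2) by simp
    next
      case (union A)
      then have A: "range A \<subseteq> sets lborel"
        by (auto simp: borel_eq_closed)
      have "(LINT x:(\<Union>i. A i)|lborel. v x) = (\<Sum>i. (LINT x:(A i)|lborel. v x))"
      proof (rule lebesgue_integral_countable_add)
        show "\<And>i j. i \<noteq> j \<Longrightarrow> A i \<inter> A j = {}" using union(1) by (auto simp: disjoint_family_on_def)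
        show "set_integrable lborel (\<Union>i. A i) v"
          unfolding set_integrable_def using A by (intro integrable_mult_indicator v) auto
      qed (use A in auto)
      then show ?case using union(3) by simp
    qed
  qed
  then show ?thesis by (intro sigma_finite_measure.density_zero[OF lborel.sigma_finite_measure_axioms v]) auto
qed

text \<open>Riesz--Fischer: a fast subsequence converges almost everywhere because
  \<open>\<Sum>k. 2 ^ k * (norm (F (r (k + 1)) x - F (r k) x))\<^sup>2\<close> is integrable.\<close>

lemma L2_complete:
  fixes F :: "nat \<Rightarrow> 'm \<Rightarrow> complex"
  assumes [measurable]: "\<And>n. F n \<in> borel_measurable M"
    and Cauchy: "\<And>e::real. e > 0 \<Longrightarrow> \<exists>N. \<forall>m\<ge>N. \<forall>n\<ge>N. (\<integral>\<^sup>+ x. ennreal ((norm (F m x - F n x))\<^sup>2) \<partial>M) \<le> ennreal e"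
  shows "\<exists>G\<in>borel_measurable M. (\<lambda>n. \<integral>\<^sup>+ x. ennreal ((norm (F n x - G x))\<^sup>2) \<partial>M) \<longlonglongrightarrow> 0"
proof -
  let ?d = "\<lambda>m n. \<integral>\<^sup>+ x. ennreal ((norm (F m x - F n x))\<^sup>2) \<partial>M"
  \<comment> \<open>The rate \<open>(1/4) ^ k\<close> beats the weight \<open>2 ^ k\<close> in
    \<open>D\<close> and leaves a geometric series of ratio 1/2; the pointwise increments then decay
    like \<open>sqrt (1/2) ^ k\<close>.\<close>
  have "\<forall>k. \<exists>N. \<forall>m\<ge>N. \<forall>n\<ge>N. ?d m n \<le> ennreal ((1/4) ^ k)"
    using Cauchy by simp
  then obtain N where N: "\<And>k m n. m \<ge> N k \<Longrightarrow> n \<ge> N k \<Longrightarrow> ?d m n \<le> ennreal ((1/4) ^ k)"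
    by metis
  \<comment> \<open>The \<open>max\<close> keeps \<open>r\<close> strictly increasing while reaching
    the threshold \<open>N k\<close>.\<close>
  define r where "r = rec_nat (N 0) (\<lambda>k rk. max (Suc rk) (N (Suc k)))"
  have r_Suc: "r (Suc k) > r k" and r_N: "r k \<ge> N k" for k
    by (auto simp: r_def split: nat.splits) (cases k; simp)
  have r: "strict_mono r" using r_Suc by (simp add: strict_mono_Suc_iff)
  define D where "D k x = ennreal (2 ^ k) * ennreal ((norm (F (r (Suc k)) x - F (r k) x))\<^sup>2)" for k x
  have [measurable]: "D k \<in> borel_measurable M" for k
    unfolding D_def by measurable
  have "(\<integral>\<^sup>+ x. (\<Sum>k. D k x) \<partial>M) = (\<Sum>k. \<integral>\<^sup>+ x. D k x \<partial>M)"
    by (rule nn_integral_suminf) simp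
  also have "\<dots> \<le> (\<Sum>k. ennreal ((1/2) ^ k))"
  proof (intro suminf_le summableI)
    fix k
    have "(\<integral>\<^sup>+ x. D k x \<partial>M) = ennreal (2 ^ k) * ?d (r (Suc k)) (r k)"
      unfolding D_def by (rule nn_integral_cmult) measurable
    also have "\<dots> \<le> ennreal (2 ^ k) * ennreal ((1/4) ^ k)"
      using r_N[of k] r_Suc[of k] by (intro mult_left_mono N) auto
    also have "\<dots> = ennreal ((1/2) ^ k)"
      by (simp flip: ennreal_mult power_mult_distrib)
    finally show "(\<integral>\<^sup>+ x. D k x \<partial>M) \<le> ennreal ((1/2) ^ k)" .
  qed
  also have "\<dots> = ennreal (1 / (1 - 1/2))"
    using suminf_ennreal_geometric[of 1 "1/2"] by (simp only: mult_1_left)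
  also have "\<dots> < \<infinity>" by simp
  finally have "(\<integral>\<^sup>+ x. (\<Sum>k. D k x) \<partial>M) \<noteq> \<infinity>"
    by simp
  then have fin: "AE x in M. (\<Sum>k. D k x) \<noteq> \<infinity>"
    by (rule nn_integral_PInf_AE[rotated]) measurable
  have conv: "AE x in M. convergent (\<lambda>k. F (r k) x)"
    using fin
  proof eventually_elim
    case (elim x)
    then obtain S where S: "S \<ge> 0" "(\<Sum>k. D k x) = ennreal S" by (cases "\<Sum>k. D k x") auto
    have le: "norm (F (r (Suc k)) x - F (r k) x) \<le> sqrt S * (sqrt (1/2)) ^ k" for k
    proof -
      have "D k x \<le> ennreal S"
        using ennreal_le_suminf[of "\<lambda>k. D k x" k] S(2) by simp
      then have "ennreal (2 ^ k * (norm (F (r (Suc k)) x - F (r k) x))\<^sup>2) \<le> ennreal S"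
        unfolding D_def by (subst ennreal_mult) auto
      then have "2 ^ k * (norm (F (r (Suc k)) x - F (r k) x))\<^sup>2 \<le> S"
        using S(1) by (simp add: ennreal_le_iff)
      then have "(norm (F (r (Suc k)) x - F (r k) x))\<^sup>2 \<le> S * (1/2) ^ k"
        by (simp add: field_simps power_divide)
      then have "norm (F (r (Suc k)) x - F (r k) x) \<le> sqrt (S * (1/2) ^ k)"
        by (rule real_le_rsqrt)
      then show ?thesis by (simp add: real_sqrt_mult real_sqrt_power)
    qed
    have "summable (\<lambda>k. F (r (Suc k)) x - F (r k) x)"
    proof (rule summable_comparison_test'[OF _ le])
      show "summable (\<lambda>k. sqrt S * (sqrt (1/2)) ^ k)"
        by (intro summable_mult summable_geometric) (auto simp: real_sqrt_divide)
    qed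
    then have "convergent (\<lambda>n. \<Sum>k<n. F (r (Suc k)) x - F (r k) x)"
      by (simp add: summable_iff_convergent)
    then have "convergent (\<lambda>n. F (r n) x - F (r 0) x)"
      using sum_lessThan_telescope[of "\<lambda>k. F (r k) x"] by simp
    then have "convergent (\<lambda>n. (F (r n) x - F (r 0) x) + F (r 0) x)"
      by (intro convergent_add convergent_const)
    then show ?case by simp
  qed
  define G where "G x = lim (\<lambda>k. F (r k) x)" for x
  have [measurable]: "G \<in> borel_measurable M"
    unfolding G_def by measurable
  have "(\<lambda>n. \<integral>\<^sup>+ x. ennreal ((norm (F n x - G x))\<^sup>2) \<partial>M) \<longlonglongrightarrow> 0"
  proof (rule tendsto_zero_ennreal)
    fix e :: real assume "e > 0"
    then obtain K where K: "\<And>m n. m \<ge> K \<Longrightarrow> n \<ge> K \<Longrightarrow> ?d m n \<le> ennreal (e/2)"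
      using Cauchy[of "e/2"] by auto
    \<comment> \<open>Fatou along the subsequence turns the Cauchy bound into a bound on the
      distance to the limit, now for the whole sequence. The margin \<open>e / 2\<close> makes the
      final inequality strict.\<close>
    have "(\<integral>\<^sup>+ x. ennreal ((norm (F n x - G x))\<^sup>2) \<partial>M) \<le> ennreal (e / 2)" if n: "n \<ge> K" for n
    proof -
      have "(\<integral>\<^sup>+ x. ennreal ((norm (F n x - G x))\<^sup>2) \<partial>M) = (\<integral>\<^sup>+ x. liminf (\<lambda>k. ennreal ((norm (F n x - F (r k) x))\<^sup>2)) \<partial>M)"
      proof (rule nn_integral_cong_AE)
        show "AE x in M. ennreal ((norm (F n x - G x))\<^sup>2) = liminf (\<lambda>k. ennreal ((norm (F n x - F (r k) x))\<^sup>2))"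
          using conv
        proof eventually_elim
          case (elim x)
          then have "(\<lambda>k. F (r k) x) \<longlonglongrightarrow> G x"
            unfolding G_def by (simp add: convergent_LIMSEQ_iff)
          then have "(\<lambda>k. ennreal ((norm (F n x - F (r k) x))\<^sup>2)) \<longlonglongrightarrow> ennreal ((norm (F n x - G x))\<^sup>2)"
            by (intro tendsto_intros)
          then show ?case by (intro lim_imp_Liminf[symmetric]) simp_all
        qed
      qed
      also have "\<dots> \<le> liminf (\<lambda>k. ?d n (r k))"
        by (rule nn_integral_liminf) measurable
      also have "\<dots> \<le> ennreal (e / 2)"
      proof (rule Liminf_le)
        have "eventually (\<lambda>k. k \<ge> K) sequentially" by (rule eventually_ge_at_top)
        then show "\<forall>\<^sub>F k in sequentially. ?d n (r k) \<le> ennreal (e / 2)"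
          by eventually_elim (use n seq_suble[OF r] in \<open>auto intro!: K intro: order_trans\<close>)
      qed simp
      finally show ?thesis .
    qed
    moreover have "ennreal (e/2) < ennreal e" using \<open>e > 0\<close> by (simp add: ennreal_less_iff)
    ultimately show "\<forall>\<^sub>F n in sequentially. (\<integral>\<^sup>+ x. ennreal ((norm (F n x - G x))\<^sup>2) \<partial>M) < ennreal e"
      by (intro eventually_sequentiallyI[of K]) (rule le_less_trans)
  qed
  then show ?thesis by (intro bexI[of _ G]) auto
qed

section \<open>Singular weights on slabs\<close>

lemma dyadic_shell:
  fixes y a :: real
  assumes "0 < y" "y \<le> a"
  obtains k where "a * (1/2) ^ Suc k < y" "y \<le> a * (1/2) ^ k"
proof -
  have a: "a > 0" using assms by linarith
  obtain n where "(1/2) ^ n < y / a"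
    using real_arch_pow_inv[of "y / a" "1/2"] assms a by auto
  then have n: "a * (1/2) ^ n < y" using a by (simp add: field_simps)
  define k where "k = (LEAST k. a * (1/2) ^ k < y)"
  have k: "a * (1/2) ^ k < y" unfolding k_def by (rule LeastI[of _ n]) (rule n)
  have "k \<noteq> 0" using k assms by (auto intro!: Nat.gr0I)
  then obtain m where m: "k = Suc m" by (cases k) auto
  have "\<not> a * (1/2) ^ m < y" using not_less_Least[of m "\<lambda>k. a * (1/2) ^ k < y"] m unfolding k_def by simp
  then show thesis using that[of m] k m by simp
qed

text \<open>On the shell between radii \<open>a / 2 ^ (k + 1)\<close> and \<open>a / 2 ^ k\<close>
  the weight is at most its value at the inner radius, whence \<open>2 powr p\<close>, and the
  enclosing ball has measure at most a multiple of its radius to the power \<open>q\<close>; the sum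
  is geometric with ratio \<open>(1/2) powr (q - p)\<close>. A general measure is allowed because
  the bound serves both \<open>lborel\<close>, with growth \<open>d\<close>, and slab measures, with
  growth \<open>d - 1\<close>.\<close>

lemma nn_integral_powr_cball_le:
  fixes \<mu> :: "'a::euclidean_space measure"
  assumes sets [measurable_cong]: "sets \<mu> = sets borel"
    and B: "\<And>R. R > 0 \<Longrightarrow> emeasure \<mu> (cball 0 R) \<le> B * ennreal (R powr q)"
    and pq: "0 \<le> p" "p < q" and a: "a > 0"
  shows "(\<integral>\<^sup>+ x. ennreal (norm x powr (- p)) * indicator (cball 0 a) x \<partial>\<mu>)
    \<le> B * ennreal (2 powr p / (1 - (1/2) powr (q - p)) * a powr (q - p))"
proof -
  let ?\<rho> = "\<lambda>k. a * (1/2) ^ k"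
  have \<rho>: "?\<rho> k > 0" for k using a by simp
  have [measurable]: "cball (0::'a) R \<in> sets borel" for R by (rule borel_closed) simp
  have "(\<integral>\<^sup>+ x. ennreal (norm x powr (- p)) * indicator (cball 0 a) x \<partial>\<mu>)
     \<le> (\<integral>\<^sup>+ x. (\<Sum>k. ennreal (?\<rho> (Suc k) powr (- p)) * indicator (cball 0 (?\<rho> k)) x) \<partial>\<mu>)"
  proof (rule nn_integral_mono)
    fix x
    show "ennreal (norm x powr (- p)) * indicator (cball 0 a) x \<le> (\<Sum>k. ennreal (?\<rho> (Suc k) powr (- p)) * indicator (cball 0 (?\<rho> k)) x)"
    proof (cases "x \<in> cball 0 a \<and> x \<noteq> 0")
      case True
      then obtain k where k: "?\<rho> (Suc k) < norm x" "norm x \<le> ?\<rho> k"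
        using dyadic_shell[of "norm x" a] by auto
      have "ennreal (norm x powr (- p)) * indicator (cball 0 a) x \<le> ennreal (?\<rho> (Suc k) powr (- p)) * indicator (cball 0 (?\<rho> k)) x"
        using k True pq \<rho>[of "Suc k"] by (auto intro!: ennreal_leI powr_mono2')
      also have "\<dots> \<le> (\<Sum>k. ennreal (?\<rho> (Suc k) powr (- p)) * indicator (cball 0 (?\<rho> k)) x)"
        by (rule ennreal_le_suminf)
      finally show ?thesis .
    qed auto
  qed
  also have "\<dots> = (\<Sum>k. \<integral>\<^sup>+ x. ennreal (?\<rho> (Suc k) powr (- p)) * indicator (cball 0 (?\<rho> k)) x \<partial>\<mu>)"
    by (rule nn_integral_suminf) measurable
  also have "\<dots> = (\<Sum>k. ennreal (?\<rho> (Suc k) powr (- p)) * emeasure \<mu> (cball 0 (?\<rho> k)))"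
    by (intro suminf_cong nn_integral_cmult_indicator) measurable
  also have "\<dots> \<le> (\<Sum>k. B * ennreal (2 powr p * a powr (q - p) * ((1/2) powr (q - p)) ^ k))"
  proof (intro suminf_le summableI)
    fix k
    have "?\<rho> (Suc k) powr (- p) * ?\<rho> k powr q = 2 powr p * a powr (q - p) * ((1/2) powr (q - p)) ^ k"
    proof -
      have "?\<rho> (Suc k) powr (- p) = 2 powr p * ?\<rho> k powr (- p)"
        using a by (simp add: powr_mult powr_minus_divide powr_divide)
      moreover have "?\<rho> k powr (- p) * ?\<rho> k powr q = ?\<rho> k powr (q - p)"
        by (simp flip: powr_add)
      moreover have "?\<rho> k powr (q - p) = a powr (q - p) * ((1/2) powr (q - p)) ^ k"
        using a by (simp add: powr_mult powr_power powr_powr mult.commute flip: powr_realpow)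
      ultimately show ?thesis by simp
    qed
    then have "ennreal (?\<rho> (Suc k) powr (- p)) * (B * ennreal (?\<rho> k powr q)) = B * ennreal (2 powr p * a powr (q - p) * ((1/2) powr (q - p)) ^ k)"
      by (metis ennreal_mult' mult.left_commute powr_ge_zero)
    then show "ennreal (?\<rho> (Suc k) powr (- p)) * emeasure \<mu> (cball 0 (?\<rho> k)) \<le> B * ennreal (2 powr p * a powr (q - p) * ((1/2) powr (q - p)) ^ k)"
      using mult_left_mono[OF B[OF \<rho>[of k]], of "ennreal (?\<rho> (Suc k) powr (- p))"] by simp
  qed
  also have "\<dots> = B * ennreal (2 powr p * a powr (q - p) / (1 - (1/2) powr (q - p)))"
    using pq powr_less_mono2[of "q - p" "1/2" 1] by (subst ennreal_suminf_cmult, subst suminf_ennreal_geometric) auto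
  finally show ?thesis by simp
qed

text \<open>Outward shells: the series converges because the weight decays faster than balls grow,
  and \<open>2 powr q\<close> comes from enclosing each shell in its outer ball.\<close>

lemma nn_integral_powr_Compl_cball_le:
  fixes \<mu> :: "'a::euclidean_space measure"
  assumes sets [measurable_cong]: "sets \<mu> = sets borel"
    and B: "\<And>R. R > 0 \<Longrightarrow> emeasure \<mu> (cball 0 R) \<le> B * ennreal (R powr q)"
    and pq: "0 \<le> q" "q < p" and a: "a > 0"
  shows "(\<integral>\<^sup>+ x. ennreal (norm x powr (- p)) * indicator (- cball 0 a) x \<partial>\<mu>)
    \<le> B * ennreal (2 powr q / (1 - (1/2) powr (p - q)) * a powr (q - p))"
proof -
  let ?\<rho> = "\<lambda>k. a * 2 ^ k"
  have \<rho>: "?\<rho> k > 0" for k using a by simp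
  have [measurable]: "cball (0::'a) R \<in> sets borel" for R by (rule borel_closed) simp
  have "(\<integral>\<^sup>+ x. ennreal (norm x powr (- p)) * indicator (- cball 0 a) x \<partial>\<mu>)
     \<le> (\<integral>\<^sup>+ x. (\<Sum>k. ennreal (?\<rho> k powr (- p)) * indicator (cball 0 (?\<rho> (Suc k))) x) \<partial>\<mu>)"
  proof (rule nn_integral_mono)
    fix x
    show "ennreal (norm x powr (- p)) * indicator (- cball 0 a) x \<le> (\<Sum>k. ennreal (?\<rho> k powr (- p)) * indicator (cball 0 (?\<rho> (Suc k))) x)"
    proof (cases "x \<in> - cball 0 a")
      case True
      then have x: "norm x > a" by auto
      \<comment> \<open>Inversion turns outward shells into the inward ones of
        \<open>dyadic_shell\<close>.\<close>
      then have "0 < inverse (norm x)" "inverse (norm x) \<le> inverse a" using a by (auto simp: le_imp_inverse_le)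
      then obtain k where k: "inverse a * (1/2) ^ Suc k < inverse (norm x)" "inverse (norm x) \<le> inverse a * (1/2) ^ k"
        by (rule dyadic_shell)
      have k': "?\<rho> k \<le> norm x" "norm x \<le> ?\<rho> (Suc k)"
      proof -
        have inv: "inverse a * (1/2) ^ j = inverse (a * 2 ^ j)" for j :: nat
          by (simp add: power_divide inverse_eq_divide)
        show "?\<rho> k \<le> norm x"
          using k(2) x a unfolding inv by (subst (asm) inverse_le_iff_le) auto
        show "norm x \<le> ?\<rho> (Suc k)"
          using k(1) x a unfolding inv by (subst (asm) inverse_less_iff_less) auto
      qed
      have "ennreal (norm x powr (- p)) * indicator (- cball 0 a) x \<le> ennreal (?\<rho> k powr (- p)) * indicator (cball 0 (?\<rho> (Suc k))) x"
        using k' True pq \<rho>[of k] by (auto intro!: ennreal_leI powr_mono2')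
      also have "\<dots> \<le> (\<Sum>k. ennreal (?\<rho> k powr (- p)) * indicator (cball 0 (?\<rho> (Suc k))) x)"
        by (rule ennreal_le_suminf)
      finally show ?thesis .
    qed auto
  qed
  also have "\<dots> = (\<Sum>k. \<integral>\<^sup>+ x. ennreal (?\<rho> k powr (- p)) * indicator (cball 0 (?\<rho> (Suc k))) x \<partial>\<mu>)"
    by (rule nn_integral_suminf) measurable
  also have "\<dots> = (\<Sum>k. ennreal (?\<rho> k powr (- p)) * emeasure \<mu> (cball 0 (?\<rho> (Suc k))))"
    by (intro suminf_cong nn_integral_cmult_indicator) measurable
  also have "\<dots> \<le> (\<Sum>k. B * ennreal (2 powr q * a powr (q - p) * ((1/2) powr (p - q)) ^ k))"
  proof (intro suminf_le summableI)
    fix k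
    have "?\<rho> k powr (- p) * ?\<rho> (Suc k) powr q = 2 powr q * a powr (q - p) * ((1/2) powr (p - q)) ^ k"
    proof -
      have "?\<rho> (Suc k) powr q = 2 powr q * ?\<rho> k powr q"
        using a by (simp add: powr_mult)
      moreover have "?\<rho> k powr (- p) * ?\<rho> k powr q = ?\<rho> k powr (q - p)"
        by (simp flip: powr_add)
      moreover have "?\<rho> k powr (q - p) = a powr (q - p) * (2 powr (q - p)) ^ k"
        using a by (simp add: powr_mult powr_power powr_powr mult.commute flip: powr_realpow)
      moreover have "(2::real) powr (q - p) = (1/2) powr (p - q)"
        using powr_minus_divide[of 2 "p - q"] by (simp add: powr_divide)
      ultimately show ?thesis by simp
    qed
    then have "ennreal (?\<rho> k powr (- p)) * (B * ennreal (?\<rho> (Suc k) powr q)) = B * ennreal (2 powr q * a powr (q - p) * ((1/2) powr (p - q)) ^ k)"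
      by (metis ennreal_mult' mult.left_commute powr_ge_zero)
    then show "ennreal (?\<rho> k powr (- p)) * emeasure \<mu> (cball 0 (?\<rho> (Suc k))) \<le> B * ennreal (2 powr q * a powr (q - p) * ((1/2) powr (p - q)) ^ k)"
      using mult_left_mono[OF B[OF \<rho>[of "Suc k"]], of "ennreal (?\<rho> k powr (- p))"] by simp
  qed
  also have "\<dots> = B * ennreal (2 powr q * a powr (q - p) / (1 - (1/2) powr (p - q)))"
    using pq powr_less_mono2[of "p - q" "1/2" 1] by (subst ennreal_suminf_cmult, subst suminf_ennreal_geometric) auto
  finally show ?thesis by simp
qed

lemma emeasure_lborel_cball_le:
  assumes "R > 0"
  shows "emeasure lborel (cball 0 R :: 'a::euclidean_space set) \<le> ennreal (2 ^ DIM('a)) * ennreal (R powr DIM('a))"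
proof -
  let ?r = "\<Sum>b\<in>(Basis::'a set). R *\<^sub>R b"
  have "(cball 0 R :: 'a set) \<subseteq> cbox (- ?r) ?r"
  proof
    fix x :: 'a assume "x \<in> cball 0 R"
    then have "- R \<le> x \<bullet> b \<and> x \<bullet> b \<le> R" if "b \<in> Basis" for b
      using Basis_le_norm[OF that, of x] by (simp add: abs_le_iff)
    then show "x \<in> cbox (- ?r) ?r" by (auto simp: mem_box)
  qed
  then have "emeasure lborel (cball 0 R :: 'a set) \<le> emeasure lborel (cbox (- ?r) ?r)"
    by (intro emeasure_mono) auto
  also have "\<dots> = ennreal (\<Prod>b\<in>(Basis::'a set). 2 * R)"
    using assms by (subst emeasure_lborel_cbox) (auto simp: inner_diff_left inner_add_left intro!: arg_cong[where f = ennreal] prod.cong)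
  also have "\<dots> = ennreal (2 ^ DIM('a)) * ennreal (R powr DIM('a))"
    using assms by (simp add: powr_realpow power_mult_distrib ennreal_mult)
  finally show ?thesis .
qed

lemma nn_integral_lborel_powr_cball:
  fixes q :: real
  assumes "0 \<le> q" "q < DIM('a)"
  obtains C where "C > 0" "\<And>A. A > 0 \<Longrightarrow>
    (\<integral>\<^sup>+ x. ennreal (norm x powr (- q)) * indicator (cball (0::'a::euclidean_space) A) x \<partial>lborel) \<le> ennreal (C * A powr (DIM('a) - q))"
proof
  have lt: "(1/2) powr (DIM('a) - q) < 1"
    using assms powr_less_mono2[of "DIM('a) - q" "1/2" 1] by simp
  let ?C = "2 ^ DIM('a) * (2 powr q / (1 - (1/2) powr (DIM('a) - q)))"
  show "?C > 0" using lt by simp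
  fix A :: real assume "A > 0"
  have "(\<integral>\<^sup>+ x. ennreal (norm x powr (- q)) * indicator (cball (0::'a) A) x \<partial>lborel)
     \<le> ennreal (2 ^ DIM('a)) * ennreal (2 powr q / (1 - (1/2) powr (DIM('a) - q)) * A powr (DIM('a) - q))"
    by (rule nn_integral_powr_cball_le) (use assms \<open>A > 0\<close> emeasure_lborel_cball_le in auto)
  then show "(\<integral>\<^sup>+ x. ennreal (norm x powr (- q)) * indicator (cball (0::'a) A) x \<partial>lborel) \<le> ennreal (?C * A powr (DIM('a) - q))"
    using lt by (simp add: mult.assoc flip: ennreal_mult)
qed

section \<open>Slabs orthogonal to a frequency\<close>

lemma nn_integral_lborel_remove_coordinate:
  fixes f :: "'a::euclidean_space \<Rightarrow> ennreal"
  assumes e: "e \<in> Basis" and [measurable]: "f \<in> borel_measurable borel"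
  shows "(\<integral>\<^sup>+ x. f x \<partial>lborel) = (\<integral>\<^sup>+ x. (\<integral>\<^sup>+ y. f (y *\<^sub>R e + (\<Sum>b\<in>Basis - {e}. x b *\<^sub>R b)) \<partial>lborel)
    \<partial>(\<Pi>\<^sub>M b\<in>Basis - {e}. (lborel :: real measure)))"
proof -
  interpret product_sigma_finite "\<lambda>_::'a. lborel :: real measure"
    by (standard; rule lborel.sigma_finite_measure_axioms)
  have ins: "insert e (Basis - {e}) = Basis" using e by auto
  have eq: "lborel = distr (\<Pi>\<^sub>M b\<in>(Basis::'a set). lborel) borel (\<lambda>f. \<Sum>b\<in>Basis. f b *\<^sub>R b)"
    by (subst lborel_def) (simp add: lborel_eq_real)
  have meas: "(\<lambda>x. f (\<Sum>b\<in>Basis. x b *\<^sub>R b)) \<in> borel_measurable (\<Pi>\<^sub>M b\<in>(Basis::'a set). (lborel :: real measure))"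
    by measurable
  have "(\<integral>\<^sup>+ x. f x \<partial>lborel) = (\<integral>\<^sup>+ x. f (\<Sum>b\<in>Basis. x b *\<^sub>R b) \<partial>(\<Pi>\<^sub>M b\<in>(Basis::'a set). (lborel :: real measure)))"
    by (subst eq, subst nn_integral_distr) auto
  also have "\<dots> = (\<integral>\<^sup>+ x. (\<integral>\<^sup>+ y. f (\<Sum>b\<in>Basis. (x(e := y)) b *\<^sub>R b) \<partial>lborel) \<partial>(\<Pi>\<^sub>M b\<in>Basis - {e}. (lborel :: real measure)))"
    using product_nn_integral_insert[of "Basis - {e}" e "\<lambda>x. f (\<Sum>b\<in>Basis. x b *\<^sub>R b)"] meas
    unfolding ins by simp
  finally have *: "(\<integral>\<^sup>+ x. f x \<partial>lborel) = \<dots>" .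
  have "(\<Sum>b\<in>Basis. (x(e := y)) b *\<^sub>R b) = y *\<^sub>R e + (\<Sum>b\<in>Basis - {e}. x b *\<^sub>R b)" for x y
    using e by (subst sum.remove[of _ e]) (auto intro!: sum.cong)
  then show ?thesis unfolding * by (simp only:)
qed

text \<open>Pigeonhole: the sum of the absolute coordinates dominates the norm, so some coordinate
  carries a share of at least \<open>1 / DIM('a)\<close>. This replaces a rotation taking \<zeta> to
  a coordinate axis, at the cost of a dimensional factor.\<close>

lemma obtain_large_coordinate:
  fixes \<zeta> :: "'a::euclidean_space"
  obtains e where "e \<in> Basis" "norm \<zeta> \<le> DIM('a) * \<bar>\<zeta> \<bullet> e\<bar>"
proof -
  have "\<exists>e\<in>Basis. norm \<zeta> / DIM('a) \<le> \<bar>\<zeta> \<bullet> e\<bar>"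
  proof (rule ccontr)
    assume "\<not> ?thesis"
    then have "(\<Sum>b\<in>Basis. \<bar>\<zeta> \<bullet> b\<bar>) < (\<Sum>b\<in>(Basis::'a set). norm \<zeta> / DIM('a))"
      by (intro sum_strict_mono) auto
    also have "\<dots> = norm \<zeta>" by simp
    finally show False using norm_le_l1[of \<zeta>] by simp
  qed
  then show thesis using that by (auto simp: field_simps)
qed

text \<open>Along a large coordinate \<open>e\<close> the argument of \<Phi> is affine with slope
  \<open>2 * (\<zeta> \<bullet> e)\<close>, which yields the integral of \<Phi>; the remaining
  \<open>d - 1\<close> coordinates range over intervals of length \<open>2 * R\<close>. So the
  measure with density \<open>\<Phi> (2 * (\<zeta> \<bullet> \<eta>))\<close> grows on balls like a
  hyperplane.\<close>

lemma nn_integral_slab_cball_le: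
  fixes \<zeta> :: "'a::euclidean_space" and R :: real
  assumes \<zeta>: "\<zeta> \<noteq> 0" and R: "R > 0" and [measurable]: "\<Phi> \<in> borel_measurable borel"
  shows "(\<integral>\<^sup>+ \<eta>. \<Phi> (2 * (\<zeta> \<bullet> \<eta>)) * indicator (cball 0 R) \<eta> \<partial>lborel)
    \<le> ennreal (DIM('a) * (2 * R) ^ (DIM('a) - 1) / (2 * norm \<zeta>)) * (\<integral>\<^sup>+ y. \<Phi> y \<partial>lborel)"
proof -
  interpret product_sigma_finite "\<lambda>_::'a. lborel :: real measure"
    by (standard; rule lborel.sigma_finite_measure_axioms)
  obtain e where e: "e \<in> Basis" "norm \<zeta> \<le> DIM('a) * \<bar>\<zeta> \<bullet> e\<bar>"
    by (rule obtain_large_coordinate)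
  have \<zeta>e: "\<bar>\<zeta> \<bullet> e\<bar> > 0" using e \<zeta> by (auto simp: zero_less_abs_iff)
  let ?P = "\<Pi>\<^sub>M b\<in>Basis - {e}. (lborel :: real measure)"
  let ?v = "\<lambda>x y. y *\<^sub>R e + (\<Sum>b\<in>Basis - {e}. x b *\<^sub>R b)"
  let ?I = "\<integral>\<^sup>+ y. \<Phi> y \<partial>lborel"
  have [measurable]: "cball (0::'a) R \<in> sets borel" by (rule borel_closed) simp
  have "(\<integral>\<^sup>+ \<eta>. \<Phi> (2 * (\<zeta> \<bullet> \<eta>)) * indicator (cball 0 R) \<eta> \<partial>lborel)
     = (\<integral>\<^sup>+ x. (\<integral>\<^sup>+ y. \<Phi> (2 * (\<zeta> \<bullet> ?v x y)) * indicator (cball 0 R) (?v x y) \<partial>lborel) \<partial>?P)"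
    by (rule nn_integral_lborel_remove_coordinate[OF e(1)]) measurable
  also have "\<dots> \<le> (\<integral>\<^sup>+ x. (\<Prod>b\<in>Basis - {e}. indicator {-R..R} (x b)) * (ennreal (1 / (2 * \<bar>\<zeta> \<bullet> e\<bar>)) * ?I) \<partial>?P)"
  proof (rule nn_integral_mono)
    fix x :: "'a \<Rightarrow> real"
    let ?J = "\<Prod>b\<in>Basis - {e}. indicator {-R..R} (x b) :: ennreal"
    let ?t = "2 * (\<zeta> \<bullet> (\<Sum>b\<in>Basis - {e}. x b *\<^sub>R b))"
    have "(\<integral>\<^sup>+ y. \<Phi> (2 * (\<zeta> \<bullet> ?v x y)) * indicator (cball 0 R) (?v x y) \<partial>lborel)
       \<le> (\<integral>\<^sup>+ y. ?J * \<Phi> (?t + 2 * (\<zeta> \<bullet> e) * y) \<partial>lborel)"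
    proof (rule nn_integral_mono)
      fix y
      have A: "indicator (cball 0 R) (?v x y) \<le> ?J"
      proof (cases "?v x y \<in> cball 0 R")
        case True
        have "x b \<in> {-R..R}" if b: "b \<in> Basis - {e}" for b
        proof -
          have "?v x y \<bullet> b = x b"
            using b e(1) by (auto simp add: inner_add_left inner_sum_left inner_Basis if_distrib sum.remove[of "Basis - {e}" b] cong: if_cong)
          then show ?thesis
            using True Basis_le_norm[of b "?v x y"] b by (simp add: abs_le_iff)
        qed
        then have "?J = 1" by (intro prod.neutral) auto
        then show ?thesis by (simp add: indicator_def)
      qed simp
      have B: "2 * (\<zeta> \<bullet> ?v x y) = ?t + 2 * (\<zeta> \<bullet> e) * y"
        by (simp add: inner_add_right)
      show "\<Phi> (2 * (\<zeta> \<bullet> ?v x y)) * indicator (cball 0 R) (?v x y) \<le> ?J * \<Phi> (?t + 2 * (\<zeta> \<bullet> e) * y)"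
        unfolding B by (subst mult.commute[of ?J]) (rule mult_left_mono[OF A], simp)
    qed
    also have "\<dots> = ?J * (\<integral>\<^sup>+ y. \<Phi> (?t + 2 * (\<zeta> \<bullet> e) * y) \<partial>lborel)"
      by (rule nn_integral_cmult) measurable
    also have "(\<integral>\<^sup>+ y. \<Phi> (?t + 2 * (\<zeta> \<bullet> e) * y) \<partial>lborel) = ennreal (1 / (2 * \<bar>\<zeta> \<bullet> e\<bar>)) * ?I"
    proof -
      have "?I = ennreal (2 * \<bar>\<zeta> \<bullet> e\<bar>) * (\<integral>\<^sup>+ y. \<Phi> (?t + 2 * (\<zeta> \<bullet> e) * y) \<partial>lborel)"
        using nn_integral_real_affine[of \<Phi> "2 * (\<zeta> \<bullet> e)" ?t] \<zeta>e by (simp add: abs_mult)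
      moreover have "ennreal (1 / (2 * \<bar>\<zeta> \<bullet> e\<bar>)) * ennreal (2 * \<bar>\<zeta> \<bullet> e\<bar>) = 1"
        using \<zeta>e by (subst ennreal_mult[symmetric]) auto
      ultimately show ?thesis by (simp only: mult.assoc[symmetric]) simp
    qed
    finally show "(\<integral>\<^sup>+ y. \<Phi> (2 * (\<zeta> \<bullet> ?v x y)) * indicator (cball 0 R) (?v x y) \<partial>lborel)
       \<le> ?J * (ennreal (1 / (2 * \<bar>\<zeta> \<bullet> e\<bar>)) * ?I)" .
  qed
  also have "\<dots> = (\<integral>\<^sup>+ x. (\<Prod>b\<in>Basis - {e}. indicator {-R..R} (x b)) \<partial>?P) * (ennreal (1 / (2 * \<bar>\<zeta> \<bullet> e\<bar>)) * ?I)"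
    by (rule nn_integral_multc) measurable
  also have "(\<integral>\<^sup>+ x. (\<Prod>b\<in>Basis - {e}. indicator {-R..R} (x b)) \<partial>?P) = (\<Prod>b\<in>Basis - {e}. (\<integral>\<^sup>+ y. indicator {-R..R} y \<partial>(lborel :: real measure)))"
    by (rule product_nn_integral_prod) auto
  also have "\<dots> = ennreal ((2 * R) ^ (DIM('a) - 1))"
    using R e by (simp add: ennreal_power)
  also have "ennreal ((2 * R) ^ (DIM('a) - 1)) * (ennreal (1 / (2 * \<bar>\<zeta> \<bullet> e\<bar>)) * ?I) = ennreal ((2 * R) ^ (DIM('a) - 1) / (2 * \<bar>\<zeta> \<bullet> e\<bar>)) * ?I"
    using R by (simp add: mult.assoc[symmetric] flip: ennreal_mult)
  also have "\<dots> \<le> ennreal (DIM('a) * (2 * R) ^ (DIM('a) - 1) / (2 * norm \<zeta>)) * ?I"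
  proof (intro mult_right_mono ennreal_leI)
    have "1 / (2 * \<bar>\<zeta> \<bullet> e\<bar>) \<le> DIM('a) / (2 * norm \<zeta>)"
      using e(2) \<zeta>e \<zeta> by (simp add: field_simps)
    from mult_left_mono[OF this, of "(2 * R) ^ (DIM('a) - 1)"]
    show "(2 * R) ^ (DIM('a) - 1) / (2 * \<bar>\<zeta> \<bullet> e\<bar>) \<le> DIM('a) * (2 * R) ^ (DIM('a) - 1) / (2 * norm \<zeta>)"
      using R by (simp add: mult.commute)
  qed simp
  finally show ?thesis .
qed

text \<open>Where \<open>norm \<eta> \<le> norm (\<zeta> + \<eta>)\<close>, the triangle inequality
  keeps \<open>\<zeta> + \<eta>\<close> at distance at least \<open>norm \<zeta> / 2\<close> from 0,
  so only the singularity at \<open>\<eta> = 0\<close> remains. Inside the ball of that radius the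
  other factor is bounded and \<open>2 * s < d - 1\<close> gives convergence; outside, both factors
  are bounded by powers of \<open>norm \<eta>\<close> and \<open>d - 1 < 4 * s\<close> does.\<close>

lemma nn_integral_weight_half_slab_le:
  fixes \<zeta> :: "'a::euclidean_space" and s :: real
  assumes s: "2 * s < real DIM('a) - 1" "real DIM('a) - 1 < 4 * s"
    and \<zeta>: "\<zeta> \<noteq> 0" and [measurable]: "\<Phi> \<in> borel_measurable borel"
  defines "q \<equiv> real DIM('a) - 1"
  shows "(\<integral>\<^sup>+ \<eta>. ennreal ((norm (\<zeta> + \<eta>) powr (- s) * norm \<eta> powr (- s))\<^sup>2) * \<Phi> (2 * (\<zeta> \<bullet> \<eta>))
      * indicator {\<eta>. norm \<eta> \<le> norm (\<zeta> + \<eta>)} \<eta> \<partial>lborel)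
    \<le> ennreal (DIM('a) * 2 powr q / 2 * (2 powr (2 * s) / (1 - (1/2) powr (q - 2 * s)) + 2 powr q / (1 - (1/2) powr (4 * s - q)))
        * 2 powr (4 * s - q) * norm \<zeta> powr (q - 1 - 4 * s)) * (\<integral>\<^sup>+ y. \<Phi> y \<partial>lborel)"
proof -
  let ?W = "\<lambda>\<eta>. (norm (\<zeta> + \<eta>) powr (- s) * norm \<eta> powr (- s))\<^sup>2"
  let ?I = "\<integral>\<^sup>+ y. \<Phi> y \<partial>lborel"
  \<comment> \<open>The dyadic bounds are applied to this measure with growth exponent
    \<open>q = d - 1\<close>.\<close>
  define \<mu> where "\<mu> = density lborel (\<lambda>\<eta>. \<Phi> (2 * (\<zeta> \<bullet> \<eta>)))"
  define a where "a = norm \<zeta> / 2"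
  define B where "B = ennreal (DIM('a) * 2 powr q / (2 * norm \<zeta>)) * ?I"
  define c1 where "c1 = 2 powr (2 * s) / (1 - (1/2) powr (q - 2 * s))"
  define c2 where "c2 = 2 powr q / (1 - (1/2) powr (4 * s - q))"
  have a: "a > 0" using \<zeta> by (simp add: a_def)
  have q: "0 \<le> q" "2 * s < q" "q < 4 * s" using s DIM_positive[where 'a='a] by (auto simp: q_def)
  then have s0: "s > 0" by linarith
  have [measurable]: "cball (0::'a) R \<in> sets borel" for R by (rule borel_closed) simp
  have sets_\<mu> [measurable_cong]: "sets \<mu> = sets borel" by (simp add: \<mu>_def)
  have c_nn: "c1 \<ge> 0" "c2 \<ge> 0"
    using powr_less_mono2[of "q - 2 * s" "1/2" 1] powr_less_mono2[of "4 * s - q" "1/2" 1] q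
    by (auto simp: c1_def c2_def intro!: divide_nonneg_nonneg)
  have int\<mu>: "(\<integral>\<^sup>+ \<eta>. f \<eta> \<partial>\<mu>) = (\<integral>\<^sup>+ \<eta>. \<Phi> (2 * (\<zeta> \<bullet> \<eta>)) * f \<eta> \<partial>lborel)" if [measurable]: "f \<in> borel_measurable borel" for f
    unfolding \<mu>_def by (rule nn_integral_density) measurable
  have B: "emeasure \<mu> (cball 0 R) \<le> B * ennreal (R powr q)" if R: "R > 0" for R
  proof -
    have "emeasure \<mu> (cball 0 R) = (\<integral>\<^sup>+ \<eta>. \<Phi> (2 * (\<zeta> \<bullet> \<eta>)) * indicator (cball 0 R) \<eta> \<partial>lborel)"
      unfolding \<mu>_def by (rule emeasure_density) measurable
    also have "\<dots> \<le> ennreal (DIM('a) * (2 * R) ^ (DIM('a) - 1) / (2 * norm \<zeta>)) * ?I"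
      by (rule nn_integral_slab_cball_le[OF \<zeta> R]) measurable
    also have "(2 * R) ^ (DIM('a) - 1) = 2 powr q * R powr q"
    proof -
      have "(2 * R) ^ (DIM('a) - 1) = (2 * R) powr (real (DIM('a) - 1))"
        using R by (intro powr_realpow[symmetric]) simp
      also have "real (DIM('a) - 1) = q" by (simp add: q_def of_nat_diff)
      finally show ?thesis using R by (simp add: powr_mult)
    qed
    also have "ennreal (DIM('a) * (2 powr q * R powr q) / (2 * norm \<zeta>)) * ?I
        = ennreal (DIM('a) * 2 powr q / (2 * norm \<zeta>)) * ennreal (R powr q) * ?I"
      by (subst ennreal_mult[symmetric]) (auto simp: mult_ac)
    also have "\<dots> = B * ennreal (R powr q)"
      unfolding B_def by (simp only: mult_ac)
    finally show ?thesis .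
  qed
  have pw: "?W \<eta> * indicator {\<eta>. norm \<eta> \<le> norm (\<zeta> + \<eta>)} \<eta>
      \<le> a powr (- (2 * s)) * (norm \<eta> powr (- (2 * s)) * indicator (cball 0 a) \<eta>) + norm \<eta> powr (- (4 * s)) * indicator (- cball 0 a) \<eta>" for \<eta>
  proof (cases "norm \<eta> \<le> norm (\<zeta> + \<eta>)")
    case True
    have "norm \<zeta> \<le> norm (\<zeta> + \<eta>) + norm \<eta>"
      using norm_triangle_ineq4[of "\<zeta> + \<eta>" \<eta>] by simp
    then have ge: "a \<le> norm (\<zeta> + \<eta>)" using True by (simp add: a_def)
    have W: "?W \<eta> = norm (\<zeta> + \<eta>) powr (- (2 * s)) * norm \<eta> powr (- (2 * s))"
    proof -
      have "(x powr (- s))\<^sup>2 = x powr (- (2 * s))" for x :: real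
        by (simp add: power2_eq_square flip: powr_add)
      then show ?thesis by (simp only: power_mult_distrib)
    qed
    show ?thesis
    proof (cases "\<eta> \<in> cball 0 a")
      case T: True
      have "norm (\<zeta> + \<eta>) powr (- (2 * s)) \<le> a powr (- (2 * s))"
        using ge a s0 by (intro powr_mono2') auto
      then show ?thesis using T True unfolding W by (simp add: mult_right_mono)
    next
      case F: False
      then have "norm \<eta> > 0" using a by auto
      then have "norm (\<zeta> + \<eta>) powr (- (2 * s)) \<le> norm \<eta> powr (- (2 * s))"
        using True s0 by (intro powr_mono2') auto
      then have "?W \<eta> \<le> norm \<eta> powr (- (2 * s)) * norm \<eta> powr (- (2 * s))"
        unfolding W by (rule mult_right_mono) simp
      also have "\<dots> = norm \<eta> powr (- (4 * s))" by (simp flip: powr_add)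
      finally show ?thesis using F True by simp
    qed
  qed (simp add: indicator_def)
  have "(\<integral>\<^sup>+ \<eta>. ennreal (?W \<eta>) * \<Phi> (2 * (\<zeta> \<bullet> \<eta>)) * indicator {\<eta>. norm \<eta> \<le> norm (\<zeta> + \<eta>)} \<eta> \<partial>lborel)
     \<le> (\<integral>\<^sup>+ \<eta>. \<Phi> (2 * (\<zeta> \<bullet> \<eta>)) * (ennreal (a powr (- (2 * s))) * (ennreal (norm \<eta> powr (- (2 * s))) * indicator (cball 0 a) \<eta>)
         + ennreal (norm \<eta> powr (- (4 * s))) * indicator (- cball 0 a) \<eta>) \<partial>lborel)"
  proof (rule nn_integral_mono)
    fix \<eta>
    have "ennreal (?W \<eta>) * indicator {\<eta>. norm \<eta> \<le> norm (\<zeta> + \<eta>)} \<eta> = ennreal (?W \<eta> * indicator {\<eta>. norm \<eta> \<le> norm (\<zeta> + \<eta>)} \<eta>)"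
      by (simp add: indicator_def)
    also have "\<dots> \<le> ennreal (a powr (- (2 * s)) * (norm \<eta> powr (- (2 * s)) * indicator (cball 0 a) \<eta>) + norm \<eta> powr (- (4 * s)) * indicator (- cball 0 a) \<eta>)"
      by (rule ennreal_leI[OF pw])
    also have "\<dots> = ennreal (a powr (- (2 * s))) * (ennreal (norm \<eta> powr (- (2 * s))) * indicator (cball 0 a) \<eta>)
         + ennreal (norm \<eta> powr (- (4 * s))) * indicator (- cball 0 a) \<eta>"
      by (simp add: indicator_def ennreal_mult)
    finally have "ennreal (?W \<eta>) * indicator {\<eta>. norm \<eta> \<le> norm (\<zeta> + \<eta>)} \<eta> \<le> \<dots>" .
    from mult_left_mono[OF this, of "\<Phi> (2 * (\<zeta> \<bullet> \<eta>))"]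
    show "ennreal (?W \<eta>) * \<Phi> (2 * (\<zeta> \<bullet> \<eta>)) * indicator {\<eta>. norm \<eta> \<le> norm (\<zeta> + \<eta>)} \<eta>
      \<le> \<Phi> (2 * (\<zeta> \<bullet> \<eta>)) * (ennreal (a powr (- (2 * s))) * (ennreal (norm \<eta> powr (- (2 * s))) * indicator (cball 0 a) \<eta>)
         + ennreal (norm \<eta> powr (- (4 * s))) * indicator (- cball 0 a) \<eta>)"
      by (simp only: zero_le mult_ac simp_thms)
  qed
  also have "\<dots> = (\<integral>\<^sup>+ \<eta>. (ennreal (a powr (- (2 * s))) * (ennreal (norm \<eta> powr (- (2 * s))) * indicator (cball 0 a) \<eta>)
         + ennreal (norm \<eta> powr (- (4 * s))) * indicator (- cball 0 a) \<eta>) \<partial>\<mu>)"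
    by (rule int\<mu>[symmetric]) measurable
  also have "\<dots> = (\<integral>\<^sup>+ \<eta>. ennreal (a powr (- (2 * s))) * (ennreal (norm \<eta> powr (- (2 * s))) * indicator (cball 0 a) \<eta>) \<partial>\<mu>)
        + (\<integral>\<^sup>+ \<eta>. ennreal (norm \<eta> powr (- (4 * s))) * indicator (- cball 0 a) \<eta> \<partial>\<mu>)"
    by (rule nn_integral_add) measurable
  also have "(\<integral>\<^sup>+ \<eta>. ennreal (a powr (- (2 * s))) * (ennreal (norm \<eta> powr (- (2 * s))) * indicator (cball 0 a) \<eta>) \<partial>\<mu>)
      = ennreal (a powr (- (2 * s))) * (\<integral>\<^sup>+ \<eta>. ennreal (norm \<eta> powr (- (2 * s))) * indicator (cball 0 a) \<eta> \<partial>\<mu>)"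
    by (rule nn_integral_cmult) measurable
  finally have *: "(\<integral>\<^sup>+ \<eta>. ennreal (?W \<eta>) * \<Phi> (2 * (\<zeta> \<bullet> \<eta>)) * indicator {\<eta>. norm \<eta> \<le> norm (\<zeta> + \<eta>)} \<eta> \<partial>lborel)
     \<le> ennreal (a powr (- (2 * s))) * (\<integral>\<^sup>+ \<eta>. ennreal (norm \<eta> powr (- (2 * s))) * indicator (cball 0 a) \<eta> \<partial>\<mu>)
        + (\<integral>\<^sup>+ \<eta>. ennreal (norm \<eta> powr (- (4 * s))) * indicator (- cball 0 a) \<eta> \<partial>\<mu>)" .
  note *
  also have "\<dots> \<le> ennreal (a powr (- (2 * s))) * (B * ennreal (c1 * a powr (q - 2 * s))) + B * ennreal (c2 * a powr (q - 4 * s))"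
    unfolding c1_def c2_def using s0 q a
    by (intro add_mono mult_left_mono nn_integral_powr_cball_le nn_integral_powr_Compl_cball_le sets_\<mu> B) auto
  also have "\<dots> = B * (ennreal (a powr (- (2 * s))) * ennreal (c1 * a powr (q - 2 * s)) + ennreal (c2 * a powr (q - 4 * s)))"
    by (simp add: distrib_left mult.left_commute)
  also have "\<dots> = B * ennreal ((c1 + c2) * a powr (q - 4 * s))"
  proof -
    have "a powr (- (2 * s)) * (c1 * a powr (q - 2 * s)) + c2 * a powr (q - 4 * s) = (c1 + c2) * a powr (q - 4 * s)"
      by (simp add: algebra_simps flip: powr_add)
    then show ?thesis using c_nn by (simp flip: ennreal_mult ennreal_plus)
  qed
  also have "\<dots> = ennreal (DIM('a) * 2 powr q / (2 * norm \<zeta>)) * ennreal ((c1 + c2) * a powr (q - 4 * s)) * ?I"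
    unfolding B_def by (simp only: mult_ac)
  also have "ennreal (DIM('a) * 2 powr q / (2 * norm \<zeta>)) * ennreal ((c1 + c2) * a powr (q - 4 * s))
     = ennreal (DIM('a) * 2 powr q / 2 * (c1 + c2) * 2 powr (4 * s - q) * norm \<zeta> powr (q - 1 - 4 * s))"
  proof -
    have "a powr (q - 4 * s) = 2 powr (4 * s - q) * norm \<zeta> powr (q - 4 * s)"
      using powr_minus_divide[of 2 "4 * s - q"] by (simp add: a_def powr_divide divide_simps flip: powr_add)
    moreover have "norm \<zeta> powr (q - 1 - 4 * s) = norm \<zeta> powr (q - 4 * s) / norm \<zeta>"
      using \<zeta> powr_add[of "norm \<zeta>" "q - 4 * s" "-1"] by (simp add: powr_minus_divide algebra_simps)
    ultimately show ?thesis
      using c_nn by (simp flip: ennreal_mult)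
  qed
  finally show ?thesis unfolding c1_def c2_def .
qed

text \<open>The reflection \<open>\<eta> \<mapsto> - \<zeta> - \<eta>\<close> exchanges the two
  factors of the weight, so it carries the other half space into the one already treated. The
  exponent is one below that of the slice integral, because passing to the variable
  \<open>2 * (\<zeta> \<bullet> \<eta>)\<close> costs a factor
  \<open>1 / norm \<zeta>\<close>.\<close>

lemma slab_weight_estimate:
  fixes s :: real
  assumes s: "2 * s < real DIM('a) - 1" "real DIM('a) - 1 < 4 * s"
  obtains C where "C > 0" "\<And>(\<zeta>::'a::euclidean_space) \<Phi>. \<zeta> \<noteq> 0 \<Longrightarrow> \<Phi> \<in> borel_measurable borel \<Longrightarrow>
    (\<integral>\<^sup>+ \<eta>. ennreal ((norm (\<zeta> + \<eta>) powr (- s) * norm \<eta> powr (- s))\<^sup>2) * \<Phi> (2 * (\<zeta> \<bullet> \<eta>)) \<partial>lborel)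
      \<le> ennreal (C * norm \<zeta> powr (real DIM('a) - 2 - 4 * s)) * (\<integral>\<^sup>+ y. \<Phi> y \<partial>lborel)"
proof -
  define q where "q = real DIM('a) - 1"
  define K where "K = DIM('a) * 2 powr q / 2 * (2 powr (2 * s) / (1 - (1/2) powr (q - 2 * s)) + 2 powr q / (1 - (1/2) powr (4 * s - q)))
        * 2 powr (4 * s - q)"
  have "(1/2) powr (q - 2 * s) < 1" "(1/2) powr (4 * s - q) < 1"
    using powr_less_mono2[of "q - 2 * s" "1/2" 1] powr_less_mono2[of "4 * s - q" "1/2" 1] s
    by (auto simp: q_def)
  then have "K > 0" unfolding K_def by (intro mult_pos_pos add_pos_pos divide_pos_pos) auto
  show thesis
  proof
    show "2 * K > 0" using \<open>K > 0\<close> by simp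
    fix \<zeta> :: 'a and \<Phi> :: "real \<Rightarrow> ennreal" assume \<zeta>: "\<zeta> \<noteq> 0" and [measurable]: "\<Phi> \<in> borel_measurable borel"
    let ?W = "\<lambda>\<eta>. ennreal ((norm (\<zeta> + \<eta>) powr (- s) * norm \<eta> powr (- s))\<^sup>2)"
    let ?H = "{\<eta>. norm \<eta> \<le> norm (\<zeta> + \<eta>)}"
    let ?K = "ennreal (K * norm \<zeta> powr (real DIM('a) - 2 - 4 * s))"
    have half: "(\<integral>\<^sup>+ \<eta>. ?W \<eta> * \<Psi> (2 * (\<zeta> \<bullet> \<eta>)) * indicator ?H \<eta> \<partial>lborel) \<le> ?K * (\<integral>\<^sup>+ y. \<Psi> y \<partial>lborel)"
      if "\<Psi> \<in> borel_measurable borel" for \<Psi>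
    proof -
      have e: "real DIM('a) - 2 - 4 * s = q - 1 - 4 * s" by (simp add: q_def)
      show ?thesis
        unfolding e using nn_integral_weight_half_slab_le[OF s \<zeta> that, folded q_def, folded K_def] .
    qed
    \<comment> \<open>From \<open>2 * (\<zeta> \<bullet> (- \<zeta> - \<eta>)) = - 2 * (\<zeta>
      \<bullet> \<zeta>) - 2 * (\<zeta> \<bullet> \<eta>)\<close>: the reflection acts on the slab
      variable by an isometry of the line, which preserves the integral of \<Phi>.\<close>
    define \<Psi> where "\<Psi> y = \<Phi> (- 2 * (\<zeta> \<bullet> \<zeta>) + - 1 * y)" for y
    have [measurable]: "\<Psi> \<in> borel_measurable borel" unfolding \<Psi>_def by measurable
    have \<Psi>: "(\<integral>\<^sup>+ y. \<Psi> y \<partial>lborel) = (\<integral>\<^sup>+ y. \<Phi> y \<partial>lborel)"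
      using nn_integral_real_affine[of \<Phi> "-1" "- 2 * (\<zeta> \<bullet> \<zeta>)"] unfolding \<Psi>_def by simp
    have "(\<integral>\<^sup>+ \<eta>. ?W \<eta> * \<Phi> (2 * (\<zeta> \<bullet> \<eta>)) * indicator (- ?H) \<eta> \<partial>lborel)
      = (\<integral>\<^sup>+ \<eta>. ?W (- \<zeta> + - 1 *\<^sub>R \<eta>) * \<Phi> (2 * (\<zeta> \<bullet> (- \<zeta> + - 1 *\<^sub>R \<eta>))) * indicator (- ?H) (- \<zeta> + - 1 *\<^sub>R \<eta>) \<partial>lborel)"
      by (subst nn_integral_lborel_affine[of "-1" _ "- \<zeta>"]) auto
    also have "\<dots> \<le> (\<integral>\<^sup>+ \<eta>. ?W \<eta> * \<Psi> (2 * (\<zeta> \<bullet> \<eta>)) * indicator ?H \<eta> \<partial>lborel)"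
    proof (rule nn_integral_mono)
      fix \<eta> :: 'a
      have n: "norm (\<zeta> + (- \<zeta> + - 1 *\<^sub>R \<eta>)) = norm \<eta>" "norm (- \<zeta> + - 1 *\<^sub>R \<eta>) = norm (\<zeta> + \<eta>)"
        using norm_minus_cancel[of "\<zeta> + \<eta>"] by (simp_all add: add.commute)
      have i: "2 * (\<zeta> \<bullet> (- \<zeta> + - 1 *\<^sub>R \<eta>)) = - 2 * (\<zeta> \<bullet> \<zeta>) + - 1 * (2 * (\<zeta> \<bullet> \<eta>))"
        by (simp add: inner_diff_right algebra_simps)
      have ind: "(indicator (- ?H) (- \<zeta> + - 1 *\<^sub>R \<eta>) :: ennreal) \<le> indicator ?H \<eta>"
        unfolding indicator_def using n by simp
      show "?W (- \<zeta> + - 1 *\<^sub>R \<eta>) * \<Phi> (2 * (\<zeta> \<bullet> (- \<zeta> + - 1 *\<^sub>R \<eta>))) * indicator (- ?H) (- \<zeta> + - 1 *\<^sub>R \<eta>)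
        \<le> ?W \<eta> * \<Psi> (2 * (\<zeta> \<bullet> \<eta>)) * indicator ?H \<eta>"
        unfolding \<Psi>_def n i by (subst mult.commute[of "norm \<eta> powr (- s)"]) (rule mult_left_mono[OF ind], simp)
    qed
    also have "\<dots> \<le> ?K * (\<integral>\<^sup>+ y. \<Phi> y \<partial>lborel)"
      using half[of \<Psi>] by (simp add: \<Psi>)
    finally have other: "(\<integral>\<^sup>+ \<eta>. ?W \<eta> * \<Phi> (2 * (\<zeta> \<bullet> \<eta>)) * indicator (- ?H) \<eta> \<partial>lborel) \<le> \<dots>" .
    have "(\<integral>\<^sup>+ \<eta>. ?W \<eta> * \<Phi> (2 * (\<zeta> \<bullet> \<eta>)) \<partial>lborel)
       = (\<integral>\<^sup>+ \<eta>. ?W \<eta> * \<Phi> (2 * (\<zeta> \<bullet> \<eta>)) * indicator ?H \<eta> + ?W \<eta> * \<Phi> (2 * (\<zeta> \<bullet> \<eta>)) * indicator (- ?H) \<eta> \<partial>lborel)"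
      by (intro nn_integral_cong) (auto simp: indicator_def)
    also have "\<dots> = (\<integral>\<^sup>+ \<eta>. ?W \<eta> * \<Phi> (2 * (\<zeta> \<bullet> \<eta>)) * indicator ?H \<eta> \<partial>lborel)
        + (\<integral>\<^sup>+ \<eta>. ?W \<eta> * \<Phi> (2 * (\<zeta> \<bullet> \<eta>)) * indicator (- ?H) \<eta> \<partial>lborel)"
      by (rule nn_integral_add) measurable
    also have "\<dots> \<le> ?K * (\<integral>\<^sup>+ y. \<Phi> y \<partial>lborel) + ?K * (\<integral>\<^sup>+ y. \<Phi> y \<partial>lborel)"
      by (intro add_mono half other) measurable
    also have "\<dots> = (?K + ?K) * (\<integral>\<^sup>+ y. \<Phi> y \<partial>lborel)" by (simp only: distrib_right)
    also have "?K + ?K = ennreal (2 * K * norm \<zeta> powr (real DIM('a) - 2 - 4 * s))"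
      using \<open>K > 0\<close> by (simp flip: ennreal_plus)
    finally show "(\<integral>\<^sup>+ \<eta>. ?W \<eta> * \<Phi> (2 * (\<zeta> \<bullet> \<eta>)) \<partial>lborel) \<le> ennreal (2 * K * norm \<zeta> powr (real DIM('a) - 2 - 4 * s)) * (\<integral>\<^sup>+ y. \<Phi> y \<partial>lborel)" .
  qed
qed

section \<open>Sobolev embedding\<close>

text \<open>The inequality for general phases with the identity as phase and \<open>w = 1\<close>;
  translated Gaussians have mass 1, so \<open>B = 1\<close>.\<close>

lemma plancherel_le:
  fixes h :: "'a::euclidean_space \<Rightarrow> complex"
  assumes h: "integrable lborel h"
  shows "(\<integral>\<^sup>+ x. ennreal ((norm (LINT \<xi>|lborel. cis (x \<bullet> \<xi>) * h \<xi>))\<^sup>2) \<partial>lborel)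
    \<le> ennreal ((2 * pi) ^ DIM('a)) * (\<integral>\<^sup>+ \<xi>. ennreal ((norm (h \<xi>))\<^sup>2) \<partial>lborel)"
proof -
  have [measurable]: "h \<in> borel_measurable borel" using h by auto
  have "(\<integral>\<^sup>+ x. ennreal ((norm (LINT \<xi>|lborel. cis (x \<bullet> \<xi>) * h \<xi>))\<^sup>2) \<partial>lborel)
    \<le> ennreal ((2 * pi) ^ DIM('a)) * 1 * (\<integral>\<^sup>+ \<xi>. ennreal ((norm (h \<xi>))\<^sup>2) \<partial>lborel)"
    by (rule nn_integral_norm_fourier_le[OF lborel.sigma_finite_measure_axioms, where w = "\<lambda>_. 1"])
       (use h in \<open>auto simp: nn_integral_gauss_diff\<close>)
  then show ?thesis by simp
qed

text \<open>Cauchy--Schwarz after inserting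
  \<open>norm \<zeta> powr (- \<alpha>) * norm \<zeta> powr \<alpha>\<close>. The condition
  \<open>2 * \<alpha> < d\<close> makes the first factor square integrable on balls.\<close>

lemma sobolev_low_frequency:
  fixes \<alpha> :: real
  assumes \<alpha>: "0 < \<alpha>" "\<alpha> < DIM('a) / 2"
  obtains c where "c > 0" "\<And>(R :: 'a::euclidean_space \<Rightarrow> complex) N A. integrable lborel R \<Longrightarrow> N > 0 \<Longrightarrow> A > 0 \<Longrightarrow>
    (\<integral>\<^sup>+ \<zeta>. ennreal (norm \<zeta> powr (2 * \<alpha>) * (norm (R \<zeta>))\<^sup>2) \<partial>lborel) \<le> ennreal (N\<^sup>2) \<Longrightarrow>
    (\<integral>\<^sup>+ \<zeta>. ennreal (norm (R \<zeta>)) * indicator (cball 0 A) \<zeta> \<partial>lborel) \<le> ennreal (c * A powr (DIM('a) / 2 - \<alpha>) * N)"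
proof -
  obtain C where C: "C > 0" "\<And>A. A > 0 \<Longrightarrow>
    (\<integral>\<^sup>+ x. ennreal (norm x powr (- (2 * \<alpha>))) * indicator (cball (0::'a) A) x \<partial>lborel) \<le> ennreal (C * A powr (DIM('a) - 2 * \<alpha>))"
    using nn_integral_lborel_powr_cball[of "2 * \<alpha>", where 'a='a] \<alpha> by auto
  show thesis
  proof
    show "sqrt C > 0" using C by simp
    fix R :: "'a \<Rightarrow> complex" and N A :: real
    assume R: "integrable lborel R" and N: "N > 0" and A: "A > 0"
      and le: "(\<integral>\<^sup>+ \<zeta>. ennreal (norm \<zeta> powr (2 * \<alpha>) * (norm (R \<zeta>))\<^sup>2) \<partial>lborel) \<le> ennreal (N\<^sup>2)"
    have [measurable]: "R \<in> borel_measurable borel" using R by auto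
    have [measurable]: "cball (0::'a) A \<in> sets borel" by (rule borel_closed) simp
    let ?f = "\<lambda>\<zeta>::'a. ennreal (norm \<zeta> powr (- \<alpha>)) * indicator (cball 0 A) \<zeta>"
    let ?g = "\<lambda>\<zeta>. ennreal (norm \<zeta> powr \<alpha> * norm (R \<zeta>))"
    let ?X = "\<integral>\<^sup>+ \<zeta>. ennreal (norm (R \<zeta>)) * indicator (cball 0 A) \<zeta> \<partial>lborel"
    have "?X = (\<integral>\<^sup>+ \<zeta>. ?f \<zeta> * ?g \<zeta> \<partial>lborel)"
    proof (rule nn_integral_cong_AE)
      show "AE \<zeta> in lborel. ennreal (norm (R \<zeta>)) * indicator (cball 0 A) \<zeta> = ?f \<zeta> * ?g \<zeta>"
        using AE_lborel_singleton[of "0::'a"]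
      proof eventually_elim
        case (elim \<zeta>)
        have "norm (R \<zeta>) = norm \<zeta> powr (- \<alpha>) * (norm \<zeta> powr \<alpha> * norm (R \<zeta>))"
          using elim by (simp add: powr_minus)
        then have "ennreal (norm (R \<zeta>)) = ennreal (norm \<zeta> powr (- \<alpha>)) * ?g \<zeta>"
          by (subst ennreal_mult[symmetric]) auto
        then show ?case by (simp only: mult_ac)
      qed
    qed
    then have "?X\<^sup>2 \<le> (\<integral>\<^sup>+ \<zeta>. (?f \<zeta>)\<^sup>2 \<partial>lborel) * (\<integral>\<^sup>+ \<zeta>. (?g \<zeta>)\<^sup>2 \<partial>lborel)"
      using Cauchy_Schwarz_nn_integral[of ?f lborel ?g] by simp
    also have "(\<integral>\<^sup>+ \<zeta>. (?f \<zeta>)\<^sup>2 \<partial>lborel) = (\<integral>\<^sup>+ x. ennreal (norm x powr (- (2 * \<alpha>))) * indicator (cball (0::'a) A) x \<partial>lborel)"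
    proof (rule nn_integral_cong)
      fix \<zeta> :: 'a
      have "(norm \<zeta> powr (- \<alpha>))\<^sup>2 = norm \<zeta> powr (- (2 * \<alpha>))"
        by (simp add: power2_eq_square flip: powr_add)
      then show "(?f \<zeta>)\<^sup>2 = ennreal (norm \<zeta> powr (- (2 * \<alpha>))) * indicator (cball 0 A) \<zeta>"
        by (simp add: indicator_def ennreal_power)
    qed
    also have "(\<integral>\<^sup>+ \<zeta>. (?g \<zeta>)\<^sup>2 \<partial>lborel) = (\<integral>\<^sup>+ \<zeta>. ennreal (norm \<zeta> powr (2 * \<alpha>) * (norm (R \<zeta>))\<^sup>2) \<partial>lborel)"
    proof (rule nn_integral_cong)
      fix \<zeta> :: 'a
      have "(norm \<zeta> powr \<alpha>)\<^sup>2 = norm \<zeta> powr (2 * \<alpha>)"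
        by (simp add: power2_eq_square flip: powr_add)
      then show "(?g \<zeta>)\<^sup>2 = ennreal (norm \<zeta> powr (2 * \<alpha>) * (norm (R \<zeta>))\<^sup>2)"
        by (simp add: ennreal_power power_mult_distrib)
    qed
    finally have "?X\<^sup>2 \<le> ennreal (C * A powr (DIM('a) - 2 * \<alpha>)) * ennreal (N\<^sup>2)"
      using C(2)[OF A] le by (meson mult_mono order_trans zero_le)
    also have "\<dots> = ennreal ((sqrt C * A powr (DIM('a) / 2 - \<alpha>) * N)\<^sup>2)"
    proof -
      have "(A powr (DIM('a) / 2 - \<alpha>))\<^sup>2 = A powr (DIM('a) - 2 * \<alpha>)"
        by (simp add: power2_eq_square flip: powr_add)
      then show ?thesis using C(1) by (simp add: power_mult_distrib flip: ennreal_mult)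
    qed
    finally have sq: "?X\<^sup>2 \<le> ennreal ((sqrt C * A powr (DIM('a) / 2 - \<alpha>) * N)\<^sup>2)" .
    have nn: "0 \<le> sqrt C * A powr (DIM('a) / 2 - \<alpha>) * N" using C(1) N by simp
    show "?X \<le> ennreal (sqrt C * A powr (DIM('a) / 2 - \<alpha>) * N)"
    proof (cases ?X)
      case (real x)
      then have "x\<^sup>2 \<le> (sqrt C * A powr (DIM('a) / 2 - \<alpha>) * N)\<^sup>2"
        using sq by (simp add: ennreal_power ennreal_le_iff)
      then show ?thesis using real nn by (auto intro!: ennreal_leI power2_le_imp_le)
    qed (use sq in \<open>simp add: top_unique\<close>)
  qed
qed

lemma nn_integral_powr_Icc:
  assumes "a > - 1" "c \<ge> (0::real)"
  shows "(\<integral>\<^sup>+ x. ennreal (x powr a) * indicator {0..c} x \<partial>lborel) = ennreal (c powr (a + 1) / (a + 1))"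
  using nn_integral_has_integral_lebesgue'[OF _ has_integral_powr_from_0[OF assms]] by simp

text \<open>The frequencies \<open>\<zeta>\<close> with \<open>2 * c * N * norm \<zeta> powr (d / 2 - \<alpha>) \<le> \<lambda>\<close> contribute at most \<open>\<lambda> / 2\<close>,
  so on the level set of height \<open>\<lambda>\<close> the remaining ones contribute at least \<open>\<lambda> / 2\<close>; these
  are estimated in \<open>L\<^sup>2\<close> and integrated against \<open>p * \<lambda> powr (p - 1)\<close> (Chemin--Xu).\<close>

lemma sobolev_embedding:
  fixes \<alpha> p :: real
  assumes \<alpha>: "0 < \<alpha>" "\<alpha> < DIM('a) / 2" and p: "p * (DIM('a) / 2 - \<alpha>) = DIM('a)"
  obtains C where "C > 0" "\<And>(R :: 'a::euclidean_space \<Rightarrow> complex) N. integrable lborel R \<Longrightarrow> N > 0 \<Longrightarrow>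
    (\<integral>\<^sup>+ \<zeta>. ennreal (norm \<zeta> powr (2 * \<alpha>) * (norm (R \<zeta>))\<^sup>2) \<partial>lborel) \<le> ennreal (N\<^sup>2) \<Longrightarrow>
    (\<integral>\<^sup>+ x. ennreal (norm (LINT \<zeta>|lborel. cis (x \<bullet> \<zeta>) * R \<zeta>) powr p) \<partial>lborel) \<le> ennreal (C * N powr p)"
proof -
  \<comment> \<open>The exponent of the radius in the low-frequency bound. From
    \<open>p * \<delta> = d\<close> and \<open>\<delta> < d / 2\<close> follow \<open>p > 2\<close>
    and \<open>\<delta> * (p - 2) = d - 2 * \<delta> = 2 * \<alpha>\<close>, so integrating over the
    levels reproduces the Sobolev weight.\<close>
  define \<delta> where "\<delta> = DIM('a) / 2 - \<alpha>"
  have \<delta>: "\<delta> > 0" "p * \<delta> = DIM('a)" using \<alpha> p by (auto simp: \<delta>_def)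
  have "2 * \<delta> < p * \<delta>" using \<delta>(2) \<alpha> by (simp add: \<delta>_def)
  then have p2: "p > 2" using \<delta>(1) by simp
  have exponent: "\<delta> * (p - 2) = 2 * \<alpha>" using \<delta>(2) by (simp add: algebra_simps) (simp add: \<delta>_def)
  obtain c where c: "c > 0" and low: "\<And>(R :: 'a \<Rightarrow> complex) N A. integrable lborel R \<Longrightarrow> N > 0 \<Longrightarrow> A > 0 \<Longrightarrow>
    (\<integral>\<^sup>+ \<zeta>. ennreal (norm \<zeta> powr (2 * \<alpha>) * (norm (R \<zeta>))\<^sup>2) \<partial>lborel) \<le> ennreal (N\<^sup>2) \<Longrightarrow>
    (\<integral>\<^sup>+ \<zeta>. ennreal (norm (R \<zeta>)) * indicator (cball 0 A) \<zeta> \<partial>lborel) \<le> ennreal (c * A powr \<delta> * N)"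
    using sobolev_low_frequency[OF \<alpha>] unfolding \<delta>_def by blast
  define K where "K = 4 * p * (2 * pi) ^ DIM('a)"
  have K: "K > 0" using p2 by (simp add: K_def)
  show thesis
  proof
    show "K * (2 * c) powr (p - 2) / (p - 2) > 0" using K c p2 by simp
    fix R :: "'a \<Rightarrow> complex" and N :: real
    assume R: "integrable lborel R" and N: "N > 0"
      and le: "(\<integral>\<^sup>+ \<zeta>. ennreal (norm \<zeta> powr (2 * \<alpha>) * (norm (R \<zeta>))\<^sup>2) \<partial>lborel) \<le> ennreal (N\<^sup>2)"
    have [measurable]: "R \<in> borel_measurable borel" using R by auto
    define \<rho> where "\<rho> x = (LINT \<zeta>|lborel. cis (x \<bullet> \<zeta>) * R \<zeta>)" for x
    have [measurable]: "\<rho> \<in> borel_measurable borel" unfolding \<rho>_def by measurable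
    define \<Lambda> where "\<Lambda> \<zeta> = 2 * c * N * norm (\<zeta>::'a) powr \<delta>" for \<zeta>
    have [measurable]: "\<Lambda> \<in> borel_measurable borel" unfolding \<Lambda>_def by measurable
    have \<Lambda>0: "\<Lambda> \<zeta> \<ge> 0" for \<zeta> using c N by (simp add: \<Lambda>_def)
    define hi where "hi l x = (LINT \<zeta>|lborel. cis (x \<bullet> \<zeta>) * (R \<zeta> * of_real (indicator {\<zeta>. l < \<Lambda> \<zeta>} \<zeta>)))" for l x
    have cut: "integrable lborel (\<lambda>\<zeta>. R \<zeta> * of_real (indicator S \<zeta>))" if [measurable]: "S \<in> sets borel" for S
      by (rule Bochner_Integration.integrable_bound[OF R]) (auto simp: indicator_def)
    have modulate: "integrable lborel (\<lambda>\<zeta>. cis (x \<bullet> \<zeta>) * h \<zeta>)" if "integrable lborel h" for h :: "'a \<Rightarrow> complex" and x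
      by (rule Bochner_Integration.integrable_bound[OF that]) (use that in \<open>auto simp: norm_mult\<close>)
    have hi_ge: "l \<le> 2 * norm (hi l x)" if l: "l > 0" and lx: "l \<le> norm (\<rho> x)" for l x
    proof -
      \<comment> \<open>The radius solves \<open>c * A powr \<delta> * N = l / 2\<close>, the
        largest contribution allowed to the low frequencies.\<close>
      define A where "A = (l / (2 * c * N)) powr (1 / \<delta>)"
      have A: "A > 0" "c * A powr \<delta> * N = l / 2"
        using l c N \<delta>(1) by (auto simp: A_def powr_powr field_simps)
      have sub: "\<zeta> \<in> cball 0 A" if "\<not> l < \<Lambda> \<zeta>" for \<zeta>
      proof -
        have "norm \<zeta> powr \<delta> \<le> l / (2 * c * N)" using that c N by (simp add: \<Lambda>_def field_simps)
        then have "(norm \<zeta> powr \<delta>) powr (1 / \<delta>) \<le> A" unfolding A_def using \<delta>(1) by (intro powr_mono2) auto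
        then show ?thesis using \<delta>(1) by (simp add: powr_powr)
      qed
      let ?lo = "LINT \<zeta>|lborel. cis (x \<bullet> \<zeta>) * (R \<zeta> * of_real (indicator (- {\<zeta>. l < \<Lambda> \<zeta>}) \<zeta>))"
      have "ennreal (norm ?lo) \<le> (\<integral>\<^sup>+ \<zeta>. ennreal (norm (cis (x \<bullet> \<zeta>) * (R \<zeta> * of_real (indicator (- {\<zeta>. l < \<Lambda> \<zeta>}) \<zeta>)))) \<partial>lborel)"
        by (intro integral_norm_bound_ennreal modulate cut) measurable
      also have "\<dots> \<le> (\<integral>\<^sup>+ \<zeta>. ennreal (norm (R \<zeta>)) * indicator (cball 0 A) \<zeta> \<partial>lborel)"
        by (intro nn_integral_mono) (use sub in \<open>auto simp: norm_mult indicator_def\<close>)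
      also have "\<dots> \<le> ennreal (l / 2)"
        using low[OF R N A(1) le] unfolding A(2) .
      finally have lo: "norm ?lo \<le> l / 2" using l by (simp add: ennreal_le_iff)
      have "\<rho> x = (LINT \<zeta>|lborel. cis (x \<bullet> \<zeta>) * (R \<zeta> * of_real (indicator {\<zeta>. l < \<Lambda> \<zeta>} \<zeta>))
          + cis (x \<bullet> \<zeta>) * (R \<zeta> * of_real (indicator (- {\<zeta>. l < \<Lambda> \<zeta>}) \<zeta>)))"
        unfolding \<rho>_def by (intro Bochner_Integration.integral_cong) (auto simp: indicator_def)
      also have "\<dots> = hi l x + ?lo"
        unfolding hi_def by (intro Bochner_Integration.integral_add modulate cut) measurable
      finally have "norm (\<rho> x) \<le> norm (hi l x) + norm ?lo" by (simp add: norm_triangle_ineq)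
      then show ?thesis using lo lx by linarith
    qed
    \<comment> \<open>Layer-cake formula, so that each level \<open>l\<close> can be given its own
      frequency splitting.\<close>
    have "(\<integral>\<^sup>+ x. ennreal (norm (\<rho> x) powr p) \<partial>lborel)
      = (\<integral>\<^sup>+ x. \<integral>\<^sup>+ l. ennreal p * (ennreal (l powr (p - 1)) * indicator {0..norm (\<rho> x)} l) \<partial>lborel \<partial>lborel)"
    proof (rule nn_integral_cong)
      fix x
      have "(\<integral>\<^sup>+ l. ennreal p * (ennreal (l powr (p - 1)) * indicator {0..norm (\<rho> x)} l) \<partial>lborel)
         = ennreal p * (\<integral>\<^sup>+ l. ennreal (l powr (p - 1)) * indicator {0..norm (\<rho> x)} l \<partial>lborel)"
        by (rule nn_integral_cmult) measurable
      also have "\<dots> = ennreal p * ennreal (norm (\<rho> x) powr p / p)"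
        using p2 by (subst nn_integral_powr_Icc) auto
      also have "\<dots> = ennreal (norm (\<rho> x) powr p)"
        using p2 by (subst ennreal_mult[symmetric]) auto
      finally show "ennreal (norm (\<rho> x) powr p) = (\<integral>\<^sup>+ l. ennreal p * (ennreal (l powr (p - 1)) * indicator {0..norm (\<rho> x)} l) \<partial>lborel)" ..
    qed
    also have "\<dots> = (\<integral>\<^sup>+ l. \<integral>\<^sup>+ x. ennreal p * (ennreal (l powr (p - 1)) * indicator {0..norm (\<rho> x)} l) \<partial>lborel \<partial>lborel)"
      unfolding indicator_def atLeastAtMost_iff by (rule lborel_pair.Fubini') measurable
    also have "\<dots> \<le> (\<integral>\<^sup>+ l. \<integral>\<^sup>+ \<zeta>. ennreal (K * (norm (R \<zeta>))\<^sup>2) * (ennreal (l powr (p - 3)) * indicator {0..\<Lambda> \<zeta>} l) \<partial>lborel \<partial>lborel)"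
    proof (rule nn_integral_mono)
      fix l :: real
      show "(\<integral>\<^sup>+ x. ennreal p * (ennreal (l powr (p - 1)) * indicator {0..norm (\<rho> x)} l) \<partial>lborel)
        \<le> (\<integral>\<^sup>+ \<zeta>. ennreal (K * (norm (R \<zeta>))\<^sup>2) * (ennreal (l powr (p - 3)) * indicator {0..\<Lambda> \<zeta>} l) \<partial>lborel)"
      proof (cases "l > 0")
        case l: True
        have [measurable]: "{\<zeta>. l < \<Lambda> \<zeta>} \<in> sets borel" by measurable
        have hi_meas [measurable]: "hi l \<in> borel_measurable borel" unfolding hi_def by measurable
        have "(\<integral>\<^sup>+ x. ennreal p * (ennreal (l powr (p - 1)) * indicator {0..norm (\<rho> x)} l) \<partial>lborel)
          \<le> (\<integral>\<^sup>+ x. ennreal (4 * p * l powr (p - 3)) * ennreal ((norm (hi l x))\<^sup>2) \<partial>lborel)"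
        proof (rule nn_integral_mono)
          fix x
          show "ennreal p * (ennreal (l powr (p - 1)) * indicator {0..norm (\<rho> x)} l) \<le> ennreal (4 * p * l powr (p - 3)) * ennreal ((norm (hi l x))\<^sup>2)"
          proof (cases "l \<le> norm (\<rho> x)")
            case True
            \<comment> \<open>Passing to the \<open>L\<^sup>2\<close> norm of the high part spends
              two powers of \<open>l\<close> and leaves \<open>l powr (p - 3)\<close>.\<close>
            have "l\<^sup>2 \<le> (2 * norm (hi l x))\<^sup>2"
              using hi_ge[OF l True] l by (intro power_mono) auto
            moreover have "l powr (p - 1) = l powr (p - 3) * l\<^sup>2"
              using l by (simp flip: powr_add powr_numeral)
            ultimately have "p * l powr (p - 1) \<le> 4 * p * l powr (p - 3) * (norm (hi l x))\<^sup>2"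
              using p2 l by (simp add: power_mult_distrib mult.left_commute[of _ p])
            then show ?thesis using p2 l True by (simp add: ennreal_leI flip: ennreal_mult)
          qed simp
        qed
        also have "\<dots> = ennreal (4 * p * l powr (p - 3)) * (\<integral>\<^sup>+ x. ennreal ((norm (hi l x))\<^sup>2) \<partial>lborel)"
          by (rule nn_integral_cmult) measurable
        also have "\<dots> \<le> ennreal (4 * p * l powr (p - 3)) * (ennreal ((2 * pi) ^ DIM('a)) * (\<integral>\<^sup>+ \<zeta>. ennreal ((norm (R \<zeta> * of_real (indicator {\<zeta>. l < \<Lambda> \<zeta>} \<zeta>)))\<^sup>2) \<partial>lborel))"
          unfolding hi_def by (intro mult_left_mono plancherel_le cut) auto
        also have "\<dots> = ennreal (K * l powr (p - 3)) * (\<integral>\<^sup>+ \<zeta>. ennreal ((norm (R \<zeta> * of_real (indicator {\<zeta>. l < \<Lambda> \<zeta>} \<zeta>)))\<^sup>2) \<partial>lborel)"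
        proof -
          have "ennreal (4 * p * l powr (p - 3)) * ennreal ((2 * pi) ^ DIM('a)) = ennreal (K * l powr (p - 3))"
            unfolding K_def using p2 by (subst ennreal_mult[symmetric]) (auto simp: mult_ac)
          then show ?thesis by (simp only: mult.assoc[symmetric])
        qed
        also have "\<dots> = (\<integral>\<^sup>+ \<zeta>. ennreal (K * l powr (p - 3)) * ennreal ((norm (R \<zeta> * of_real (indicator {\<zeta>. l < \<Lambda> \<zeta>} \<zeta>)))\<^sup>2) \<partial>lborel)"
          by (rule nn_integral_cmult[symmetric]) measurable
        also have "\<dots> \<le> (\<integral>\<^sup>+ \<zeta>. ennreal (K * (norm (R \<zeta>))\<^sup>2) * (ennreal (l powr (p - 3)) * indicator {0..\<Lambda> \<zeta>} l) \<partial>lborel)"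
          using l K by (intro nn_integral_mono) (auto simp: indicator_def mult_ac simp flip: ennreal_mult)
        finally show ?thesis .
      next
        case False
        \<comment> \<open>For \<open>l < 0\<close> the indicator vanishes, and at
          \<open>l = 0\<close> the factor \<open>0 powr (p - 1)\<close> is 0.\<close>
        then have "ennreal p * (ennreal (l powr (p - 1)) * indicator {0..norm (\<rho> x)} l) = 0" for x
          by (cases "l = 0") (auto simp: indicator_def)
        then show ?thesis by (simp only: nn_integral_const) simp
      qed
    qed
    also have "\<dots> = (\<integral>\<^sup>+ \<zeta>. \<integral>\<^sup>+ l. ennreal (K * (norm (R \<zeta>))\<^sup>2) * (ennreal (l powr (p - 3)) * indicator {0..\<Lambda> \<zeta>} l) \<partial>lborel \<partial>lborel)"
      unfolding indicator_def atLeastAtMost_iff by (rule lborel_pair.Fubini') measurable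
    also have "\<dots> = (\<integral>\<^sup>+ \<zeta>. ennreal (K * (2 * c * N) powr (p - 2) / (p - 2)) * ennreal (norm \<zeta> powr (2 * \<alpha>) * (norm (R \<zeta>))\<^sup>2) \<partial>lborel)"
    proof (rule nn_integral_cong)
      fix \<zeta> :: 'a
      have "(\<integral>\<^sup>+ l. ennreal (K * (norm (R \<zeta>))\<^sup>2) * (ennreal (l powr (p - 3)) * indicator {0..\<Lambda> \<zeta>} l) \<partial>lborel)
         = ennreal (K * (norm (R \<zeta>))\<^sup>2) * (\<integral>\<^sup>+ l. ennreal (l powr (p - 3)) * indicator {0..\<Lambda> \<zeta>} l \<partial>lborel)"
        by (rule nn_integral_cmult) measurable
      \<comment> \<open>Convergence at 0 holds since \<open>p > 2\<close>, that is
        \<open>p - 3 > - 1\<close>.\<close>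
      also have "(\<integral>\<^sup>+ l. ennreal (l powr (p - 3)) * indicator {0..\<Lambda> \<zeta>} l \<partial>lborel) = ennreal (\<Lambda> \<zeta> powr (p - 2) / (p - 2))"
        using p2 \<Lambda>0 by (subst nn_integral_powr_Icc) auto
      also have "\<Lambda> \<zeta> powr (p - 2) = (2 * c * N) powr (p - 2) * norm \<zeta> powr (2 * \<alpha>)"
        using c N unfolding \<Lambda>_def exponent[symmetric] by (simp add: powr_mult powr_powr)
      also have "ennreal (K * (norm (R \<zeta>))\<^sup>2) * ennreal ((2 * c * N) powr (p - 2) * norm \<zeta> powr (2 * \<alpha>) / (p - 2))
          = ennreal (K * (2 * c * N) powr (p - 2) / (p - 2)) * ennreal (norm \<zeta> powr (2 * \<alpha>) * (norm (R \<zeta>))\<^sup>2)"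
        using K p2 by (subst (1 2) ennreal_mult[symmetric]) (auto simp: mult_ac)
      finally show "(\<integral>\<^sup>+ l. ennreal (K * (norm (R \<zeta>))\<^sup>2) * (ennreal (l powr (p - 3)) * indicator {0..\<Lambda> \<zeta>} l) \<partial>lborel)
         = ennreal (K * (2 * c * N) powr (p - 2) / (p - 2)) * ennreal (norm \<zeta> powr (2 * \<alpha>) * (norm (R \<zeta>))\<^sup>2)" .
    qed
    also have "\<dots> = ennreal (K * (2 * c * N) powr (p - 2) / (p - 2)) * (\<integral>\<^sup>+ \<zeta>. ennreal (norm \<zeta> powr (2 * \<alpha>) * (norm (R \<zeta>))\<^sup>2) \<partial>lborel)"
      by (rule nn_integral_cmult) measurable
    also have "\<dots> \<le> ennreal (K * (2 * c * N) powr (p - 2) / (p - 2)) * ennreal (N\<^sup>2)"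
      by (rule mult_left_mono[OF le]) simp
    also have "\<dots> = ennreal (K * (2 * c) powr (p - 2) / (p - 2) * N powr p)"
    proof -
      have "N powr (p - 2) * N\<^sup>2 = N powr p"
        using N by (simp flip: powr_add powr_numeral)
      then have "K * (2 * c * N) powr (p - 2) / (p - 2) * N\<^sup>2 = K * (2 * c) powr (p - 2) / (p - 2) * N powr p"
        using c N by (simp add: powr_mult mult.assoc)
      then show ?thesis using K p2 by (simp flip: ennreal_mult)
    qed
    finally show "(\<integral>\<^sup>+ x. ennreal (norm (LINT \<zeta>|lborel. cis (x \<bullet> \<zeta>) * R \<zeta>) powr p) \<partial>lborel)
      \<le> ennreal (K * (2 * c) powr (p - 2) / (p - 2) * N powr p)"
      unfolding \<rho>_def .
  qed
qed

section \<open>Schwartz functions\<close>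

text \<open>On the unit ball the constant bound suffices; outside it, \<open>d + 1\<close> powers of
  decay beat the volume growth of order \<open>d\<close>.\<close>

lemma integrable_decay:
  fixes f :: "'a::euclidean_space \<Rightarrow> complex"
  assumes [measurable]: "f \<in> borel_measurable borel"
    and C: "\<And>x. norm (f x) \<le> C" "\<And>x. norm x ^ Suc DIM('a) * norm (f x) \<le> C"
  shows "integrable lborel f"
proof (rule integrableI_bounded)
  have [measurable]: "cball (0::'a) R \<in> sets borel" for R by (rule borel_closed) simp
  have "C \<ge> 0" using C(1)[of 0] norm_ge_zero order_trans by blast
  let ?p = "real DIM('a) + 1"
  have "(\<integral>\<^sup>+ x. ennreal (norm (f x)) \<partial>lborel)
    \<le> (\<integral>\<^sup>+ x. ennreal C * indicator (cball (0::'a) 1) x + ennreal C * (ennreal (norm x powr (- ?p)) * indicator (- cball 0 1) x) \<partial>lborel)"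
  proof (rule nn_integral_mono)
    fix x :: 'a
    show "ennreal (norm (f x)) \<le> ennreal C * indicator (cball 0 1) x + ennreal C * (ennreal (norm x powr (- ?p)) * indicator (- cball 0 1) x)"
    proof (cases "x \<in> cball 0 1")
      case True
      then show ?thesis using C(1) by (simp add: ennreal_leI)
    next
      case False
      then have x: "norm x > 1" by simp
      have "norm x powr ?p = norm x ^ Suc DIM('a)"
        using x by (subst powr_realpow[symmetric]) (auto simp: add.commute)
      then have "norm x powr ?p * norm (f x) \<le> C" using C(2)[of x] by simp
      then have "norm (f x) \<le> C * norm x powr (- ?p)"
        using x unfolding powr_minus divide_inverse[symmetric] by (subst pos_le_divide_eq) (auto simp: mult.commute)
      then show ?thesis using False \<open>C \<ge> 0\<close> by (simp add: ennreal_leI flip: ennreal_mult)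
    qed
  qed
  also have "\<dots> = ennreal C * emeasure lborel (cball (0::'a) 1) + ennreal C * (\<integral>\<^sup>+ x. ennreal (norm (x::'a) powr (- ?p)) * indicator (- cball 0 1) x \<partial>lborel)"
    by (simp add: nn_integral_add nn_integral_cmult)
  also have "\<dots> < \<infinity>"
  proof -
    have "emeasure lborel (cball (0::'a) 1) < \<infinity>"
      using emeasure_lborel_cball_le[of 1, where 'a='a] by (auto intro: le_less_trans)
    moreover have "(\<integral>\<^sup>+ x. ennreal (norm (x::'a) powr (- ?p)) * indicator (- cball 0 1) x \<partial>lborel)
        \<le> ennreal (2 ^ DIM('a)) * ennreal (2 powr DIM('a) / (1 - (1/2) powr (?p - DIM('a))) * 1 powr (DIM('a) - ?p))"
      by (rule nn_integral_powr_Compl_cball_le) (auto simp: emeasure_lborel_cball_le)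
    then have "(\<integral>\<^sup>+ x. ennreal (norm (x::'a) powr (- ?p)) * indicator (- cball 0 1) x \<partial>lborel) < \<infinity>"
      by (rule le_less_trans) (simp add: ennreal_mult_less_top)
    ultimately show ?thesis by (simp add: ennreal_mult_less_top)
  qed
  finally show "(\<integral>\<^sup>+ x. ennreal (norm (f x)) \<partial>lborel) < \<infinity>" .
qed simp

section \<open>Derivatives and decay of Schwartz functions\<close>

lemma iterated_deriv_append:
  "iterated_deriv (vs @ ws) \<phi> = iterated_deriv vs (iterated_deriv ws \<phi>)"
  by (induction vs) auto

lemma schwartz_differentiable: "schwartz \<phi> \<Longrightarrow> \<phi> differentiable (at x)"
  unfolding schwartz_def by (metis iterated_deriv.simps(1) lists.Nil)

lemma schwartz_deriv:
  assumes "schwartz \<phi>" "b \<in> Basis"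
  shows "schwartz (\<lambda>x. frechet_derivative \<phi> (at x) b)"
  unfolding schwartz_def
proof
  fix vs :: "'a list" assume "vs \<in> lists Basis"
  then have "vs @ [b] \<in> lists Basis" using assms(2) by auto
  moreover have "iterated_deriv (vs @ [b]) \<phi> = iterated_deriv vs (\<lambda>x. frechet_derivative \<phi> (at x) b)"
    by (simp add: iterated_deriv_append)
  ultimately show "(\<forall>x. iterated_deriv vs (\<lambda>x. frechet_derivative \<phi> (at x) b) differentiable (at x)) \<and>
     (\<forall>k::nat. bounded (range (\<lambda>x. norm x ^ k *\<^sub>R iterated_deriv vs (\<lambda>x. frechet_derivative \<phi> (at x) b) x)))"
    using assms(1) unfolding schwartz_def by (metis (no_types))
qed

lemma schwartz_continuous: "schwartz \<phi> \<Longrightarrow> continuous_on S \<phi>"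
  by (simp add: continuous_at_imp_continuous_on differentiable_imp_continuous_within schwartz_differentiable)

lemma schwartz_measurable: "schwartz \<phi> \<Longrightarrow> \<phi> \<in> borel_measurable borel"
  by (intro borel_measurable_continuous_onI schwartz_continuous)

lemma schwartz_bound:
  assumes "schwartz \<phi>"
  obtains C where "\<And>x. (1 + norm x) ^ k * norm (\<phi> x) \<le> C"
proof -
  have bd: "\<exists>C. \<forall>x. norm x ^ j * norm (\<phi> x) \<le> C" for j
  proof -
    have "bounded (range (\<lambda>x. norm x ^ j *\<^sub>R iterated_deriv [] \<phi> x))"
      using assms unfolding schwartz_def by blast
    then show ?thesis by (auto simp: bounded_iff)
  qed
  obtain C0 Ck where C: "\<And>x. norm x ^ 0 * norm (\<phi> x) \<le> C0" "\<And>x. norm x ^ k * norm (\<phi> x) \<le> Ck"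
    using bd[of 0] bd[of k] by blast
  have "(1 + norm x) ^ k * norm (\<phi> x) \<le> 2 ^ k * (C0 + Ck)" for x
  proof -
    \<comment> \<open>The definition of \<open>schwartz\<close> controls powers of
      \<open>norm x\<close> only; the maximum separates the powers 0 and \<open>k\<close>.\<close>
    have "(1 + norm x) ^ k \<le> (2 * max 1 (norm x)) ^ k"
      by (intro power_mono) auto
    also have "\<dots> = 2 ^ k * max 1 (norm x ^ k)"
    proof (cases "norm x \<le> 1")
      case True
      then have "norm x ^ k \<le> 1" by (simp add: power_le_one)
      with True show ?thesis by (simp add: power_mult_distrib max_absorb1)
    next
      case False
      then have "1 \<le> norm x ^ k" by (simp add: one_le_power)
      with False show ?thesis by (simp add: power_mult_distrib max_absorb2)
    qed
    also have "\<dots> \<le> 2 ^ k * (1 + norm x ^ k)"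
      by (intro mult_left_mono) auto
    finally have "(1 + norm x) ^ k * norm (\<phi> x) \<le> 2 ^ k * (1 + norm x ^ k) * norm (\<phi> x)"
      by (rule mult_right_mono) simp
    also have "\<dots> = 2 ^ k * (norm x ^ 0 * norm (\<phi> x) + norm x ^ k * norm (\<phi> x))"
      by (simp add: algebra_simps)
    also have "\<dots> \<le> 2 ^ k * (C0 + Ck)"
      by (intro mult_left_mono add_mono C) auto
    finally show ?thesis .
  qed
  then show thesis using that by blast
qed

lemma integrable_decay':
  fixes f :: "'a::euclidean_space \<Rightarrow> complex"
  assumes "f \<in> borel_measurable borel" and C: "\<And>x. (1 + norm x) ^ Suc DIM('a) * norm (f x) \<le> C"
  shows "integrable lborel f"
proof (rule integrable_decay[of _ C])
  fix x :: 'a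
  have "1 * norm (f x) \<le> (1 + norm x) ^ Suc DIM('a) * norm (f x)"
    by (intro mult_right_mono one_le_power) auto
  then show "norm (f x) \<le> C" using C[of x] by simp
  have "norm x ^ Suc DIM('a) * norm (f x) \<le> (1 + norm x) ^ Suc DIM('a) * norm (f x)"
    by (intro mult_right_mono power_mono) auto
  then show "norm x ^ Suc DIM('a) * norm (f x) \<le> C" using C[of x] by linarith
qed fact

lemma schwartz_integrable:
  assumes "schwartz (\<phi> :: 'a::euclidean_space \<Rightarrow> complex)"
  shows "integrable lborel \<phi>"
  using schwartz_bound[OF assms, of "Suc DIM('a)"] schwartz_measurable[OF assms] integrable_decay' by metis

lemma schwartz_bounded:
  assumes "schwartz \<phi>"
  obtains C where "\<And>x. norm (\<phi> x) \<le> C"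
  using schwartz_bound[OF assms, of 0] by auto

section \<open>The Fourier transform of Schwartz functions\<close>

abbreviation fourier_const :: "'a::euclidean_space itself \<Rightarrow> real" where
  "fourier_const _ \<equiv> (2 * pi) powr (- real DIM('a) / 2)"

lemma fourier_const_square: "(fourier_const TYPE('a::euclidean_space))\<^sup>2 * (2 * pi) ^ DIM('a) = 1"
proof -
  have "(fourier_const TYPE('a))\<^sup>2 = (2 * pi) powr (- real DIM('a))"
    by (simp add: power2_eq_square flip: powr_add)
  moreover have "(2 * pi) ^ DIM('a) = (2 * pi) powr (real DIM('a))"
    by (simp add: powr_realpow)
  ultimately show ?thesis by (simp flip: powr_add)
qed

lemma fourier_measurable [measurable]:
  assumes [measurable]: "\<phi> \<in> borel_measurable borel"
  shows "fourier \<phi> \<in> borel_measurable borel"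
  unfolding fourier_def by measurable

lemma integrable_cis_mult:
  assumes h: "integrable lborel h" and [measurable]: "f \<in> borel_measurable lborel"
  shows "integrable lborel (\<lambda>x. cis (f x) * (h x :: complex))"
  by (rule Bochner_Integration.integrable_bound[OF h]) (use h in \<open>auto simp: norm_mult\<close>)

lemma norm_fourier_le:
  fixes \<phi> :: "'a::euclidean_space \<Rightarrow> complex"
  assumes "integrable lborel \<phi>"
  shows "norm (fourier \<phi> \<xi>) \<le> fourier_const TYPE('a) * (LINT x|lborel. norm (\<phi> x))"
proof -
  have "norm (LINT x|lborel. cis (- (x \<bullet> \<xi>)) * \<phi> x) \<le> (LINT x|lborel. norm (cis (- (x \<bullet> \<xi>)) * \<phi> x))"
    by (rule integral_norm_bound)
  then show ?thesis by (simp add: fourier_def norm_mult mult_left_mono)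
qed

lemma fourier_translate:
  fixes \<phi> :: "'a::euclidean_space \<Rightarrow> complex"
  assumes [measurable]: "\<phi> \<in> borel_measurable borel"
  shows "fourier (\<lambda>x. \<phi> (x + v)) \<xi> = cis (v \<bullet> \<xi>) * fourier \<phi> \<xi>"
proof -
  have "(LINT x|lborel. cis (- (x \<bullet> \<xi>)) * \<phi> (x + v)) = (LINT x|lborel. cis (- ((- v + 1 *\<^sub>R x) \<bullet> \<xi>)) * \<phi> (- v + 1 *\<^sub>R x + v))"
    by (subst integral_lborel_affine[of 1 _ "- v"]) auto
  also have "\<dots> = (LINT x|lborel. cis (v \<bullet> \<xi>) * (cis (- (x \<bullet> \<xi>)) * \<phi> x))"
    by (simp add: inner_diff_left cis_mult flip: mult.assoc)
  also have "\<dots> = cis (v \<bullet> \<xi>) * (LINT x|lborel. cis (- (x \<bullet> \<xi>)) * \<phi> x)"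
    by (rule integral_mult_right_zero)
  finally show ?thesis by (simp add: fourier_def mult_ac)
qed

lemma fourier_scaled_diff:
  fixes f g :: "'a::euclidean_space \<Rightarrow> complex"
  assumes "integrable lborel f" "integrable lborel g"
  shows "fourier (\<lambda>x. a * (f x - g x)) \<xi> = a * (fourier f \<xi> - fourier g \<xi>)"
proof -
  have "(LINT x|lborel. cis (- (x \<bullet> \<xi>)) * (a * (f x - g x))) = (LINT x|lborel. a * (cis (- (x \<bullet> \<xi>)) * f x - cis (- (x \<bullet> \<xi>)) * g x))"
    by (simp add: algebra_simps)
  also have "\<dots> = a * ((LINT x|lborel. cis (- (x \<bullet> \<xi>)) * f x) - (LINT x|lborel. cis (- (x \<bullet> \<xi>)) * g x))"
    using assms by (subst integral_mult_right_zero, subst Bochner_Integration.integral_diff) (auto intro!: integrable_cis_mult)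
  finally have eq: "(LINT x|lborel. cis (- (x \<bullet> \<xi>)) * (a * (f x - g x))) = \<dots>" .
  show ?thesis unfolding fourier_def eq by (simp only: right_diff_distrib mult.left_commute)
qed

text \<open>Difference quotients take the place of integration by parts: their transforms are known
  from the translation rule. One side converges by dominated convergence, the other by the
  derivative of the exponential at 0.\<close>

lemma fourier_deriv:
  fixes \<phi> :: "'a::euclidean_space \<Rightarrow> complex"
  assumes \<phi>: "schwartz \<phi>" and b: "b \<in> Basis"
  shows "fourier (\<lambda>x. frechet_derivative \<phi> (at x) b) \<xi> = \<i> * of_real (b \<bullet> \<xi>) * fourier \<phi> \<xi>"
proof -
  let ?D = "\<lambda>x. frechet_derivative \<phi> (at x) b"
  define h where "h n = 1 / real (Suc n)" for n
  have h: "0 < h n" "h n \<le> 1" for n by (auto simp: h_def)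
  have h0: "h \<longlonglongrightarrow> 0" unfolding h_def by (rule LIMSEQ_Suc[OF lim_1_over_n])
  have D: "(\<phi> has_derivative frechet_derivative \<phi> (at x)) (at x)" for x
    using schwartz_differentiable[OF \<phi>] frechet_derivative_works by blast
  have vd: "((\<lambda>t. \<phi> (x + t *\<^sub>R b)) has_vector_derivative ?D (x + t *\<^sub>R b)) (at t within S)" for x t S
  proof -
    have "((\<lambda>t. \<phi> (x + t *\<^sub>R b)) has_derivative (\<lambda>h. frechet_derivative \<phi> (at (x + t *\<^sub>R b)) (h *\<^sub>R b))) (at t within S)"
      by (rule has_derivative_compose[OF _ D]) (auto intro!: derivative_eq_intros)
    moreover have "frechet_derivative \<phi> (at y) (h *\<^sub>R b) = h *\<^sub>R ?D y" for h y
      using linear_frechet_derivative[OF schwartz_differentiable[OF \<phi>]] by (simp add: linear_cmul)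
    ultimately show ?thesis by (simp add: has_vector_derivative_def)
  qed
  have [measurable]: "\<phi> \<in> borel_measurable borel" using \<phi> by (rule schwartz_measurable)
  have [measurable]: "?D \<in> borel_measurable borel" by (rule schwartz_measurable[OF schwartz_deriv[OF \<phi> b]])
  have i\<phi>: "integrable lborel \<phi>" using \<phi> by (rule schwartz_integrable)
  have it: "integrable lborel (\<lambda>x. \<phi> (x + v))" for v
    using integrable_lborel_affine[OF _ i\<phi>, of 1 v] by (simp add: add.commute)
  obtain C where C: "\<And>x. (1 + norm x) ^ Suc DIM('a) * norm (?D x) \<le> C"
    using schwartz_bound[OF schwartz_deriv[OF \<phi> b]] by blast
  let ?Q = "\<lambda>n x. of_real (1 / h n) * (\<phi> (x + h n *\<^sub>R b) - \<phi> x)"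
  \<comment> \<open>A majorant of all difference quotients by the mean value inequality;
    \<open>1 + norm x \<le> 2 * (1 + norm (x + t *\<^sub>R b))\<close> for
    \<open>0 \<le> t \<le> 1\<close> is the origin of the power of 2.\<close>
  let ?G = "\<lambda>x::'a. complex_of_real (2 ^ Suc DIM('a) * C / (1 + norm x) ^ Suc DIM('a))"
  have C0: "C \<ge> 0" by (rule order_trans[OF _ C[of 0]]) simp
  have iG: "integrable lborel ?G"
  proof (rule integrable_decay'[where C = "2 ^ Suc DIM('a) * C"])
    fix x :: 'a
    have "1 + norm x > 0" by (simp add: add_pos_nonneg)
    then show "(1 + norm x) ^ Suc DIM('a) * norm (?G x) \<le> 2 ^ Suc DIM('a) * C"
      unfolding norm_of_real using C0 by (simp add: abs_mult)
  qed measurable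
  have bound: "norm (?Q n x) \<le> 2 ^ Suc DIM('a) * C / (1 + norm x) ^ Suc DIM('a)" for n x
  proof -
    have "norm (\<phi> (x + h n *\<^sub>R b) - \<phi> (x + 0 *\<^sub>R b)) \<le> 2 ^ Suc DIM('a) * C / (1 + norm x) ^ Suc DIM('a) * norm (h n - 0)"
    proof (rule differentiable_bound[of "{0..h n}" _ "\<lambda>t s. s *\<^sub>R ?D (x + t *\<^sub>R b)"])
      fix t assume t: "t \<in> {0..h n}"
      show "((\<lambda>t. \<phi> (x + t *\<^sub>R b)) has_derivative (\<lambda>s. s *\<^sub>R ?D (x + t *\<^sub>R b))) (at t within {0..h n})"
        using vd by (simp add: has_vector_derivative_def)
      have n1: "norm x \<le> norm (x + t *\<^sub>R b) + norm (t *\<^sub>R b)"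
        using norm_triangle_ineq4[of "x + t *\<^sub>R b" "t *\<^sub>R b"] by simp
      have n2: "norm (t *\<^sub>R b) \<le> 1" using t h[of n] b by auto
      have "norm x \<le> norm (x + t *\<^sub>R b) + 1"
        by (rule order_trans[OF n1 add_left_mono[OF n2]])
      then have "1 + norm x \<le> 2 * (1 + norm (x + t *\<^sub>R b))"
        using norm_ge_zero[of "x + t *\<^sub>R b"] by argo
      then have "(1 + norm x) ^ Suc DIM('a) \<le> (2 * (1 + norm (x + t *\<^sub>R b))) ^ Suc DIM('a)"
        by (intro power_mono) auto
      then have "(1 + norm x) ^ Suc DIM('a) * norm (?D (x + t *\<^sub>R b)) \<le> (2 * (1 + norm (x + t *\<^sub>R b))) ^ Suc DIM('a) * norm (?D (x + t *\<^sub>R b))"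
        by (rule mult_right_mono) simp
      also have "\<dots> = 2 ^ Suc DIM('a) * ((1 + norm (x + t *\<^sub>R b)) ^ Suc DIM('a) * norm (?D (x + t *\<^sub>R b)))"
        by (simp only: power_mult_distrib mult.assoc)
      also have "\<dots> \<le> 2 ^ Suc DIM('a) * C"
        by (intro mult_left_mono C) simp
      finally have *: "norm (?D (x + t *\<^sub>R b)) \<le> 2 ^ Suc DIM('a) * C / (1 + norm x) ^ Suc DIM('a)"
        by (subst pos_le_divide_eq) (auto simp: add_pos_nonneg mult.commute)
      show "onorm (\<lambda>s. s *\<^sub>R ?D (x + t *\<^sub>R b)) \<le> 2 ^ Suc DIM('a) * C / (1 + norm x) ^ Suc DIM('a)"
        by (rule onorm_le) (use mult_left_mono[OF *, of "\<bar>_\<bar>"] in \<open>simp add: mult.commute\<close>)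
    qed (use h[of n] in auto)
    moreover have "norm (?Q n x) = norm (\<phi> (x + h n *\<^sub>R b) - \<phi> (x + 0 *\<^sub>R b)) / h n"
      using h(1)[of n] by (simp add: norm_mult norm_divide)
    ultimately show ?thesis
      using h(1)[of n] by (simp add: pos_divide_le_eq)
  qed
  have ptw: "(\<lambda>n. ?Q n x) \<longlonglongrightarrow> ?D x" for x
  proof -
    have L: "(\<lambda>v. norm (\<phi> (x + v) - \<phi> x - frechet_derivative \<phi> (at x) v) / norm v) \<midarrow>0\<rightarrow> 0"
      using D[of x] unfolding has_derivative_at by blast
    have "filterlim (\<lambda>n. h n *\<^sub>R b) (at 0) sequentially"
      unfolding filterlim_at using h(1) b h0 tendsto_scaleR[OF h0 tendsto_const[of b]]
      by (auto intro!: always_eventually simp: less_imp_neq[THEN not_sym])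
    from filterlim_compose[OF L this]
    have "(\<lambda>n. norm (\<phi> (x + h n *\<^sub>R b) - \<phi> x - frechet_derivative \<phi> (at x) (h n *\<^sub>R b)) / norm (h n *\<^sub>R b)) \<longlonglongrightarrow> 0" .
    moreover have "norm (\<phi> (x + h n *\<^sub>R b) - \<phi> x - frechet_derivative \<phi> (at x) (h n *\<^sub>R b)) / norm (h n *\<^sub>R b) = norm (?Q n x - ?D x)" for n
    proof -
      have "frechet_derivative \<phi> (at x) (h n *\<^sub>R b) = h n *\<^sub>R ?D x"
        using linear_frechet_derivative[OF schwartz_differentiable[OF \<phi>]] by (simp add: linear_cmul)
      moreover have "?Q n x - ?D x = of_real (1 / h n) * (\<phi> (x + h n *\<^sub>R b) - \<phi> x - h n *\<^sub>R ?D x)"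
        using h(1)[of n] by (simp add: scaleR_conv_of_real right_diff_distrib)
      ultimately show ?thesis
        using h(1)[of n] b by (simp only: norm_mult) (simp add: norm_divide)
    qed
    ultimately have "(\<lambda>n. norm (?Q n x - ?D x)) \<longlonglongrightarrow> 0" by simp
    then show ?thesis by (simp only: tendsto_norm_zero_iff LIM_zero_iff)
  qed
  have lim: "(\<lambda>n. LINT x|lborel. cis (- (x \<bullet> \<xi>)) * ?Q n x) \<longlonglongrightarrow> (LINT x|lborel. cis (- (x \<bullet> \<xi>)) * ?D x)"
  proof (rule integral_dominated_convergence)
    show "integrable lborel (\<lambda>x. norm (?G x))" using iG by (rule integrable_norm)
    show "AE x in lborel. (\<lambda>n. cis (- (x \<bullet> \<xi>)) * ?Q n x) \<longlonglongrightarrow> cis (- (x \<bullet> \<xi>)) * ?D x"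
      by (intro AE_I2 tendsto_mult tendsto_const ptw)
    show "AE x in lborel. norm (cis (- (x \<bullet> \<xi>)) * ?Q n x) \<le> norm (?G x)" for n
      using bound[of n] by (intro AE_I2) (simp only: norm_mult norm_cis norm_of_real mult_1_left order_trans[OF _ abs_ge_self])
  qed measurable
  have "(\<lambda>n. fourier (?Q n) \<xi>) \<longlonglongrightarrow> fourier ?D \<xi>"
    unfolding fourier_def by (intro tendsto_mult tendsto_const lim)
  moreover have "fourier (?Q n) \<xi> = (cis (h n * (b \<bullet> \<xi>)) - 1) / of_real (h n) * fourier \<phi> \<xi>" for n
    using fourier_scaled_diff[OF it[of "h n *\<^sub>R b"] i\<phi>, of "of_real (1 / h n)" \<xi>]
    by (simp add: fourier_translate algebra_simps diff_divide_distrib)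
  ultimately have 1: "(\<lambda>n. (cis (h n * (b \<bullet> \<xi>)) - 1) / of_real (h n) * fourier \<phi> \<xi>) \<longlonglongrightarrow> fourier ?D \<xi>"
    by simp
  have "((\<lambda>z. exp (\<i> * of_real (b \<bullet> \<xi>) * z)) has_field_derivative \<i> * of_real (b \<bullet> \<xi>)) (at 0)"
    by (auto intro!: derivative_eq_intros)
  then have E: "(\<lambda>z. (exp (\<i> * of_real (b \<bullet> \<xi>) * (0 + z)) - exp (\<i> * of_real (b \<bullet> \<xi>) * 0)) / z) \<midarrow>0\<rightarrow> \<i> * of_real (b \<bullet> \<xi>)"
    unfolding DERIV_def .
  have "filterlim (\<lambda>n. complex_of_real (h n)) (at 0) sequentially"
    unfolding filterlim_at using h(1) tendsto_of_real[OF h0]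
    by (auto intro!: always_eventually simp: less_imp_neq[THEN not_sym])
  from filterlim_compose[OF E this]
  have "(\<lambda>n. (cis (h n * (b \<bullet> \<xi>)) - 1) / of_real (h n)) \<longlonglongrightarrow> \<i> * of_real (b \<bullet> \<xi>)"
    by (simp add: cis_conv_exp mult_ac)
  then have 2: "(\<lambda>n. (cis (h n * (b \<bullet> \<xi>)) - 1) / of_real (h n) * fourier \<phi> \<xi>) \<longlonglongrightarrow> \<i> * of_real (b \<bullet> \<xi>) * fourier \<phi> \<xi>"
    by (intro tendsto_intros)
  show ?thesis using LIMSEQ_unique[OF 1 2] .
qed

lemma fourier_deriv_iterate:
  fixes \<phi> :: "'a::euclidean_space \<Rightarrow> complex"
  assumes b: "b \<in> Basis" and \<phi>: "schwartz \<phi>"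
  shows "\<exists>\<psi>. schwartz \<psi> \<and> (\<forall>\<xi>. fourier \<psi> \<xi> = (\<i> * of_real (b \<bullet> \<xi>)) ^ k * fourier \<phi> \<xi>)"
proof (induction k)
  case 0
  show ?case using \<phi> by auto
next
  case (Suc k)
  then obtain \<psi> where \<psi>: "schwartz \<psi>" "\<And>\<xi>. fourier \<psi> \<xi> = (\<i> * of_real (b \<bullet> \<xi>)) ^ k * fourier \<phi> \<xi>" by blast
  then show ?case
    by (intro exI[of _ "\<lambda>x. frechet_derivative \<psi> (at x) b"]) (simp add: schwartz_deriv fourier_deriv b)
qed

text \<open>Differentiating \<open>d + 1\<close> times in a basis direction bounds the transform
  times the \<open>(d + 1)\<close>-st power of that coordinate. Some coordinate is always comparable
  to the norm, so the transform decays with order \<open>d + 1\<close>.\<close>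

lemma schwartz_fourier_integrable:
  fixes \<phi> :: "'a::euclidean_space \<Rightarrow> complex"
  assumes \<phi>: "schwartz \<phi>"
  shows "integrable lborel (fourier \<phi>)"
proof -
  let ?k = "Suc DIM('a)"
  obtain C0 where C0: "\<And>\<xi>. norm (fourier \<phi> \<xi>) \<le> C0"
    using norm_fourier_le[OF schwartz_integrable[OF \<phi>]] by blast
  have "\<forall>b\<in>(Basis::'a set). \<exists>C. \<forall>\<xi>. \<bar>b \<bullet> \<xi>\<bar> ^ ?k * norm (fourier \<phi> \<xi>) \<le> C"
  proof
    fix b :: 'a assume b: "b \<in> Basis"
    obtain \<psi> where \<psi>: "schwartz \<psi>" "\<And>\<xi>. fourier \<psi> \<xi> = (\<i> * of_real (b \<bullet> \<xi>)) ^ ?k * fourier \<phi> \<xi>"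
      using fourier_deriv_iterate[OF b \<phi>] by blast
    have "\<bar>b \<bullet> \<xi>\<bar> ^ ?k * norm (fourier \<phi> \<xi>) = norm (fourier \<psi> \<xi>)" for \<xi>
      unfolding \<psi>(2) by (simp add: norm_mult norm_power)
    then show "\<exists>C. \<forall>\<xi>. \<bar>b \<bullet> \<xi>\<bar> ^ ?k * norm (fourier \<phi> \<xi>) \<le> C"
      using norm_fourier_le[OF schwartz_integrable[OF \<psi>(1)]] by auto
  qed
  then obtain C where C: "\<And>b \<xi>. b \<in> Basis \<Longrightarrow> \<bar>b \<bullet> \<xi>\<bar> ^ ?k * norm (fourier \<phi> \<xi>) \<le> C b"
    by metis
  define K where "K = DIM('a) ^ ?k * (\<Sum>b\<in>(Basis::'a set). C b)"
  have "norm \<xi> ^ ?k * norm (fourier \<phi> \<xi>) \<le> K" for \<xi> :: 'a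
  proof -
    obtain e :: 'a where e: "e \<in> Basis" "norm \<xi> \<le> DIM('a) * \<bar>\<xi> \<bullet> e\<bar>" by (rule obtain_large_coordinate)
    have nn: "C b \<ge> 0" if "b \<in> Basis" for b
      using C[OF that, of 0] order_trans[OF _ C[OF that, of 0]] by auto
    have "norm \<xi> ^ ?k * norm (fourier \<phi> \<xi>) \<le> (DIM('a) * \<bar>\<xi> \<bullet> e\<bar>) ^ ?k * norm (fourier \<phi> \<xi>)"
      by (intro mult_right_mono power_mono e) auto
    also have "\<dots> = DIM('a) ^ ?k * (\<bar>e \<bullet> \<xi>\<bar> ^ ?k * norm (fourier \<phi> \<xi>))"
      by (simp add: power_mult_distrib inner_commute mult_ac)
    also have "\<dots> \<le> DIM('a) ^ ?k * (\<Sum>b\<in>(Basis::'a set). C b)"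
      using C[OF e(1), of \<xi>] member_le_sum[of e Basis C] nn e(1) by (intro mult_left_mono) auto
    finally show ?thesis by (simp add: K_def)
  qed
  moreover have "fourier \<phi> \<in> borel_measurable borel"
    using schwartz_measurable[OF \<phi>] by measurable
  ultimately show ?thesis
    using C0 by (intro integrable_decay[of _ "max C0 K"]) (auto intro: max.coboundedI1 max.coboundedI2)
qed

text \<open>With a Gaussian factor inserted, Fubini turns the inverse integral into a convolution of
  \<phi> with \<open>gauss\<close>. As the factor tends to 1, the same sequence converges to the
  inverse integral by domination and to a multiple of \<open>\<phi> x\<close> by the approximate
  identity.\<close>

lemma fourier_inversion:
  fixes \<phi> :: "'a::euclidean_space \<Rightarrow> complex"
  assumes \<phi>: "schwartz \<phi>"
  shows "of_real (fourier_const TYPE('a)) * (LINT \<xi>|lborel. cis (x \<bullet> \<xi>) * fourier \<phi> \<xi>) = \<phi> x"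
proof -
  let ?c = "fourier_const TYPE('a)"
  define h where "h n = 1 / real (Suc n)" for n
  have h: "0 < h n" for n by (auto simp: h_def)
  have h0: "h \<longlonglongrightarrow> 0" unfolding h_def by (rule LIMSEQ_Suc[OF lim_1_over_n])
  have i\<phi>: "integrable lborel \<phi>" using \<phi> by (rule schwartz_integrable)
  have [measurable]: "\<phi> \<in> borel_measurable borel" using \<phi> by (rule schwartz_measurable)
  have iF: "integrable lborel (fourier \<phi>)" using \<phi> by (rule schwartz_fourier_integrable)
  let ?e = "\<lambda>a (\<xi>::'a). exp (- a * (norm \<xi>)\<^sup>2 / 2)"
  have reg: "(LINT \<xi>|lborel. cis (x \<bullet> \<xi>) * fourier \<phi> \<xi> * of_real (?e a \<xi>))
      = of_real (?c * (2 * pi) ^ DIM('a)) * (LINT y|lborel. \<phi> y * of_real (gauss a (x - y)))" if a: "a > 0" for a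
  proof -
    let ?F = "\<lambda>p. cis (fst p \<bullet> (x - snd p)) * of_real (?e a (fst p)) * \<phi> (snd p)"
    have iF: "integrable (lborel \<Otimes>\<^sub>M lborel) ?F"
      by (rule Bochner_Integration.integrable_bound[OF lborel_pair.integrable_tensor(1)[of "\<lambda>t. of_real (?e a t)" \<phi>]])
         (use fourier_exp_square(3)[OF a] i\<phi> in \<open>auto simp: norm_mult\<close>)
    have "(LINT \<xi>|lborel. cis (x \<bullet> \<xi>) * fourier \<phi> \<xi> * of_real (?e a \<xi>)) = (LINT \<xi>|lborel. of_real ?c * (LINT y|lborel. ?F (\<xi>, y)))"
    proof (intro Bochner_Integration.integral_cong refl)
      fix \<xi> :: 'a
      have "(LINT y|lborel. ?F (\<xi>, y)) = (LINT y|lborel. cis (x \<bullet> \<xi>) * of_real (?e a \<xi>) * (cis (- (y \<bullet> \<xi>)) * \<phi> y))"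
      proof (intro Bochner_Integration.integral_cong refl)
        fix y
        have "cis (\<xi> \<bullet> (x - y)) = cis (x \<bullet> \<xi>) * cis (- (y \<bullet> \<xi>))"
          by (simp add: cis_mult inner_diff_right inner_commute)
        then show "?F (\<xi>, y) = cis (x \<bullet> \<xi>) * of_real (?e a \<xi>) * (cis (- (y \<bullet> \<xi>)) * \<phi> y)"
          by (simp only: fst_conv snd_conv mult_ac)
      qed
      also have "\<dots> = cis (x \<bullet> \<xi>) * of_real (?e a \<xi>) * (LINT y|lborel. cis (- (y \<bullet> \<xi>)) * \<phi> y)"
        by (rule integral_mult_right_zero)
      finally show "cis (x \<bullet> \<xi>) * fourier \<phi> \<xi> * of_real (?e a \<xi>) = of_real ?c * (LINT y|lborel. ?F (\<xi>, y))"
        by (simp only: fourier_def mult_ac)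
    qed
    also have "\<dots> = of_real ?c * (LINT \<xi>|lborel. LINT y|lborel. ?F (\<xi>, y))"
      by (rule integral_mult_right_zero)
    also have "(LINT \<xi>|lborel. LINT y|lborel. ?F (\<xi>, y)) = (LINT y|lborel. LINT \<xi>|lborel. ?F (\<xi>, y))"
      using lborel_pair.Fubini_integral[of "\<lambda>\<xi> y. ?F (\<xi>, y)"] iF by (simp add: case_prod_beta')
    also have "\<dots> = (LINT y|lborel. of_real ((2 * pi) ^ DIM('a)) * (\<phi> y * of_real (gauss a (x - y))))"
    proof (intro Bochner_Integration.integral_cong refl)
      fix y
      have "(LINT \<xi>|lborel. ?F (\<xi>, y)) = (LINT \<xi>|lborel. cis (\<xi> \<bullet> (x - y)) * of_real (?e a \<xi>)) * \<phi> y"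
        unfolding fst_conv snd_conv by (rule integral_mult_left_zero)
      then show "(LINT \<xi>|lborel. ?F (\<xi>, y)) = of_real ((2 * pi) ^ DIM('a)) * (\<phi> y * of_real (gauss a (x - y)))"
        unfolding fourier_exp_square(2)[OF a] by (simp only: of_real_mult mult_ac)
    qed
    also have "\<dots> = of_real ((2 * pi) ^ DIM('a)) * (LINT y|lborel. \<phi> y * of_real (gauss a (x - y)))"
      by (rule integral_mult_right_zero)
    finally show ?thesis by (simp only: of_real_mult mult.assoc)
  qed
  obtain M where M: "\<And>x. norm (\<phi> x) \<le> M" using schwartz_bounded[OF \<phi>] by blast
  have "(\<lambda>n. of_real (?c * (2 * pi) ^ DIM('a)) * (LINT y|lborel. \<phi> y * of_real (gauss ((h n)\<^sup>2) (x - y)))) \<longlonglongrightarrow> of_real (?c * (2 * pi) ^ DIM('a)) * \<phi> x"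
    by (intro tendsto_mult tendsto_const gauss_approximate_identity[OF schwartz_continuous[OF \<phi>] M h h0])
  then have 1: "(\<lambda>n. LINT \<xi>|lborel. cis (x \<bullet> \<xi>) * fourier \<phi> \<xi> * of_real (?e ((h n)\<^sup>2) \<xi>)) \<longlonglongrightarrow> of_real (?c * (2 * pi) ^ DIM('a)) * \<phi> x"
    using reg[of "(h n)\<^sup>2" for n] h by (simp only: zero_less_power)
  have 2: "(\<lambda>n. LINT \<xi>|lborel. cis (x \<bullet> \<xi>) * fourier \<phi> \<xi> * of_real (?e ((h n)\<^sup>2) \<xi>)) \<longlonglongrightarrow> (LINT \<xi>|lborel. cis (x \<bullet> \<xi>) * fourier \<phi> \<xi>)"
  proof (rule integral_dominated_convergence)
    show "integrable lborel (\<lambda>\<xi>. norm (fourier \<phi> \<xi>))" using iF by (rule integrable_norm)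
    have "(\<lambda>n. cis (x \<bullet> \<xi>) * fourier \<phi> \<xi> * of_real (?e ((h n)\<^sup>2) \<xi>)) \<longlonglongrightarrow> cis (x \<bullet> \<xi>) * fourier \<phi> \<xi> * of_real (?e (0\<^sup>2) \<xi>)" for \<xi>
      by (intro tendsto_intros h0) auto
    then show "AE \<xi> in lborel. (\<lambda>n. cis (x \<bullet> \<xi>) * fourier \<phi> \<xi> * of_real (?e ((h n)\<^sup>2) \<xi>)) \<longlonglongrightarrow> cis (x \<bullet> \<xi>) * fourier \<phi> \<xi>"
      by simp
    show "AE \<xi> in lborel. norm (cis (x \<bullet> \<xi>) * fourier \<phi> \<xi> * of_real (?e ((h n)\<^sup>2) \<xi>)) \<le> norm (fourier \<phi> \<xi>)" for n
      by (intro AE_I2) (auto simp: norm_mult intro!: mult_left_le)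
  qed measurable
  have "of_real ?c * (LINT \<xi>|lborel. cis (x \<bullet> \<xi>) * fourier \<phi> \<xi>) = of_real (?c * (?c * (2 * pi) ^ DIM('a))) * \<phi> x"
    using LIMSEQ_unique[OF 1 2] by (simp only: of_real_mult mult.assoc)
  also have "?c * (?c * (2 * pi) ^ DIM('a)) = 1"
    using fourier_const_square[where 'a='a] by (simp only: power2_eq_square mult.assoc)
  finally show ?thesis by simp
qed

section \<open>Modulated Gaussians as test functions\<close>

inductive_set poly_funs :: "('a::euclidean_space \<Rightarrow> complex) set" where
  const: "(\<lambda>_. c) \<in> poly_funs"
| inner: "(\<lambda>x. of_real (x \<bullet> v)) \<in> poly_funs"
| add: "p \<in> poly_funs \<Longrightarrow> q \<in> poly_funs \<Longrightarrow> (\<lambda>x. p x + q x) \<in> poly_funs"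
| mult: "p \<in> poly_funs \<Longrightarrow> q \<in> poly_funs \<Longrightarrow> (\<lambda>x. p x * q x) \<in> poly_funs"

lemma poly_funs_derivative:
  "p \<in> poly_funs \<Longrightarrow> \<exists>p'. (\<forall>x. (p has_derivative p' x) (at x)) \<and> (\<forall>v. (\<lambda>x. p' x v) \<in> poly_funs)"
proof (induction rule: poly_funs.induct)
  case (const c)
  show ?case by (rule exI[of _ "\<lambda>_ _. 0"]) (auto intro: poly_funs.const)
next
  case (inner v)
  show ?case
    by (rule exI[of _ "\<lambda>_ h. of_real (h \<bullet> v)"]) (auto intro!: poly_funs.const derivative_eq_intros)
next
  case (add p q)
  then obtain p' q' where "\<And>x. (p has_derivative p' x) (at x)" "\<And>v. (\<lambda>x. p' x v) \<in> poly_funs"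
    "\<And>x. (q has_derivative q' x) (at x)" "\<And>v. (\<lambda>x. q' x v) \<in> poly_funs" by metis
  then show ?case
    by (intro exI[of _ "\<lambda>x v. p' x v + q' x v"]) (auto intro!: poly_funs.add has_derivative_add)
next
  case (mult p q)
  then obtain p' q' where "\<And>x. (p has_derivative p' x) (at x)" "\<And>v. (\<lambda>x. p' x v) \<in> poly_funs"
    "\<And>x. (q has_derivative q' x) (at x)" "\<And>v. (\<lambda>x. q' x v) \<in> poly_funs" by metis
  with mult.hyps show ?case
    by (intro exI[of _ "\<lambda>x v. p x * q' x v + p' x v * q x"]) (auto intro!: poly_funs.add poly_funs.mult has_derivative_mult)
qed

lemma poly_funs_growth: "p \<in> poly_funs \<Longrightarrow> \<exists>C k. \<forall>x. norm (p x) \<le> C * (1 + norm x) ^ k"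
proof (induction rule: poly_funs.induct)
  case (const c)
  show ?case by (rule exI[of _ "norm c"], rule exI[of _ 0]) simp
next
  case (inner v)
  have "norm (complex_of_real (x \<bullet> v)) \<le> norm v * (1 + norm x) ^ 1" for x
    using Cauchy_Schwarz_ineq2[of x v] by (simp add: algebra_simps add_increasing)
  then show ?case by blast
next
  case (add p q)
  then obtain C k D l where *: "\<And>x. norm (p x) \<le> C * (1 + norm x) ^ k" "\<And>x. norm (q x) \<le> D * (1 + norm x) ^ l" by blast
  have "norm (p x + q x) \<le> (\<bar>C\<bar> + \<bar>D\<bar>) * (1 + norm x) ^ (k + l)" for x
  proof -
    have "C * (1 + norm x) ^ k \<le> \<bar>C\<bar> * (1 + norm x) ^ (k + l)" "D * (1 + norm x) ^ l \<le> \<bar>D\<bar> * (1 + norm x) ^ (k + l)"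
      by (intro mult_mono power_increasing; simp)+
    then show ?thesis
      using *[of x] norm_triangle_ineq[of "p x" "q x"] by (simp add: distrib_right)
  qed
  then show ?case by blast
next
  case (mult p q)
  then obtain C k D l where *: "\<And>x. norm (p x) \<le> C * (1 + norm x) ^ k" "\<And>x. norm (q x) \<le> D * (1 + norm x) ^ l" by blast
  have "norm (p x * q x) \<le> (C * D) * (1 + norm x) ^ (k + l)" for x
  proof -
    have "norm (p x * q x) \<le> (C * (1 + norm x) ^ k) * (D * (1 + norm x) ^ l)"
      unfolding norm_mult by (intro mult_mono * order_trans[OF norm_ge_zero *(1)]) auto
    then show ?thesis by (simp add: power_add mult_ac)
  qed
  then show ?case by blast
qed

lemma power_mult_exp_square_bounded:
  "\<exists>C. \<forall>y\<ge>0. (1 + y) ^ k * exp (- y\<^sup>2 / 2) \<le> (C::real)"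
proof (intro exI allI impI)
  fix y :: real assume y: "y \<ge> 0"
  have "(1 + y) ^ k / fact k \<le> exp (1 + y)"
    using sum_le_suminf[OF summable_exp[of "1 + y"], of "{k}"] y by (simp add: exp_def divide_inverse mult.commute)
  then have "(1 + y) ^ k \<le> fact k * exp (1 + y)" by (simp add: field_simps)
  then have "(1 + y) ^ k * exp (- y\<^sup>2 / 2) \<le> fact k * exp (1 + y) * exp (- y\<^sup>2 / 2)"
    by (rule mult_right_mono) simp
  also have "\<dots> = fact k * exp (1 + y - y\<^sup>2 / 2)" by (simp flip: exp_add)
  \<comment> \<open>Completing the square:
    \<open>1 + y - y\<^sup>2 / 2 = 3 / 2 - (y - 1)\<^sup>2 / 2\<close>.\<close>
  also have "\<dots> \<le> fact k * exp (3 / 2)"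
    using zero_le_power2[of "y - 1"] by (intro mult_left_mono) (auto simp: power2_diff)
  finally show "(1 + y) ^ k * exp (- y\<^sup>2 / 2) \<le> fact k * exp (3 / 2)" .
qed

text \<open>A Gaussian centred at \<open>b\<close> and modulated with frequency \<open>a\<close>,
  written as a single exponential so that the chain rule applies. These are the test functions that
  separate tempered functions: \<open>gauss_wave \<xi> 0\<close> on one side of the transform,
  \<open>gauss_wave 0 b\<close> on the other.\<close>

definition gauss_wave :: "'a::euclidean_space \<Rightarrow> 'a \<Rightarrow> 'a \<Rightarrow> complex" where
  "gauss_wave a b x = exp (of_real (- (((x - b) \<bullet> (x - b)) / 2)) + \<i> * of_real (x \<bullet> a))"

lemma gauss_wave_eq: "gauss_wave a b x = of_real (exp (- (norm (x - b))\<^sup>2 / 2)) * cis (x \<bullet> a)"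
proof -
  have "- (norm (x - b))\<^sup>2 / 2 = - (((x - b) \<bullet> (x - b)) / 2)"
    by (simp add: power2_norm_eq_inner)
  then show ?thesis
    by (simp only: gauss_wave_def exp_add cis_conv_exp exp_of_real)
qed

text \<open>Differentiation maps a polynomial times the wave to another polynomial times the wave,
  so every iterated derivative has this shape and the Gaussian absorbs its polynomial
  growth.\<close>

lemma schwartz_gauss_wave: "schwartz (gauss_wave a b :: 'a::euclidean_space \<Rightarrow> complex)"
proof -
  let ?E = "gauss_wave a b :: 'a \<Rightarrow> complex"
  have dE: "(?E has_derivative (\<lambda>h. ?E x * (of_real (- (x - b) \<bullet> h) + \<i> * of_real (h \<bullet> a)))) (at x)" for x
  proof -
    have "((\<lambda>x. complex_of_real (- (((x - b) \<bullet> (x - b)) / 2)) + \<i> * of_real (x \<bullet> a))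
        has_derivative (\<lambda>h. of_real (- (x - b) \<bullet> h) + \<i> * of_real (h \<bullet> a))) (at x)"
      by (auto intro!: derivative_eq_intros simp: inner_commute inner_diff_right diff_divide_distrib)
    from has_derivative_compose[OF this DERIV_exp[unfolded has_field_derivative_def]]
    show ?thesis unfolding gauss_wave_def .
  qed
  have der: "\<exists>q\<in>poly_funs. (\<forall>x. (\<lambda>x. p x * ?E x) differentiable (at x)) \<and> (\<lambda>x. frechet_derivative (\<lambda>x. p x * ?E x) (at x) v) = (\<lambda>x. q x * ?E x)"
    if p: "p \<in> poly_funs" for p v
  proof -
    obtain p' where p': "\<And>x. (p has_derivative p' x) (at x)" "\<And>v. (\<lambda>x. p' x v) \<in> poly_funs"
      using poly_funs_derivative[OF p] by blast
    let ?q = "\<lambda>x. p x * ((of_real (x \<bullet> (- v)) + of_real (b \<bullet> v)) + \<i> * of_real (v \<bullet> a)) + p' x v"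
    have "?q \<in> poly_funs"
      by (intro poly_funs.add poly_funs.mult poly_funs.inner poly_funs.const p p')
    moreover have d: "((\<lambda>x. p x * ?E x) has_derivative (\<lambda>h. p x * (?E x * (of_real (- (x - b) \<bullet> h) + \<i> * of_real (h \<bullet> a))) + p' x h * ?E x)) (at x)" for x
      by (rule has_derivative_mult[OF p'(1) dE])
    moreover have "frechet_derivative (\<lambda>x. p x * ?E x) (at x) v = ?q x * ?E x" for x
      unfolding frechet_derivative_at[OF d, symmetric] by (simp add: algebra_simps inner_diff_left)
    ultimately show ?thesis
      by (intro bexI[of _ ?q]) (auto simp: differentiable_def)
  qed
  have iter: "\<exists>p\<in>poly_funs. iterated_deriv vs ?E = (\<lambda>x. p x * ?E x)" for vs
  proof (induction vs)
    case Nil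
    show ?case by (rule bexI[of _ "\<lambda>_. 1"]) (auto intro: poly_funs.const)
  next
    case (Cons v vs)
    then obtain p where p: "p \<in> poly_funs" "iterated_deriv vs ?E = (\<lambda>x. p x * ?E x)" by blast
    from der[OF p(1), of v] obtain q where "q \<in> poly_funs"
      "(\<lambda>x. frechet_derivative (\<lambda>x. p x * ?E x) (at x) v) = (\<lambda>x. q x * ?E x)" by blast
    then show ?case by (intro bexI[of _ q]) (simp_all add: p(2))
  qed
  show ?thesis
    unfolding schwartz_def
  proof (intro ballI conjI allI)
    fix vs :: "'a list" and x
    obtain p where p: "p \<in> poly_funs" "iterated_deriv vs ?E = (\<lambda>x. p x * ?E x)" using iter by blast
    show "iterated_deriv vs ?E differentiable (at x)" using der[OF p(1), of 0] unfolding p(2) by blast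
    fix k :: nat
    obtain C l where C: "\<And>x. norm (p x) \<le> C * (1 + norm x) ^ l" using poly_funs_growth[OF p(1)] by blast
    obtain D where "\<forall>y\<ge>(0::real). (1 + y) ^ (k + l) * exp (- y\<^sup>2 / 2) \<le> D"
      using power_mult_exp_square_bounded[of "k + l"] by (elim exE)
    then have D: "(1 + y) ^ (k + l) * exp (- y\<^sup>2 / 2) \<le> D" if "y \<ge> 0" for y :: real
      using that by simp
    have "norm (norm x ^ k *\<^sub>R (p x * ?E x)) \<le> \<bar>C\<bar> * (1 + norm b) ^ (k + l) * D" for x
    proof -
      \<comment> \<open>Recentres the polynomial weight at \<open>b\<close>, where the Gaussian
        decays.\<close>
      have 1: "1 + norm x \<le> (1 + norm b) * (1 + norm (x - b))"
      proof -
        have "0 \<le> norm b * norm (x - b)" by simp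
        then show ?thesis
          using norm_triangle_sub[of x b] unfolding distrib_left distrib_right mult_1_left mult_1_right by linarith
      qed
      have "norm (norm x ^ k *\<^sub>R (p x * ?E x)) = norm x ^ k * norm (p x) * exp (- (norm (x - b))\<^sup>2 / 2)"
        by (simp add: gauss_wave_eq norm_mult)
      also have "\<dots> \<le> (1 + norm x) ^ k * (\<bar>C\<bar> * (1 + norm x) ^ l) * exp (- (norm (x - b))\<^sup>2 / 2)"
      proof (intro mult_right_mono mult_mono power_mono)
        show "norm (p x) \<le> \<bar>C\<bar> * (1 + norm x) ^ l"
          using C[of x] mult_right_mono[OF abs_ge_self[of C], of "(1 + norm x) ^ l"] by simp
      qed auto
      also have "\<dots> = \<bar>C\<bar> * ((1 + norm x) ^ (k + l) * exp (- (norm (x - b))\<^sup>2 / 2))"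
        by (simp add: power_add mult_ac)
      also have "\<dots> \<le> \<bar>C\<bar> * (((1 + norm b) * (1 + norm (x - b))) ^ (k + l) * exp (- (norm (x - b))\<^sup>2 / 2))"
        by (intro mult_left_mono mult_right_mono power_mono 1) auto
      also have "\<dots> = \<bar>C\<bar> * (1 + norm b) ^ (k + l) * ((1 + norm (x - b)) ^ (k + l) * exp (- (norm (x - b))\<^sup>2 / 2))"
        by (simp only: power_mult_distrib mult_ac)
      also have "\<dots> \<le> \<bar>C\<bar> * (1 + norm b) ^ (k + l) * D"
        by (intro mult_left_mono D) auto
      finally show ?thesis .
    qed
    then show "bounded (range (\<lambda>x. norm x ^ k *\<^sub>R iterated_deriv vs ?E x))"
      unfolding p(2) bounded_iff by blast
  qed
qed

lemma fourier_gauss_wave_0: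
  "fourier (gauss_wave 0 b) \<xi> = of_real (exp (- (norm \<xi>)\<^sup>2 / 2)) * cis (- (b \<bullet> \<xi>))" for \<xi> :: "'a::euclidean_space"
proof -
  let ?g = "\<lambda>x::'a. complex_of_real (exp (- (norm x)\<^sup>2 / 2))"
  have "gauss_wave 0 b = (\<lambda>x. ?g (x + (- b)))"
    by (simp add: gauss_wave_eq fun_eq_iff)
  then have "fourier (gauss_wave 0 b) \<xi> = cis (- (b \<bullet> \<xi>)) * fourier ?g \<xi>"
    using fourier_translate[of ?g "- b" \<xi>] by simp
  also have "fourier ?g \<xi> = of_real (fourier_const TYPE('a) * ((2 * pi) ^ DIM('a) * gauss 1 (- \<xi>)))"
    using fourier_exp_square(2)[of 1 "- \<xi>"] unfolding fourier_def by simp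
  also have "fourier_const TYPE('a) * ((2 * pi) ^ DIM('a) * gauss 1 (- \<xi>)) = exp (- (norm \<xi>)\<^sup>2 / 2)"
    using fourier_const_square[where 'a='a] by (simp add: gauss_eq power2_eq_square mult_ac)
  finally show ?thesis by (simp only: mult.commute)
qed

section \<open>The Fourier transform on \<open>L\<^sup>2\<close>\<close>

abbreviation L2_sq :: "('a::euclidean_space \<Rightarrow> complex) \<Rightarrow> ennreal" where
  "L2_sq f \<equiv> \<integral>\<^sup>+ x. ennreal ((norm (f x))\<^sup>2) \<partial>lborel"

lemma L2_fun_iff: "L2_fun f \<longleftrightarrow> f \<in> borel_measurable borel \<and> L2_sq f < \<infinity>"
  unfolding L2_fun_def by (auto simp: integrable_iff_bounded)

lemma L2_fun_measurable: "L2_fun f \<Longrightarrow> f \<in> borel_measurable borel"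
  by (simp add: L2_fun_iff)

lemma L2_sq_eq:
  assumes "L2_fun f"
  shows "L2_sq f = ennreal (LINT x|lborel. (norm (f x))\<^sup>2)"
  using assms unfolding L2_fun_def by (intro nn_integral_eq_integral) auto

lemma L2_mult:
  assumes "L2_fun f" "L2_fun g"
  shows "integrable lborel (\<lambda>x. f x * g x)"
    and "ennreal (norm (LINT x|lborel. f x * g x)) ^ 2 \<le> L2_sq f * L2_sq g"
proof -
  note [measurable] = L2_fun_measurable[OF assms(1)] L2_fun_measurable[OF assms(2)]
  have CS: "(\<integral>\<^sup>+ x. ennreal (norm (f x * g x)) \<partial>lborel)\<^sup>2 \<le> L2_sq f * L2_sq g"
    using Cauchy_Schwarz_nn_integral[of "\<lambda>x. ennreal (norm (f x))" lborel "\<lambda>x. ennreal (norm (g x))"]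
    by (simp add: norm_mult ennreal_mult ennreal_power)
  also have "\<dots> < \<infinity>" using assms by (simp add: L2_fun_iff ennreal_mult_less_top)
  finally have "(\<integral>\<^sup>+ x. ennreal (norm (f x * g x)) \<partial>lborel) < \<infinity>"
    by (metis ennreal_top_eq_mult_iff infinity_ennreal_def less_irrefl not_less_zero power2_eq_square top.not_eq_extremum)
  then show *: "integrable lborel (\<lambda>x. f x * g x)"
    by (intro integrableI_bounded) auto
  have "ennreal (norm (LINT x|lborel. f x * g x)) ^ 2 \<le> (\<integral>\<^sup>+ x. ennreal (norm (f x * g x)) \<partial>lborel)\<^sup>2"
    by (intro power_mono integral_norm_bound_ennreal *) simp
  with CS show "ennreal (norm (LINT x|lborel. f x * g x)) ^ 2 \<le> L2_sq f * L2_sq g" by (rule order_trans[rotated])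
qed

text \<open>Young's inequality with a free parameter. Letting \<open>e\<close> tend to 0 brings the
  first coefficient to 1, so sharp norm bounds survive limits without taking square roots in
  \<open>ennreal\<close>.\<close>

lemma ennreal_norm_add_square_le:
  fixes z w :: complex
  assumes "e > 0"
  shows "ennreal ((norm (z + w))\<^sup>2) \<le> ennreal (1 + e) * ennreal ((norm z)\<^sup>2) + ennreal (1 + 1 / e) * ennreal ((norm w)\<^sup>2)"
proof -
  have "0 \<le> (e * norm z - norm w)\<^sup>2 / e" using assms by simp
  also have "(e * norm z - norm w)\<^sup>2 / e = e * (norm z)\<^sup>2 - 2 * norm z * norm w + (norm w)\<^sup>2 / e"
    using assms by (simp add: field_simps power2_eq_square)
  finally have "2 * norm z * norm w \<le> e * (norm z)\<^sup>2 + (norm w)\<^sup>2 / e" by simp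
  moreover have "(norm (z + w))\<^sup>2 \<le> (norm z + norm w)\<^sup>2"
    by (intro power_mono norm_triangle_ineq) simp
  ultimately have "(norm (z + w))\<^sup>2 \<le> (1 + e) * (norm z)\<^sup>2 + (1 + 1 / e) * (norm w)\<^sup>2"
    by (simp add: power2_sum algebra_simps)
  then show ?thesis
    using assms by (simp add: ennreal_leI flip: ennreal_mult ennreal_plus)
qed

lemma L2_sq_add_le:
  assumes [measurable]: "f \<in> borel_measurable borel" "g \<in> borel_measurable borel" and "e > 0"
  shows "L2_sq (\<lambda>x. f x + g x) \<le> ennreal (1 + e) * L2_sq f + ennreal (1 + 1 / e) * L2_sq g"
proof -
  have "L2_sq (\<lambda>x. f x + g x) \<le> (\<integral>\<^sup>+ x. ennreal (1 + e) * ennreal ((norm (f x))\<^sup>2) + ennreal (1 + 1 / e) * ennreal ((norm (g x))\<^sup>2) \<partial>lborel)"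
    by (intro nn_integral_mono ennreal_norm_add_square_le assms)
  also have "\<dots> = ennreal (1 + e) * L2_sq f + ennreal (1 + 1 / e) * L2_sq g"
    by (subst nn_integral_add) (auto simp: nn_integral_cmult)
  finally show ?thesis .
qed

lemma L2_fun_add:
  assumes "L2_fun f" "L2_fun g"
  shows "L2_fun (\<lambda>x. f x + g x)"
  using L2_sq_add_le[of f g 1] assms
  by (auto simp: L2_fun_iff ennreal_mult_less_top ennreal_add_less_top intro: le_less_trans)

lemma L2_fun_cmult:
  assumes "L2_fun f"
  shows "L2_fun (\<lambda>x. c * f x)"
  using assms unfolding L2_fun_def by (auto simp: norm_mult power_mult_distrib)

lemma L2_fun_uminus: "L2_fun f \<Longrightarrow> L2_fun (\<lambda>x. - f x)"
  by (simp add: L2_fun_def)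

lemma L2_fun_diff: "L2_fun f \<Longrightarrow> L2_fun g \<Longrightarrow> L2_fun (\<lambda>x. f x - g x)"
  using L2_fun_add[of f "\<lambda>x. - g x"] L2_fun_uminus[of g] by simp

lemma L2_fun_mono:
  assumes "L2_fun f" "g \<in> borel_measurable borel" "\<And>x. norm (g x) \<le> norm (f x)"
  shows "L2_fun g"
proof -
  have "L2_sq g \<le> L2_sq f"
    by (intro nn_integral_mono ennreal_leI power_mono assms) simp
  then show ?thesis using assms by (auto simp: L2_fun_iff intro: le_less_trans)
qed

lemma L2_fun_reflect:
  assumes "L2_fun (f :: 'a::euclidean_space \<Rightarrow> complex)"
  shows "L2_fun (\<lambda>x. f (- x))" "L2_sq (\<lambda>x. f (- x)) = L2_sq f"
proof -
  note [measurable] = L2_fun_measurable[OF assms]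
  show *: "L2_sq (\<lambda>x. f (- x)) = L2_sq f"
    using nn_integral_lborel_affine[of "-1" "\<lambda>x. ennreal ((norm (f x))\<^sup>2)" 0] by simp
  show "L2_fun (\<lambda>x. f (- x))"
    using assms unfolding L2_fun_iff * by simp
qed

text \<open>With \<open>e\<close> fixed the error term vanishes as \<open>n\<close> grows;
  afterwards \<open>e\<close> tends to 0 along \<open>1 / (n + 1)\<close>.\<close>

lemma L2_sq_limit_le:
  assumes [measurable]: "\<And>n. F n \<in> borel_measurable borel" "g \<in> borel_measurable borel"
    and lim: "(\<lambda>n. L2_sq (\<lambda>x. F n x - g x)) \<longlonglongrightarrow> 0" and B: "\<And>n. L2_sq (F n) \<le> B"
  shows "L2_sq g \<le> B"
proof -
  have le: "L2_sq g \<le> ennreal (1 + e) * B" if e: "e > 0" for e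
  proof (rule LIMSEQ_le_const)
    show "(\<lambda>n. ennreal (1 + e) * B + ennreal (1 + 1 / e) * L2_sq (\<lambda>x. F n x - g x)) \<longlonglongrightarrow> ennreal (1 + e) * B"
      using tendsto_add[OF tendsto_const ennreal_tendsto_cmult[OF _ lim, of "ennreal (1 + 1 / e)"]] by simp
    show "\<exists>N. \<forall>n\<ge>N. L2_sq g \<le> ennreal (1 + e) * B + ennreal (1 + 1 / e) * L2_sq (\<lambda>x. F n x - g x)"
    proof (intro exI allI impI)
      fix n
      have "L2_sq g \<le> ennreal (1 + e) * L2_sq (F n) + ennreal (1 + 1 / e) * L2_sq (\<lambda>x. g x - F n x)"
        using L2_sq_add_le[of "F n" "\<lambda>x. g x - F n x" e] e by simp
      also have "\<dots> \<le> ennreal (1 + e) * B + ennreal (1 + 1 / e) * L2_sq (\<lambda>x. F n x - g x)"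
        by (intro add_mono mult_left_mono B) (auto simp: norm_minus_commute)
      finally show "L2_sq g \<le> ennreal (1 + e) * B + ennreal (1 + 1 / e) * L2_sq (\<lambda>x. F n x - g x)" .
    qed
  qed
  show ?thesis
  proof (cases "B = \<infinity>")
    case False
    show ?thesis
    proof (rule LIMSEQ_le_const)
      have "(\<lambda>n. ennreal (1 + 1 / real (Suc n))) \<longlonglongrightarrow> ennreal (1 + 0)"
        by (intro tendsto_ennrealI tendsto_add tendsto_const LIMSEQ_Suc[OF lim_1_over_n])
      from ennreal_tendsto_cmult[OF _ this, of B] False
      show "(\<lambda>n. ennreal (1 + 1 / real (Suc n)) * B) \<longlonglongrightarrow> B"
        by (simp add: mult.commute top.not_eq_extremum)
      show "\<exists>N. \<forall>n\<ge>N. L2_sq g \<le> ennreal (1 + 1 / real (Suc n)) * B"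
        by (intro exI allI impI le) simp
    qed
  qed simp
qed

lemma L2_mult_tendsto:
  assumes F: "\<And>n. L2_fun (F n)" and g: "L2_fun g" and \<psi>: "L2_fun \<psi>"
    and lim: "(\<lambda>n. L2_sq (\<lambda>x. F n x - g x)) \<longlonglongrightarrow> 0"
  shows "(\<lambda>n. LINT x|lborel. F n x * \<psi> x) \<longlonglongrightarrow> (LINT x|lborel. g x * \<psi> x)"
proof -
  have fin: "L2_sq \<psi> < top" using \<psi> by (simp add: L2_fun_iff)
  have "(\<lambda>n. ennreal (norm (LINT x|lborel. (F n x - g x) * \<psi> x)) ^ 2) \<longlonglongrightarrow> 0"
  proof (rule tendsto_sandwich[OF _ _ tendsto_const])
    show "(\<lambda>n. L2_sq \<psi> * L2_sq (\<lambda>x. F n x - g x)) \<longlonglongrightarrow> 0"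
      using ennreal_tendsto_cmult[OF fin lim] by simp
    show "\<forall>\<^sub>F n in sequentially. ennreal (norm (LINT x|lborel. (F n x - g x) * \<psi> x)) ^ 2 \<le> L2_sq \<psi> * L2_sq (\<lambda>x. F n x - g x)"
      using L2_mult(2)[OF L2_fun_diff[OF F g] \<psi>] by (simp add: mult.commute)
  qed simp
  then have "(\<lambda>n. ennreal ((norm (LINT x|lborel. (F n x - g x) * \<psi> x))\<^sup>2)) \<longlonglongrightarrow> ennreal 0"
    by (simp add: ennreal_power)
  then have "(\<lambda>n. (norm (LINT x|lborel. (F n x - g x) * \<psi> x))\<^sup>2) \<longlonglongrightarrow> 0"
    by (subst (asm) tendsto_ennreal_iff) auto
  then have "(\<lambda>n. norm (LINT x|lborel. (F n x - g x) * \<psi> x)) \<longlonglongrightarrow> 0"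
    using tendsto_real_sqrt by fastforce
  then have "(\<lambda>n. LINT x|lborel. (F n x - g x) * \<psi> x) \<longlonglongrightarrow> 0"
    by (rule tendsto_norm_zero_cancel)
  moreover have "(LINT x|lborel. (F n x - g x) * \<psi> x) = (LINT x|lborel. F n x * \<psi> x) - (LINT x|lborel. g x * \<psi> x)" for n
    using L2_mult(1)[OF F[of n] \<psi>] L2_mult(1)[OF g \<psi>] by (simp add: left_diff_distrib)
  ultimately show ?thesis by (simp add: LIM_zero_iff)
qed

section \<open>The Plancherel transform as a limit over truncations\<close>

lemma fourier_L2_sq_le:
  fixes h :: "'a::euclidean_space \<Rightarrow> complex"
  assumes h: "integrable lborel h"
  shows "L2_sq (fourier h) \<le> L2_sq h"
proof -
  have [measurable]: "h \<in> borel_measurable borel" using h by auto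
  let ?c = "fourier_const TYPE('a)"
  let ?K = "\<lambda>x. LINT \<xi>|lborel. cis (x \<bullet> \<xi>) * h \<xi>"
  have eq: "fourier h \<xi> = of_real ?c * ?K (- \<xi>)" for \<xi>
    by (simp add: fourier_def inner_commute)
  have "L2_sq (fourier h) = (\<integral>\<^sup>+ \<xi>. ennreal (?c\<^sup>2) * ennreal ((norm (?K (0 + - 1 *\<^sub>R \<xi>)))\<^sup>2) \<partial>lborel)"
    by (rule nn_integral_cong) (simp add: eq norm_mult power_mult_distrib flip: ennreal_mult)
  also have "\<dots> = ennreal (?c\<^sup>2) * (\<integral>\<^sup>+ \<xi>. ennreal ((norm (?K (0 + - 1 *\<^sub>R \<xi>)))\<^sup>2) \<partial>lborel)"
    by (rule nn_integral_cmult) measurable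
  also have "(\<integral>\<^sup>+ \<xi>. ennreal ((norm (?K (0 + - 1 *\<^sub>R \<xi>)))\<^sup>2) \<partial>lborel) = L2_sq ?K"
    by (subst (2) nn_integral_lborel_affine[of "-1" _ 0]) auto
  also have "ennreal (?c\<^sup>2) * \<dots> \<le> ennreal (?c\<^sup>2) * (ennreal ((2 * pi) ^ DIM('a)) * L2_sq h)"
    by (intro mult_left_mono plancherel_le h) simp
  also have "\<dots> = L2_sq h"
  proof -
    have "ennreal (?c\<^sup>2) * ennreal ((2 * pi) ^ DIM('a)) = 1"
    proof -
      have "ennreal (?c\<^sup>2) * ennreal ((2 * pi) ^ DIM('a)) = ennreal (?c\<^sup>2 * (2 * pi) ^ DIM('a))"
        by (rule ennreal_mult[symmetric]) auto
      then show ?thesis by (simp only: fourier_const_square ennreal_1)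
    qed
    then show ?thesis by (simp only: mult.assoc[symmetric] mult_1_left)
  qed
  finally show ?thesis .
qed

lemma fourier_multiplication_formula:
  fixes f \<phi> :: "'a::euclidean_space \<Rightarrow> complex"
  assumes f: "integrable lborel f" and \<phi>: "integrable lborel \<phi>"
  shows "(LINT x|lborel. f x * fourier \<phi> x) = (LINT \<xi>|lborel. fourier f \<xi> * \<phi> \<xi>)"
proof -
  let ?c = "complex_of_real (fourier_const TYPE('a))"
  let ?F = "\<lambda>p. cis (- (fst p \<bullet> snd p)) * (f (fst p) * \<phi> (snd p))"
  have [measurable]: "f \<in> borel_measurable borel" "\<phi> \<in> borel_measurable borel" using f \<phi> by auto
  have iF: "integrable (lborel \<Otimes>\<^sub>M lborel) ?F"
    by (rule Bochner_Integration.integrable_bound[OF lborel_pair.integrable_tensor(1)[OF f \<phi>]]) (auto simp: norm_mult)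
  have "(LINT x|lborel. f x * fourier \<phi> x) = (LINT x|lborel. ?c * (LINT \<xi>|lborel. ?F (x, \<xi>)))"
  proof (intro Bochner_Integration.integral_cong refl)
    fix x
    have "(LINT \<xi>|lborel. ?F (x, \<xi>)) = (LINT \<xi>|lborel. f x * (cis (- (\<xi> \<bullet> x)) * \<phi> \<xi>))"
      by (simp add: inner_commute mult_ac)
    also have "\<dots> = f x * (LINT \<xi>|lborel. cis (- (\<xi> \<bullet> x)) * \<phi> \<xi>)"
      by (rule integral_mult_right_zero)
    finally show "f x * fourier \<phi> x = ?c * (LINT \<xi>|lborel. ?F (x, \<xi>))"
      by (simp only: fourier_def mult_ac)
  qed
  also have "\<dots> = ?c * (LINT x|lborel. LINT \<xi>|lborel. ?F (x, \<xi>))"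
    by (rule integral_mult_right_zero)
  also have "(LINT x|lborel. LINT \<xi>|lborel. ?F (x, \<xi>)) = (LINT \<xi>|lborel. LINT x|lborel. ?F (x, \<xi>))"
    using lborel_pair.Fubini_integral[of "\<lambda>x \<xi>. ?F (x, \<xi>)"] iF by (simp add: case_prod_beta')
  also have "?c * \<dots> = (LINT \<xi>|lborel. ?c * (LINT x|lborel. ?F (x, \<xi>)))"
    by (rule integral_mult_right_zero[symmetric])
  also have "\<dots> = (LINT \<xi>|lborel. fourier f \<xi> * \<phi> \<xi>)"
  proof (intro Bochner_Integration.integral_cong refl)
    fix \<xi>
    have "(LINT x|lborel. ?F (x, \<xi>)) = (LINT x|lborel. (cis (- (x \<bullet> \<xi>)) * f x) * \<phi> \<xi>)"
      by (simp add: mult_ac)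
    also have "\<dots> = (LINT x|lborel. cis (- (x \<bullet> \<xi>)) * f x) * \<phi> \<xi>"
      by (rule integral_mult_left_zero)
    finally show "?c * (LINT x|lborel. ?F (x, \<xi>)) = fourier f \<xi> * \<phi> \<xi>"
      by (simp only: fourier_def mult_ac)
  qed
  finally show ?thesis .
qed

text \<open>The cut-off is in the argument: on a ball, \<open>L\<^sup>2\<close> is contained in
  \<open>L\<^sup>1\<close>, so the transform of a truncation is a genuine integral. The same cut-off
  later restricts frequencies.\<close>

definition truncate_fun :: "nat \<Rightarrow> ('a::euclidean_space \<Rightarrow> complex) \<Rightarrow> 'a \<Rightarrow> complex" where
  "truncate_fun n f x = (if norm x \<le> real n then f x else 0)"

lemma truncate_fun_measurable [measurable]:
  assumes [measurable]: "f \<in> borel_measurable borel"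
  shows "truncate_fun n f \<in> borel_measurable borel"
  unfolding truncate_fun_def by measurable

lemma norm_truncate_fun_le: "norm (truncate_fun n f x) \<le> norm (f x)"
  by (simp add: truncate_fun_def)

lemma L2_fun_truncate: "L2_fun f \<Longrightarrow> L2_fun (truncate_fun n f)"
  by (rule L2_fun_mono[of f]) (auto simp: norm_truncate_fun_le L2_fun_measurable truncate_fun_measurable)

lemma integrable_truncate:
  fixes f :: "'a::euclidean_space \<Rightarrow> complex"
  assumes "L2_fun f"
  shows "integrable lborel (truncate_fun n f)"
proof -
  let ?i = "\<lambda>x::'a. complex_of_real (indicator (cball 0 (real n)) x)"
  have "integrable lborel (indicator (cball 0 (real n)) :: 'a \<Rightarrow> real)"
    by (rule integrable_real_indicator) (use emeasure_bounded_finite[of "cball (0::'a) (real n)"] in \<open>auto intro!: borel_closed\<close>)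
  moreover have "(norm (?i x))\<^sup>2 = indicator (cball 0 (real n)) x" for x
    by (simp add: indicator_def)
  ultimately have "L2_fun ?i"
    unfolding L2_fun_def using borel_closed[OF closed_cball[of "0::'a" "real n"]] by simp
  from L2_mult(1)[OF assms this]
  show ?thesis by (rule back_subst[of "integrable lborel"]) (auto simp: truncate_fun_def fun_eq_iff)
qed

lemma truncate_fun_tendsto:
  fixes f :: "'a::euclidean_space \<Rightarrow> complex"
  assumes f: "L2_fun f"
  shows "(\<lambda>n. L2_sq (\<lambda>x. truncate_fun n f x - f x)) \<longlonglongrightarrow> 0"
proof -
  note [measurable] = L2_fun_measurable[OF f]
  have "(\<lambda>n. L2_sq (\<lambda>x. truncate_fun n f x - f x)) \<longlonglongrightarrow> (\<integral>\<^sup>+ x. 0 \<partial>(lborel :: 'a measure))"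
  proof (rule nn_integral_dominated_convergence[where w = "\<lambda>x. ennreal ((norm (f x))\<^sup>2)"])
    show "(\<integral>\<^sup>+ x. ennreal ((norm (f x))\<^sup>2) \<partial>lborel) < \<infinity>" using f by (simp add: L2_fun_iff)
    show "AE x in lborel. (\<lambda>n. ennreal ((norm (truncate_fun n f x - f x))\<^sup>2)) \<longlonglongrightarrow> 0"
    proof (intro AE_I2 tendsto_eventually)
      fix x :: 'a
      obtain N where "norm x \<le> real N" using real_arch_simple by blast
      then show "\<forall>\<^sub>F n in sequentially. ennreal ((norm (truncate_fun n f x - f x))\<^sup>2) = 0"
        by (intro eventually_sequentiallyI[of N]) (auto simp: truncate_fun_def)
    qed
  qed (auto simp: truncate_fun_def)
  then show ?thesis by simp
qed

lemma truncate_fun_Cauchy: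
  fixes f :: "'a::euclidean_space \<Rightarrow> complex"
  assumes f: "L2_fun f" and e: "e > (0::real)"
  shows "\<exists>N. \<forall>m\<ge>N. \<forall>n\<ge>N. L2_sq (\<lambda>x. truncate_fun m f x - truncate_fun n f x) \<le> ennreal e"
proof -
  note [measurable] = L2_fun_measurable[OF f]
  have "\<forall>\<^sub>F n in sequentially. L2_sq (\<lambda>x. truncate_fun n f x - f x) < ennreal e"
    using truncate_fun_tendsto[OF f] e by (intro order_tendstoD) auto
  then obtain N where N: "\<And>n. n \<ge> N \<Longrightarrow> L2_sq (\<lambda>x. truncate_fun n f x - f x) < ennreal e"
    by (auto simp: eventually_sequentially)
  have "L2_sq (\<lambda>x. truncate_fun m f x - truncate_fun n f x) \<le> ennreal e" if "m \<ge> N" "n \<ge> N" for m n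
  proof -
    have "L2_sq (\<lambda>x. truncate_fun m f x - truncate_fun n f x) \<le> L2_sq (\<lambda>x. truncate_fun N f x - f x)"
      using that by (intro nn_integral_mono ennreal_leI power_mono) (auto simp: truncate_fun_def)
    with N[of N] show ?thesis by (simp add: order_trans less_imp_le)
  qed
  then show ?thesis by blast
qed

lemma fourier_diff:
  fixes f g :: "'a::euclidean_space \<Rightarrow> complex"
  assumes "integrable lborel f" "integrable lborel g"
  shows "fourier (\<lambda>x. f x - g x) \<xi> = fourier f \<xi> - fourier g \<xi>"
  using fourier_scaled_diff[OF assms, of 1] by simp

text \<open>The transforms of the truncations form a Cauchy sequence by the norm inequality. The
  duality is stated for \<psi> in \<open>L\<^sup>1\<close> and \<open>L\<^sup>2\<close>, a wider
  class than Schwartz functions, because it is later tested on \<open>fourier \<phi>\<close>, of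
  which exactly these two properties are established.\<close>

theorem plancherel_exists:
  fixes f :: "'a::euclidean_space \<Rightarrow> complex"
  assumes f: "L2_fun f"
  obtains g where "L2_fun g" "L2_sq g \<le> L2_sq f"
    "(\<lambda>n. L2_sq (\<lambda>\<xi>. fourier (truncate_fun n f) \<xi> - g \<xi>)) \<longlonglongrightarrow> 0"
    "\<forall>\<psi>. integrable lborel \<psi> \<longrightarrow> L2_fun \<psi> \<longrightarrow> (LINT x|lborel. f x * fourier \<psi> x) = (LINT \<xi>|lborel. g \<xi> * \<psi> \<xi>)"
proof -
  note [measurable] = L2_fun_measurable[OF f]
  let ?T = "\<lambda>n. truncate_fun n f"
  have iT: "integrable lborel (?T n)" for n using f by (rule integrable_truncate)
  have L2T: "L2_fun (?T n)" for n using f by (rule L2_fun_truncate)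
  have L2F: "L2_fun (fourier \<psi>)" if "integrable lborel \<psi>" "L2_fun \<psi>" for \<psi> :: "'a \<Rightarrow> complex"
    using fourier_L2_sq_le[OF that(1)] that(2) fourier_measurable[of \<psi>] by (auto simp: L2_fun_iff intro: le_less_trans)
  have "\<exists>g\<in>borel_measurable lborel. (\<lambda>n. L2_sq (\<lambda>\<xi>. fourier (?T n) \<xi> - g \<xi>)) \<longlonglongrightarrow> 0"
  proof (rule L2_complete)
    fix e :: real assume "e > 0"
    from truncate_fun_Cauchy[OF f this] obtain N where
      N: "\<And>m n. m \<ge> N \<Longrightarrow> n \<ge> N \<Longrightarrow> L2_sq (\<lambda>x. ?T m x - ?T n x) \<le> ennreal e" by blast
    have "L2_sq (\<lambda>\<xi>. fourier (?T m) \<xi> - fourier (?T n) \<xi>) \<le> ennreal e" if "m \<ge> N" "n \<ge> N" for m n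
      using fourier_L2_sq_le[OF Bochner_Integration.integrable_diff[OF iT[of m] iT[of n]]] N[OF that]
      unfolding fourier_diff[OF iT iT] by (rule order_trans)
    then show "\<exists>N. \<forall>m\<ge>N. \<forall>n\<ge>N. L2_sq (\<lambda>\<xi>. fourier (?T m) \<xi> - fourier (?T n) \<xi>) \<le> ennreal e" by blast
  qed measurable
  then obtain g where g [measurable]: "g \<in> borel_measurable lborel"
    and lim: "(\<lambda>n. L2_sq (\<lambda>\<xi>. fourier (?T n) \<xi> - g \<xi>)) \<longlonglongrightarrow> 0" by blast
  have le: "L2_sq g \<le> L2_sq f"
  proof (rule L2_sq_limit_le[OF _ _ lim])
    fix n
    have "L2_sq (fourier (?T n)) \<le> L2_sq (?T n)" by (rule fourier_L2_sq_le[OF iT])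
    also have "\<dots> \<le> L2_sq f"
      by (intro nn_integral_mono ennreal_leI power_mono norm_truncate_fun_le) simp
    finally show "L2_sq (fourier (?T n)) \<le> L2_sq f" .
  qed (use g in measurable)
  have L2g: "L2_fun g" using le f g by (auto simp: L2_fun_iff intro: le_less_trans)
  have "(LINT x|lborel. f x * fourier \<psi> x) = (LINT \<xi>|lborel. g \<xi> * \<psi> \<xi>)"
    if \<psi>: "integrable lborel \<psi>" "L2_fun \<psi>" for \<psi>
  proof -
    have "(\<lambda>n. LINT x|lborel. ?T n x * fourier \<psi> x) \<longlonglongrightarrow> (LINT x|lborel. f x * fourier \<psi> x)"
      by (rule L2_mult_tendsto[OF L2T f L2F[OF \<psi>] truncate_fun_tendsto[OF f]])
    moreover have "(\<lambda>n. LINT \<xi>|lborel. fourier (?T n) \<xi> * \<psi> \<xi>) \<longlonglongrightarrow> (LINT \<xi>|lborel. g \<xi> * \<psi> \<xi>)"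
      by (rule L2_mult_tendsto[OF L2F[OF iT L2T] L2g \<psi>(2) lim])
    ultimately show ?thesis
      unfolding fourier_multiplication_formula[OF iT \<psi>(1)] by (rule LIMSEQ_unique)
  qed
  then have "\<forall>\<psi>. integrable lborel \<psi> \<longrightarrow> L2_fun \<psi> \<longrightarrow> (LINT x|lborel. f x * fourier \<psi> x) = (LINT \<xi>|lborel. g \<xi> * \<psi> \<xi>)"
    by blast
  with L2g le lim show thesis by (rule that)
qed

section \<open>Fourier multipliers\<close>

lemma integrable_decay_weight:
  "integrable lborel (\<lambda>x::'a::euclidean_space. complex_of_real (1 / (1 + norm x) ^ Suc DIM('a)))"
proof (rule integrable_decay'[where C = 1])
  fix x :: 'a
  have "(1 + norm x) ^ Suc DIM('a) > 0" by (intro zero_less_power add_pos_nonneg) auto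
  then show "(1 + norm x) ^ Suc DIM('a) * norm (complex_of_real (1 / (1 + norm x) ^ Suc DIM('a))) \<le> 1"
    unfolding norm_of_real by simp
qed measurable

lemma bounded_integrable_L2:
  assumes f: "integrable lborel f" and M: "\<And>x. norm (f x) \<le> M"
  shows "L2_fun f"
  unfolding L2_fun_def
proof
  show "integrable lborel (\<lambda>x. (norm (f x))\<^sup>2)"
    by (rule Bochner_Integration.integrable_bound[OF integrable_mult_right[OF integrable_norm[OF f], of M]])
       (use M f order_trans[OF norm_ge_zero M] in \<open>auto simp: power2_eq_square abs_mult intro!: mult_mono\<close>)
qed (use f in auto)

lemma L2_decay_weight:
  "L2_fun (\<lambda>x::'a::euclidean_space. complex_of_real (1 / (1 + norm x) ^ Suc DIM('a)))"
proof (rule bounded_integrable_L2[OF integrable_decay_weight, of 1])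
  fix x :: 'a
  have "(1 + norm x) ^ Suc DIM('a) \<ge> 1" by (intro one_le_power) simp
  then show "norm (complex_of_real (1 / (1 + norm x) ^ Suc DIM('a))) \<le> 1"
    unfolding norm_of_real by (simp add: divide_le_eq_1)
qed

lemma integrable_weight_L2:
  assumes "L2_fun (u :: 'a::euclidean_space \<Rightarrow> complex)"
  shows "integrable lborel (\<lambda>x. u x / of_real ((1 + norm x) ^ Suc DIM('a)))"
  using L2_mult(1)[OF assms L2_decay_weight] by (simp add: divide_inverse)

lemma integrable_weight_bounded:
  assumes [measurable]: "(u :: 'a::euclidean_space \<Rightarrow> complex) \<in> borel_measurable borel" and M: "\<And>x. norm (u x) \<le> M"
  shows "integrable lborel (\<lambda>x. u x / of_real ((1 + norm x) ^ Suc DIM('a)))"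
proof (rule Bochner_Integration.integrable_bound[OF integrable_mult_right[OF integrable_decay_weight, of "of_real M"]])
  have "norm (u x / of_real ((1 + norm x) ^ Suc DIM('a))) \<le> norm (of_real M * complex_of_real (1 / (1 + norm x) ^ Suc DIM('a)))" for x
    unfolding norm_mult norm_divide norm_of_real using M[of x] by (simp add: divide_right_mono)
  then show "AE x in lborel. norm (u x / of_real ((1 + norm x) ^ Suc DIM('a))) \<le> norm (of_real M * complex_of_real (1 / (1 + norm x) ^ Suc DIM('a)))"
    by simp
qed measurable

lemma tempered_funI:
  assumes "(u :: 'a::euclidean_space \<Rightarrow> complex) \<in> borel_measurable borel"
    "integrable lborel (\<lambda>x. u x / of_real ((1 + norm x) ^ N))"
  shows "tempered_fun u"
  using assms unfolding tempered_fun_def by auto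

lemma tempered_L2: "L2_fun u \<Longrightarrow> tempered_fun u"
  by (rule tempered_funI[OF L2_fun_measurable integrable_weight_L2])

text \<open>The Gaussian beats every polynomial weight. This brings tempered functions within reach
  of the uniqueness theorem for integrable functions.\<close>

lemma tempered_mult_gauss:
  assumes "tempered_fun (u :: 'a::euclidean_space \<Rightarrow> complex)"
  shows "integrable lborel (\<lambda>x. u x * of_real (exp (- (norm x)\<^sup>2 / 2)))"
proof -
  obtain N where N: "integrable lborel (\<lambda>x. u x / of_real ((1 + norm x) ^ N))" and [measurable]: "u \<in> borel_measurable borel"
    using assms unfolding tempered_fun_def by auto
  obtain C where "\<forall>y\<ge>(0::real). (1 + y) ^ N * exp (- y\<^sup>2 / 2) \<le> C"
    using power_mult_exp_square_bounded[of N] by (elim exE)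
  then have C: "(1 + norm x) ^ N * exp (- (norm x)\<^sup>2 / 2) \<le> C" for x :: 'a by simp
  have "norm (u x * of_real (exp (- (norm x)\<^sup>2 / 2))) \<le> norm (of_real C * (u x / of_real ((1 + norm x) ^ N)))" for x
  proof -
    define p where "p = (1 + norm x) ^ N"
    define e where "e = exp (- (norm x)\<^sup>2 / 2)"
    have p: "p > 0" unfolding p_def by (intro zero_less_power add_pos_nonneg) auto
    have e: "e > 0" by (simp add: e_def)
    have pe: "p * e \<le> C" using C[of x] unfolding p_def e_def .
    then have le: "e \<le> C / p" using p by (simp add: pos_le_divide_eq mult.commute)
    have "C > 0" using pe mult_pos_pos[OF p e] by linarith
    from le have "norm (u x) * e \<le> C * (norm (u x) / p)"
      using mult_left_mono[of e "C / p" "norm (u x)"] by (simp add: mult.commute)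
    then show ?thesis
      unfolding p_def[symmetric] e_def[symmetric] norm_mult norm_divide norm_of_real using p e \<open>C > 0\<close> by simp
  qed
  then show ?thesis
    by (intro Bochner_Integration.integrable_bound[OF integrable_mult_right[OF N, of "of_real C"]]) auto
qed

text \<open>Multiplying by a nowhere vanishing Gaussian makes both functions integrable, and the
  hypothesis says that the products have equal transforms.\<close>

lemma AE_eq_if_gauss_integrals_eq:
  fixes v w :: "'a::euclidean_space \<Rightarrow> complex"
  assumes v: "tempered_fun v" and w: "tempered_fun w"
    and eq: "\<And>\<xi>. (LINT x|lborel. v x * (of_real (exp (- (norm x)\<^sup>2 / 2)) * cis (x \<bullet> \<xi>)))
      = (LINT x|lborel. w x * (of_real (exp (- (norm x)\<^sup>2 / 2)) * cis (x \<bullet> \<xi>)))"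
  shows "AE x in lborel. v x = w x"
proof -
  let ?e = "\<lambda>x::'a. complex_of_real (exp (- (norm x)\<^sup>2 / 2))"
  let ?d = "\<lambda>x. v x * ?e x - w x * ?e x"
  note iv = tempered_mult_gauss[OF v] and iw = tempered_mult_gauss[OF w]
  have "AE x in lborel. ?d x = 0"
  proof (rule fourier_eq_0_imp_AE_eq_0)
    show "integrable lborel ?d" using iv iw by (rule Bochner_Integration.integrable_diff)
    fix \<xi> :: 'a
    have "(LINT x|lborel. cis (x \<bullet> \<xi>) * ?d x) = (LINT x|lborel. cis (x \<bullet> \<xi>) * (v x * ?e x) - cis (x \<bullet> \<xi>) * (w x * ?e x))"
      by (simp only: right_diff_distrib)
    also have "\<dots> = (LINT x|lborel. cis (x \<bullet> \<xi>) * (v x * ?e x)) - (LINT x|lborel. cis (x \<bullet> \<xi>) * (w x * ?e x))"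
      by (intro Bochner_Integration.integral_diff integrable_cis_mult iv iw) measurable
    also have "\<dots> = 0"
      using eq[of \<xi>] by (simp only: mult_ac) simp
    finally show "(LINT x|lborel. cis (x \<bullet> \<xi>) * ?d x) = 0" .
  qed
  then show ?thesis
    by eventually_elim (simp flip: left_diff_distrib)
qed

lemma schwartz_separates:
  assumes "tempered_fun v" "tempered_fun w"
    and eq: "\<And>\<phi>. schwartz \<phi> \<Longrightarrow> (LINT x|lborel. v x * \<phi> x) = (LINT x|lborel. w x * \<phi> x)"
  shows "AE x in lborel. v x = w x"
proof (rule AE_eq_if_gauss_integrals_eq[OF assms(1,2)])
  fix \<xi>
  show "(LINT x|lborel. v x * (of_real (exp (- (norm x)\<^sup>2 / 2)) * cis (x \<bullet> \<xi>)))
      = (LINT x|lborel. w x * (of_real (exp (- (norm x)\<^sup>2 / 2)) * cis (x \<bullet> \<xi>)))"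
    using eq[OF schwartz_gauss_wave[of \<xi> 0]] by (simp add: gauss_wave_eq)
qed

lemma has_fourier_unique:
  "has_fourier u g \<Longrightarrow> has_fourier u g' \<Longrightarrow> AE \<xi> in lborel. g \<xi> = g' \<xi>"
  unfolding has_fourier_def by (intro schwartz_separates) auto

text \<open>The transform of \<open>gauss_wave 0 (- \<xi>)\<close> is a Gaussian times the character
  of frequency \<xi>, so testing with these waves gives exactly the integrals that decide
  equality.\<close>

lemma has_fourier_unique_inverse:
  fixes u v :: "'a::euclidean_space \<Rightarrow> complex"
  assumes "has_fourier u g" "has_fourier v g"
  shows "AE x in lborel. u x = v x"
proof (rule AE_eq_if_gauss_integrals_eq)
  show "tempered_fun u" "tempered_fun v" using assms by (auto simp: has_fourier_def)
  fix \<xi> :: 'a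
  have "(LINT x|lborel. u x * fourier (gauss_wave 0 (- \<xi>)) x) = (LINT x|lborel. v x * fourier (gauss_wave 0 (- \<xi>)) x)"
    using assms schwartz_gauss_wave unfolding has_fourier_def by metis
  then show "(LINT x|lborel. u x * (of_real (exp (- (norm x)\<^sup>2 / 2)) * cis (x \<bullet> \<xi>)))
      = (LINT x|lborel. v x * (of_real (exp (- (norm x)\<^sup>2 / 2)) * cis (x \<bullet> \<xi>)))"
    unfolding fourier_gauss_wave_0 by (simp add: inner_commute)
qed

lemma has_fourier_cong_AE:
  assumes "has_fourier u g" "AE \<xi> in lborel. g \<xi> = g' \<xi>" and [measurable]: "g' \<in> borel_measurable borel"
  shows "has_fourier u g'"
proof -
  have [measurable]: "g \<in> borel_measurable borel"
    using assms(1) by (auto simp: has_fourier_def tempered_fun_def)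
  obtain N where N: "integrable lborel (\<lambda>x. g x / of_real ((1 + norm x) ^ N))"
    using assms(1) by (auto simp: has_fourier_def tempered_fun_def)
  have "integrable lborel (\<lambda>x. g' x / of_real ((1 + norm x) ^ N))"
    by (rule integrable_cong_AE_imp[OF N]) (use assms(2) in \<open>auto elim: eventually_mono\<close>)
  then have "tempered_fun g'" by (intro tempered_funI) auto
  moreover have "(LINT \<xi>|lborel. g \<xi> * \<phi> \<xi>) = (LINT \<xi>|lborel. g' \<xi> * \<phi> \<xi>)" if "schwartz \<phi>" for \<phi>
    using schwartz_measurable[OF that] assms(2) by (intro integral_cong_AE) (auto elim: eventually_mono)
  ultimately show ?thesis using assms(1) by (auto simp: has_fourier_def)
qed

lemma schwartz_L2: "schwartz \<phi> \<Longrightarrow> L2_fun \<phi>"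
  by (metis bounded_integrable_L2 schwartz_bounded schwartz_integrable)

lemma schwartz_fourier_L2: "schwartz \<phi> \<Longrightarrow> L2_fun (fourier \<phi>)"
  by (metis bounded_integrable_L2 norm_fourier_le schwartz_fourier_integrable schwartz_integrable)

lemma fourier_reflect:
  fixes f :: "'a::euclidean_space \<Rightarrow> complex"
  assumes [measurable]: "f \<in> borel_measurable borel"
  shows "fourier (\<lambda>x. f (- x)) \<xi> = of_real (fourier_const TYPE('a)) * (LINT x|lborel. cis (\<xi> \<bullet> x) * f x)"
  using integral_lborel_affine[of "-1" "\<lambda>x. cis (x \<bullet> \<xi>) * f x" 0]
  unfolding fourier_def by (simp add: inner_commute)

lemma fourier_reflect_fourier:
  assumes "schwartz \<phi>"
  shows "fourier (\<lambda>x. fourier \<phi> (- x)) = \<phi>"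
  using fourier_reflect[OF fourier_measurable[OF schwartz_measurable[OF assms]]] fourier_inversion[OF assms]
  by (auto simp: fun_eq_iff)

lemma fourier_fourier:
  assumes "schwartz \<phi>"
  shows "fourier (fourier \<phi>) \<xi> = \<phi> (- \<xi>)"
  using fourier_inversion[OF assms, of "- \<xi>"] unfolding fourier_def[of "fourier \<phi>"] by (simp add: inner_commute)

lemma integral_reflect:
  fixes f :: "'a::euclidean_space \<Rightarrow> complex"
  assumes "f \<in> borel_measurable borel"
  shows "(LINT x|lborel. f (- x)) = (LINT x|lborel. f x)"
  using integral_lborel_affine[OF _ assms, of "-1" 0] by simp

lemma has_fourier_L2_exists:
  assumes f: "L2_fun f"
  obtains g where "L2_fun g" "has_fourier f g"
proof -
  obtain g where g: "L2_fun g" and "L2_sq g \<le> L2_sq f"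
    and "(\<lambda>n. L2_sq (\<lambda>\<xi>. fourier (truncate_fun n f) \<xi> - g \<xi>)) \<longlonglongrightarrow> 0"
    and mult': "\<forall>\<psi>. integrable lborel \<psi> \<longrightarrow> L2_fun \<psi> \<longrightarrow> (LINT x|lborel. f x * fourier \<psi> x) = (LINT \<xi>|lborel. g \<xi> * \<psi> \<xi>)"
    by (rule plancherel_exists[OF f])
  note mult = mult'[rule_format]
  have "has_fourier f g"
    unfolding has_fourier_def using f g mult by (auto intro: tempered_L2 schwartz_integrable schwartz_L2)
  with g show thesis by (rule that)
qed

lemma L2_cong_AE:
  assumes "L2_fun f" "AE x in lborel. f x = g x" and [measurable]: "g \<in> borel_measurable borel"
  shows "L2_fun g" "L2_sq g = L2_sq f"
proof -
  show *: "L2_sq g = L2_sq f"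
    by (rule nn_integral_cong_AE) (use assms(2) in \<open>auto elim: eventually_mono\<close>)
  show "L2_fun g" using assms unfolding L2_fun_iff * by simp
qed

text \<open>Equality follows from the two inequalities \<open>\<parallel>F f\<parallel> \<le> \<parallel>f\<parallel>\<close> and \<open>\<parallel>F (F f)\<parallel> \<le> \<parallel>F f\<parallel>\<close>,
  because \<open>F (F f)\<close> is the reflection of \<open>f\<close>.\<close>

lemma plancherel:
  fixes f :: "'a::euclidean_space \<Rightarrow> complex"
  assumes f: "L2_fun f" and g: "has_fourier f g"
  shows "L2_fun g" "L2_sq g = L2_sq f"
proof -
  obtain g0 where g0: "L2_fun g0" "L2_sq g0 \<le> L2_sq f"
    and "(\<lambda>n. L2_sq (\<lambda>\<xi>. fourier (truncate_fun n f) \<xi> - g0 \<xi>)) \<longlonglongrightarrow> 0"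
    and mult0': "\<forall>\<psi>. integrable lborel \<psi> \<longrightarrow> L2_fun \<psi> \<longrightarrow> (LINT x|lborel. f x * fourier \<psi> x) = (LINT \<xi>|lborel. g0 \<xi> * \<psi> \<xi>)"
    by (rule plancherel_exists[OF f])
  note mult0 = mult0'[rule_format]
  obtain g1 where g1: "L2_fun g1" "L2_sq g1 \<le> L2_sq g0"
    and "(\<lambda>n. L2_sq (\<lambda>\<xi>. fourier (truncate_fun n g0) \<xi> - g1 \<xi>)) \<longlonglongrightarrow> 0"
    and mult1': "\<forall>\<psi>. integrable lborel \<psi> \<longrightarrow> L2_fun \<psi> \<longrightarrow> (LINT x|lborel. g0 x * fourier \<psi> x) = (LINT \<xi>|lborel. g1 \<xi> * \<psi> \<xi>)"
    by (rule plancherel_exists[OF g0(1)])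
  note mult1 = mult1'[rule_format]
  note [measurable] = L2_fun_measurable[OF f]
  have "AE x in lborel. g1 x = f (- x)"
  proof (rule schwartz_separates)
    show "tempered_fun g1" "tempered_fun (\<lambda>x. f (- x))"
      using g1(1) L2_fun_reflect(1)[OF f] by (auto intro: tempered_L2)
    fix \<phi> :: "'a \<Rightarrow> complex" assume \<phi>: "schwartz \<phi>"
    have [measurable]: "\<phi> \<in> borel_measurable borel" using \<phi> by (rule schwartz_measurable)
    have "(LINT x|lborel. g1 x * \<phi> x) = (LINT x|lborel. g0 x * fourier \<phi> x)"
      using mult1[OF schwartz_integrable[OF \<phi>] schwartz_L2[OF \<phi>]] by simp
    \<comment> \<open>The test function here is \<open>fourier \<phi>\<close>, admissible as it is
      integrable and in \<open>L\<^sup>2\<close>.\<close>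
    also have "\<dots> = (LINT x|lborel. f x * fourier (fourier \<phi>) x)"
      using mult0[OF schwartz_fourier_integrable[OF \<phi>] schwartz_fourier_L2[OF \<phi>]] by simp
    also have "\<dots> = (LINT x|lborel. f (- x) * \<phi> x)"
      unfolding fourier_fourier[OF \<phi>] using integral_reflect[of "\<lambda>x. f x * \<phi> (- x)"] by simp
    finally show "(LINT x|lborel. g1 x * \<phi> x) = (LINT x|lborel. f (- x) * \<phi> x)" .
  qed
  then have "L2_sq (\<lambda>x. f (- x)) = L2_sq g1"
    by (rule L2_cong_AE(2)[OF g1(1)]) measurable
  then have eq: "L2_sq g0 = L2_sq f"
    using g0(2) g1(2) L2_fun_reflect(2)[OF f] by auto
  have "has_fourier f g0"
    unfolding has_fourier_def using f g0(1) mult0 by (auto intro: tempered_L2 schwartz_integrable schwartz_L2)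
  then have "AE x in lborel. g0 x = g x" using g has_fourier_unique by blast
  moreover have "g \<in> borel_measurable borel" using g by (auto simp: has_fourier_def tempered_fun_def)
  ultimately show "L2_fun g" "L2_sq g = L2_sq f"
    using L2_cong_AE[OF g0(1)] eq by auto
qed

lemma has_fourier_lincomb:
  assumes "L2_fun f1" "L2_fun f2" "has_fourier f1 g1" "has_fourier f2 g2"
  shows "has_fourier (\<lambda>x. f1 x + c * f2 x) (\<lambda>x. g1 x + c * g2 x)"
proof -
  note g = plancherel(1)[OF assms(1,3)] plancherel(1)[OF assms(2,4)]
  have lin: "(LINT x|lborel. (a x + c * b x) * \<psi> x) = (LINT x|lborel. a x * \<psi> x) + c * (LINT x|lborel. b x * \<psi> x)"
    if "L2_fun a" "L2_fun b" "L2_fun \<psi>" for a b \<psi>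
    using L2_mult(1)[OF that(1,3)] L2_mult(1)[OF that(2,3)] by (simp add: distrib_right mult.assoc)
  show ?thesis
    unfolding has_fourier_def
    using assms(3,4) lin[OF assms(1,2) schwartz_fourier_L2] lin[OF g schwartz_L2]
    by (auto intro!: tempered_L2 L2_fun_add L2_fun_cmult assms g simp: has_fourier_def)
qed

lemma L2_cnj: "L2_fun f \<Longrightarrow> L2_fun (\<lambda>x. cnj (f x))"
  unfolding L2_fun_def by auto

lemma L2_norm_lincomb:
  assumes f: "L2_fun f1" "L2_fun f2"
  shows "(LINT x|lborel. (norm (f1 x + c * f2 x))\<^sup>2)
    = (LINT x|lborel. (norm (f1 x))\<^sup>2) + (norm c)\<^sup>2 * (LINT x|lborel. (norm (f2 x))\<^sup>2) + 2 * Re (cnj c * (LINT x|lborel. f1 x * cnj (f2 x)))"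
proof -
  have i: "integrable lborel (\<lambda>x. (norm (f1 x))\<^sup>2)" "integrable lborel (\<lambda>x. (norm (f2 x))\<^sup>2)"
    using f by (auto simp: L2_fun_def)
  have ic: "integrable lborel (\<lambda>x. f1 x * cnj (f2 x))" by (rule L2_mult(1)[OF f(1) L2_cnj[OF f(2)]])
  have iq: "integrable lborel (\<lambda>x. 2 * Re (cnj c * (f1 x * cnj (f2 x))))"
    by (rule integrable_mult_right[OF integrable_Re[OF integrable_mult_right[OF ic]]])
  have "(norm (f1 x + c * f2 x))\<^sup>2 = (norm (f1 x))\<^sup>2 + (norm c)\<^sup>2 * (norm (f2 x))\<^sup>2 + 2 * Re (cnj c * (f1 x * cnj (f2 x)))" for x
    unfolding cmod_power2 by (simp add: power2_eq_square algebra_simps)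
  then have "(LINT x|lborel. (norm (f1 x + c * f2 x))\<^sup>2)
    = (LINT x|lborel. (norm (f1 x))\<^sup>2 + (norm c)\<^sup>2 * (norm (f2 x))\<^sup>2 + 2 * Re (cnj c * (f1 x * cnj (f2 x))))"
    by (simp only:)
  also have "\<dots> = (LINT x|lborel. (norm (f1 x))\<^sup>2) + (norm c)\<^sup>2 * (LINT x|lborel. (norm (f2 x))\<^sup>2) + 2 * (LINT x|lborel. Re (cnj c * (f1 x * cnj (f2 x))))"
    by (simp only: Bochner_Integration.integral_add[OF Bochner_Integration.integrable_add[OF i(1) integrable_mult_right[OF i(2)]] iq]
        Bochner_Integration.integral_add[OF i(1) integrable_mult_right[OF i(2)]] integral_mult_right_zero)
  also have "(LINT x|lborel. Re (cnj c * (f1 x * cnj (f2 x)))) = Re (cnj c * (LINT x|lborel. f1 x * cnj (f2 x)))"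
    using integrable_mult_right[OF ic, of "cnj c"] by (subst integral_Re) auto
  finally show ?thesis .
qed

text \<open>Polarization: the norms of \<open>f1 + c * f2\<close> and of its transform agree, and
  \<open>c = 1\<close>, \<open>c = \<i>\<close> give the real and imaginary parts of the inner
  product.\<close>

lemma plancherel_inner:
  assumes f: "L2_fun f1" "L2_fun f2" and g: "has_fourier f1 g1" "has_fourier f2 g2"
  shows "(LINT x|lborel. g1 x * cnj (g2 x)) = (LINT x|lborel. f1 x * cnj (f2 x))"
proof -
  have norm_eq: "(LINT x|lborel. (norm (b x))\<^sup>2) = (LINT x|lborel. (norm (a x))\<^sup>2)" if "L2_fun a" "has_fourier a b" for a b
    using plancherel[OF that] L2_sq_eq[OF that(1)] L2_sq_eq[OF plancherel(1)[OF that]]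
    by (simp add: integral_nonneg_AE ennreal_inj)
  note L2g = plancherel(1)[OF f(1) g(1)] plancherel(1)[OF f(2) g(2)]
  have "Re (cnj c * (LINT x|lborel. g1 x * cnj (g2 x))) = Re (cnj c * (LINT x|lborel. f1 x * cnj (f2 x)))" for c
    using norm_eq[OF L2_fun_add[OF f(1) L2_fun_cmult[OF f(2)]] has_fourier_lincomb[OF f g], of c]
      norm_eq[OF f(1) g(1)] norm_eq[OF f(2) g(2)]
    unfolding L2_norm_lincomb[OF f] L2_norm_lincomb[OF L2g] by simp
  from this[of 1] this[of \<i>] show ?thesis by (auto simp: complex_eq_iff)
qed

text \<open>The part of \<open>h\<close> in the unit ball has a convergent Fourier integral, the
  part outside has a Plancherel transform, and \<open>u\<close> is the reflection of their sum. This
  \<open>u\<close> need not be in \<open>L\<^sup>2\<close>, but from \<open>n = 1\<close> on it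
  differs from the transform of the truncation by an \<open>L\<^sup>2\<close> function.\<close>

lemma inverse_fourier_exists:
  fixes h :: "'a::euclidean_space \<Rightarrow> complex"
  assumes h1: "integrable lborel (\<lambda>\<xi>. if norm \<xi> \<le> 1 then h \<xi> else 0)"
    and h2: "L2_fun (\<lambda>\<xi>. if norm \<xi> \<le> 1 then 0 else h \<xi>)"
  obtains u where "has_fourier u h" "(\<lambda>n. L2_sq (\<lambda>x. fourier (truncate_fun n h) (- x) - u x)) \<longlonglongrightarrow> 0"
proof -
  define a where "a = (\<lambda>\<xi>. if norm \<xi> \<le> 1 then h \<xi> else 0)"
  define b where "b = (\<lambda>\<xi>. if norm \<xi> \<le> 1 then 0 else h \<xi>)"
  have a: "integrable lborel a" and b: "L2_fun b" using h1 h2 by (auto simp: a_def b_def)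
  note [measurable] = borel_measurable_integrable[OF a, simplified] L2_fun_measurable[OF b]
  have h_eq: "h = (\<lambda>\<xi>. a \<xi> + b \<xi>)" by (auto simp: a_def b_def)
  have [measurable]: "h \<in> borel_measurable borel" unfolding h_eq by measurable
  obtain w where w: "L2_fun w" and "L2_sq w \<le> L2_sq b" and lim: "(\<lambda>n. L2_sq (\<lambda>\<xi>. fourier (truncate_fun n b) \<xi> - w \<xi>)) \<longlonglongrightarrow> 0"
    and mult': "\<forall>\<psi>. integrable lborel \<psi> \<longrightarrow> L2_fun \<psi> \<longrightarrow> (LINT x|lborel. b x * fourier \<psi> x) = (LINT \<xi>|lborel. w \<xi> * \<psi> \<xi>)"
    by (rule plancherel_exists[OF b])
  note mult = mult'[rule_format]
  note [measurable] = L2_fun_measurable[OF w]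
  obtain A where A: "\<And>\<xi>. norm (fourier a \<xi>) \<le> A" using norm_fourier_le[OF a] by blast
  define u where "u x = fourier a (- x) + w (- x)" for x
  have "has_fourier u h"
    unfolding has_fourier_def
  proof (intro conjI allI impI)
    have "integrable lborel (\<lambda>x. fourier a (- x) / of_real ((1 + norm x) ^ Suc DIM('a)) + w (- x) / of_real ((1 + norm x) ^ Suc DIM('a)))"
      by (intro Bochner_Integration.integrable_add integrable_weight_L2 L2_fun_reflect w integrable_weight_bounded[OF _ A]) measurable
    then show "tempered_fun u"
      unfolding u_def by (intro tempered_funI[of _ "Suc DIM('a)"]) (auto simp: add_divide_distrib)
    have "integrable lborel (\<lambda>x. a x / of_real ((1 + norm x) ^ Suc DIM('a)))"
    proof (rule Bochner_Integration.integrable_bound[OF a])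
      have "norm (a x / of_real ((1 + norm x) ^ Suc DIM('a))) \<le> norm (a x)" for x
      proof -
        have "1 \<le> (1 + norm x) ^ Suc DIM('a)" by (intro one_le_power) simp
        then show ?thesis
          unfolding norm_divide norm_of_real using mult_left_mono[of 1 "(1 + norm x) ^ Suc DIM('a)" "norm (a x)"]
          by (simp add: divide_le_eq)
      qed
      then show "AE x in lborel. norm (a x / of_real ((1 + norm x) ^ Suc DIM('a))) \<le> norm (a x)" by simp
    qed measurable
    from Bochner_Integration.integrable_add[OF this integrable_weight_L2[OF b]]
    show "tempered_fun h"
      by (intro tempered_funI[of _ "Suc DIM('a)"]) (auto simp: h_eq add_divide_distrib)
    fix \<phi> :: "'a \<Rightarrow> complex" assume \<phi>: "schwartz \<phi>"
    \<comment> \<open>Chosen so that \<open>fourier \<psi> = \<phi>\<close> by inversion.\<close>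
    define \<psi> where "\<psi> x = fourier \<phi> (- x)" for x
    have F\<psi>: "fourier \<psi> = \<phi>" unfolding \<psi>_def by (rule fourier_reflect_fourier[OF \<phi>])
    have iF: "integrable lborel (fourier \<phi>)" and LF: "L2_fun (fourier \<phi>)"
      using \<phi> by (auto intro: schwartz_fourier_integrable schwartz_fourier_L2)
    note [measurable] = L2_fun_measurable[OF LF] schwartz_measurable[OF \<phi>]
    have i\<psi>: "integrable lborel \<psi>" and L\<psi>: "L2_fun \<psi>"
      using integrable_lborel_affine[OF _ iF, of "-1" 0] L2_fun_reflect(1)[OF LF] by (auto simp: \<psi>_def[abs_def])
    have [measurable]: "\<psi> \<in> borel_measurable borel" using L\<psi> by (rule L2_fun_measurable)
    obtain M where M: "\<And>x. norm (\<phi> x) \<le> M" using schwartz_bounded[OF \<phi>] by blast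
    have bounded_mult: "integrable lborel (\<lambda>x. p x * q x)"
      if "integrable lborel q" "\<And>x. norm (p x) \<le> B" and [measurable]: "p \<in> borel_measurable borel" for p q :: "'a \<Rightarrow> complex" and B
    proof (rule Bochner_Integration.integrable_bound[OF integrable_mult_right[OF that(1), of "of_real B"]])
      have "0 \<le> B" using that(2)[of 0] norm_ge_zero order_trans by blast
      then show "AE x in lborel. norm (p x * q x) \<le> norm (of_real B * q x)"
        using that(2) by (auto simp: norm_mult intro!: mult_right_mono)
    qed (use that(1) in measurable)
    have "(LINT x|lborel. u x * fourier \<phi> x) = (LINT x|lborel. u (- x) * fourier \<phi> (- x))"
      by (rule integral_reflect[symmetric]) (simp add: u_def)
    also have "\<dots> = (LINT x|lborel. fourier a x * \<psi> x + w x * \<psi> x)"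
      by (simp add: u_def \<psi>_def distrib_right)
    also have "\<dots> = (LINT x|lborel. fourier a x * \<psi> x) + (LINT x|lborel. w x * \<psi> x)"
      by (intro Bochner_Integration.integral_add bounded_mult[OF i\<psi> A] L2_mult(1)[OF w L\<psi>]) measurable
    also have "\<dots> = (LINT x|lborel. a x * \<phi> x) + (LINT x|lborel. b x * \<phi> x)"
      using fourier_multiplication_formula[OF a i\<psi>] mult[OF i\<psi> L\<psi>] unfolding F\<psi> by simp
    also have "\<dots> = (LINT x|lborel. a x * \<phi> x + b x * \<phi> x)"
    proof (intro Bochner_Integration.integral_add[symmetric] L2_mult(1)[OF b schwartz_L2[OF \<phi>]])
      have "integrable lborel (\<lambda>x. \<phi> x * a x)"
        by (rule bounded_mult[where p = \<phi> and q = a and B = M, OF a M]) measurable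
      then show "integrable lborel (\<lambda>x. a x * \<phi> x)" by (simp add: mult.commute)
    qed
    also have "\<dots> = (LINT x|lborel. h x * \<phi> x)"
      by (simp add: h_eq distrib_right)
    finally show "(LINT x|lborel. u x * fourier \<phi> x) = (LINT \<xi>|lborel. h \<xi> * \<phi> \<xi>)" .
  qed
  \<comment> \<open>For \<open>n \<ge> 1\<close> the truncation keeps all of \<open>a\<close>, whose
    contribution cancels against that in \<open>u\<close>; the Plancherel limit for \<open>b\<close>
    remains.\<close>
  moreover have "(\<lambda>n. L2_sq (\<lambda>x. fourier (truncate_fun n h) (- x) - u x)) \<longlonglongrightarrow> 0"
  proof (rule Lim_transform_eventually[OF lim], rule eventually_sequentiallyI[of 1])
    fix n :: nat assume n: "1 \<le> n"
    have i: "integrable lborel (truncate_fun n b)" by (rule integrable_truncate[OF b])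
    have "truncate_fun n h = (\<lambda>\<xi>. a \<xi> - (- truncate_fun n b \<xi>))"
      using n by (auto simp: truncate_fun_def a_def b_def fun_eq_iff)
    moreover have "fourier (\<lambda>\<xi>. - truncate_fun n b \<xi>) \<xi> = - fourier (truncate_fun n b) \<xi>" for \<xi>
      by (simp add: fourier_def)
    ultimately have "fourier (truncate_fun n h) \<xi> = fourier a \<xi> + fourier (truncate_fun n b) \<xi>" for \<xi>
      using fourier_diff[OF a, of "\<lambda>\<xi>. - truncate_fun n b \<xi>" \<xi>] i by simp
    then have "L2_sq (\<lambda>x. fourier (truncate_fun n h) (- x) - u x) = L2_sq (\<lambda>x. fourier (truncate_fun n b) (- x) - w (- x))"
      by (simp add: u_def)
    also have "\<dots> = L2_sq (\<lambda>x. fourier (truncate_fun n b) x - w x)"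
      using nn_integral_lborel_affine[of "-1" "\<lambda>x. ennreal ((norm (fourier (truncate_fun n b) x - w x))\<^sup>2)" 0] by simp
    finally show "L2_sq (\<lambda>x. fourier (truncate_fun n b) x - w x) = L2_sq (\<lambda>x. fourier (truncate_fun n h) (- x) - u x)" ..
  qed
  ultimately show thesis by (rule that)
qed

text \<open>The choice behind \<open>fourier_multiplier\<close> may rest on another transform
  \<open>g'\<close> of \<open>f\<close>; it agrees with \<open>g\<close> almost everywhere, which
  transfers the relation to \<open>g\<close>.\<close>

lemma has_fourier_fourier_multiplier:
  assumes f: "has_fourier f g" and u: "has_fourier u (\<lambda>\<xi>. m \<xi> * g \<xi>)" and [measurable]: "m \<in> borel_measurable borel"
  shows "has_fourier (fourier_multiplier m f) (\<lambda>\<xi>. m \<xi> * g \<xi>)"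
proof -
  have "\<exists>u g. has_fourier f g \<and> has_fourier u (\<lambda>\<xi>. m \<xi> * g \<xi>)" using f u by blast
  then have "\<exists>g. has_fourier f g \<and> has_fourier (fourier_multiplier m f) (\<lambda>\<xi>. m \<xi> * g \<xi>)"
    unfolding fourier_multiplier_def by (rule someI_ex)
  then obtain g' where g': "has_fourier f g'" "has_fourier (fourier_multiplier m f) (\<lambda>\<xi>. m \<xi> * g' \<xi>)" by blast
  have [measurable]: "g \<in> borel_measurable borel" using f by (auto simp: has_fourier_def tempered_fun_def)
  show ?thesis
    by (rule has_fourier_cong_AE[OF g'(2)])
       (use has_fourier_unique[OF g'(1) f] in \<open>auto elim: eventually_mono\<close>)
qed

text \<open>The Fourier transform of the evolved Riesz potential when \<open>G\<close> is that of
  the initial function. The nesting is the one produced by applying the two multipliers in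
  turn.\<close>

definition evolved_symbol :: "real \<Rightarrow> real \<Rightarrow> ('a::euclidean_space \<Rightarrow> complex) \<Rightarrow> 'a \<Rightarrow> complex" where
  "evolved_symbol s t G \<xi> = cis (- t * (norm \<xi>)\<^sup>2) * (of_real (norm \<xi> powr (- s)) * G \<xi>)"

lemma L2_fun_powr_cball:
  fixes s A :: real
  assumes s: "0 \<le> s" "2 * s < DIM('a)"
  shows "L2_fun (\<lambda>\<xi>::'a::euclidean_space. complex_of_real (if norm \<xi> \<le> A then norm \<xi> powr (- s) else 0))"
    (is "L2_fun ?m")
proof (cases "A \<le> 0")
  case True
  have "\<xi> = 0" if "norm \<xi> \<le> A" for \<xi> :: 'a
    using order_trans[OF that True] by simp
  \<comment> \<open>Only the origin can satisfy the condition, and there \<open>0 powr (- s)\<close>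
    is 0. Truncation at \<open>n = 0\<close> falls into this case.\<close>
  then have "?m = (\<lambda>_. 0)" by (auto simp: fun_eq_iff)
  then show ?thesis by (simp add: L2_fun_def)
next
  case False
  obtain C where C: "\<And>A. A > 0 \<Longrightarrow> (\<integral>\<^sup>+ x. ennreal (norm x powr (- (2 * s))) * indicator (cball (0::'a) A) x \<partial>lborel) \<le> ennreal (C * A powr (DIM('a) - 2 * s))"
    using nn_integral_lborel_powr_cball[of "2 * s", where 'a='a] s by auto
  have "(norm \<xi> powr (- s))\<^sup>2 = norm \<xi> powr (- (2 * s))" for \<xi> :: 'a
    by (simp add: power2_eq_square flip: powr_add)
  then have "L2_sq ?m = (\<integral>\<^sup>+ x. ennreal (norm x powr (- (2 * s))) * indicator (cball (0::'a) A) x \<partial>lborel)"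
    by (intro nn_integral_cong) (auto simp: indicator_def)
  also have "\<dots> < \<infinity>" using C[of A] False by (auto intro: le_less_trans)
  finally show ?thesis by (simp add: L2_fun_iff)
qed

text \<open>Low frequencies: the singular factor is square integrable on the unit ball, so its
  product with \<open>G\<close> is integrable. High frequencies: the factor is at most 1 and
  \<open>G\<close> is in \<open>L\<^sup>2\<close>.\<close>

lemma evolved_symbol_inverse_exists:
  fixes G :: "'a::euclidean_space \<Rightarrow> complex" and s t :: real
  assumes G: "L2_fun G" and s: "0 \<le> s" "2 * s < DIM('a)"
  obtains u where "has_fourier u (evolved_symbol s t G)"
    "(\<lambda>n. L2_sq (\<lambda>x. fourier (truncate_fun n (evolved_symbol s t G)) (- x) - u x)) \<longlonglongrightarrow> 0"
proof (rule inverse_fourier_exists[of "evolved_symbol s t G"])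
  note [measurable] = L2_fun_measurable[OF G]
  have em [measurable]: "evolved_symbol s t G \<in> borel_measurable borel" unfolding evolved_symbol_def by measurable
  from integrable_cis_mult[OF L2_mult(1)[OF L2_fun_powr_cball[OF s, of 1] G], of "\<lambda>\<xi>. - t * (norm \<xi>)\<^sup>2"]
  show "integrable lborel (\<lambda>\<xi>. if norm \<xi> \<le> 1 then evolved_symbol s t G \<xi> else 0)"
    by (rule back_subst[of "integrable lborel"]) (auto simp: evolved_symbol_def fun_eq_iff)
  show "L2_fun (\<lambda>\<xi>. if norm \<xi> \<le> 1 then 0 else evolved_symbol s t G \<xi>)"
  proof (rule L2_fun_mono[OF G])
    fix \<xi> :: 'a
    have "norm \<xi> powr (- s) \<le> 1" if "norm \<xi> > 1"
      using powr_mono[of "- s" 0 "norm \<xi>"] that s by (cases "\<xi> = 0") auto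
    then show "norm (if norm \<xi> \<le> 1 then 0 else evolved_symbol s t G \<xi>) \<le> norm (G \<xi>)"
      by (auto simp: evolved_symbol_def norm_mult intro!: mult_left_le_one_le)
  qed measurable
qed (rule that)

text \<open>Both multipliers are unspecified choices. Uniqueness of inverse transforms identifies
  their composite, up to a null set, with the explicit \<open>u\<close>, which is approximated in
  \<open>L\<^sup>2\<close> by convergent Fourier integrals.\<close>

lemma schrodinger_riesz_limit:
  fixes f :: "'a::euclidean_space \<Rightarrow> complex" and s t :: real
  assumes f: "L2_fun f" and G: "has_fourier f G" and s: "0 \<le> s" "2 * s < DIM('a)"
  shows "schrodinger t (riesz_potential s f) \<in> borel_measurable borel"
    and "(\<lambda>n. L2_sq (\<lambda>x. fourier (truncate_fun n (evolved_symbol s t G)) (- x) - schrodinger t (riesz_potential s f) x)) \<longlonglongrightarrow> 0"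
proof -
  have L2G: "L2_fun G" by (rule plancherel(1)[OF f G])
  note [measurable] = L2_fun_measurable[OF L2G]
  have em [measurable]: "evolved_symbol s t G \<in> borel_measurable borel" for t unfolding evolved_symbol_def by measurable
  \<comment> \<open>Time 0 supplies a function with the symbol of the Riesz potential; such a
    function must exist for the choice in \<open>riesz_potential s f\<close> to be
    meaningful.\<close>
  obtain u0 where u0: "has_fourier u0 (evolved_symbol s 0 G)"
    and "(\<lambda>n. L2_sq (\<lambda>x. fourier (truncate_fun n (evolved_symbol s 0 G)) (- x) - u0 x)) \<longlonglongrightarrow> 0"
    by (rule evolved_symbol_inverse_exists[OF L2G s])
  have e0: "evolved_symbol s 0 G = (\<lambda>\<xi>. of_real (norm \<xi> powr (- s)) * G \<xi>)"
    by (simp add: evolved_symbol_def fun_eq_iff)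
  have R: "has_fourier (riesz_potential s f) (\<lambda>\<xi>. of_real (norm \<xi> powr (- s)) * G \<xi>)"
    unfolding riesz_potential_def by (rule has_fourier_fourier_multiplier[OF G u0[unfolded e0]]) measurable
  obtain u where u: "has_fourier u (evolved_symbol s t G)"
    "(\<lambda>n. L2_sq (\<lambda>x. fourier (truncate_fun n (evolved_symbol s t G)) (- x) - u x)) \<longlonglongrightarrow> 0"
    by (rule evolved_symbol_inverse_exists[OF L2G s])
  have S: "has_fourier (schrodinger t (riesz_potential s f)) (evolved_symbol s t G)"
    unfolding schrodinger_def evolved_symbol_def
    by (rule has_fourier_fourier_multiplier[OF R u(1)[unfolded evolved_symbol_def]]) measurable
  then show "schrodinger t (riesz_potential s f) \<in> borel_measurable borel"
    by (auto simp: has_fourier_def tempered_fun_def)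
  have "AE x in lborel. u x = schrodinger t (riesz_potential s f) x"
    by (rule has_fourier_unique_inverse[OF u(1) S])
  then have "L2_sq (\<lambda>x. fourier (truncate_fun n (evolved_symbol s t G)) (- x) - u x)
      = L2_sq (\<lambda>x. fourier (truncate_fun n (evolved_symbol s t G)) (- x) - schrodinger t (riesz_potential s f) x)" for n
    by (intro nn_integral_cong_AE) (auto elim: eventually_mono)
  with u(2) show "(\<lambda>n. L2_sq (\<lambda>x. fourier (truncate_fun n (evolved_symbol s t G)) (- x) - schrodinger t (riesz_potential s f) x)) \<longlonglongrightarrow> 0"
    by simp
qed

section \<open>The Strichartz estimate for truncated data\<close>

lemma ennreal_powr_ennreal [simp]: "y \<ge> 0 \<Longrightarrow> ennreal_powr (ennreal y) q = ennreal (y powr q)"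
  by (simp add: ennreal_powr_def)

lemma ennreal_powr_mono:
  assumes "q > 0" "x \<le> y"
  shows "ennreal_powr x q \<le> ennreal_powr y q"
proof (cases y)
  case (real b)
  then obtain a where "x = ennreal a" "a \<ge> 0" "a \<le> b"
    using assms(2) by (cases x) (auto simp: top_unique)
  then show ?thesis using real assms(1) by (simp add: ennreal_leI powr_mono2)
qed (simp add: ennreal_powr_def)

lemma ennreal_powr_powr:
  shows "ennreal_powr (ennreal_powr x p) q = ennreal_powr x (p * q)"
  by (cases x) (auto simp: powr_powr, simp add: ennreal_powr_def)

lemma ennreal_powr_measurable [measurable (raw)]:
  assumes [measurable]: "f \<in> borel_measurable M"
  shows "(\<lambda>x. ennreal_powr (f x) p) \<in> borel_measurable M"
  unfolding ennreal_powr_def by measurable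

section \<open>Orthonormal expansions and truncated waves\<close>

lemma pythagoras:
  fixes G :: "'i \<Rightarrow> 'a::euclidean_space \<Rightarrow> complex"
  assumes J: "finite J" and G: "\<And>j. j \<in> J \<Longrightarrow> L2_fun (G j)"
    and orth: "\<And>j k. j \<in> J \<Longrightarrow> k \<in> J \<Longrightarrow> (LINT x|lborel. G j x * cnj (G k x)) = (if j = k then 1 else 0)"
  shows "L2_sq (\<lambda>x. \<Sum>j\<in>J. c j * G j x) = ennreal (\<Sum>j\<in>J. (norm (c j))\<^sup>2)"
proof -
  let ?S = "\<lambda>x. \<Sum>j\<in>J. c j * G j x"
  have L2S: "L2_fun ?S"
    using J G
  proof (induction J rule: finite_induct)
    case empty
    show ?case by (simp add: L2_fun_def)
  next
    case (insert j J)
    then show ?case using L2_fun_add[OF L2_fun_cmult[of "G j" "c j"]] by simp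
  qed
  have i: "integrable lborel (\<lambda>x. G j x * cnj (G k x))" if "j \<in> J" "k \<in> J" for j k
    using L2_mult(1)[OF G[OF that(1)] L2_cnj[OF G[OF that(2)]]] .
  have "of_real (LINT x|lborel. (norm (?S x))\<^sup>2) = (LINT x|lborel. complex_of_real ((norm (?S x))\<^sup>2))"
    by (rule integral_complex_of_real[symmetric])
  also have "\<dots> = (LINT x|lborel. (\<Sum>j\<in>J. \<Sum>k\<in>J. (c j * cnj (c k)) * (G j x * cnj (G k x))))"
    unfolding complex_norm_square by (simp add: sum_product mult_ac)
  also have "\<dots> = (\<Sum>j\<in>J. LINT x|lborel. (\<Sum>k\<in>J. (c j * cnj (c k)) * (G j x * cnj (G k x))))"
    by (rule Bochner_Integration.integral_sum) (intro Bochner_Integration.integrable_sum integrable_mult_right i)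
  also have "\<dots> = (\<Sum>j\<in>J. \<Sum>k\<in>J. LINT x|lborel. (c j * cnj (c k)) * (G j x * cnj (G k x)))"
    by (intro sum.cong refl Bochner_Integration.integral_sum integrable_mult_right i)
  also have "\<dots> = (\<Sum>j\<in>J. \<Sum>k\<in>J. (c j * cnj (c k)) * (if j = k then 1 else 0))"
    by (intro sum.cong refl) (simp add: orth)
  also have "\<dots> = (\<Sum>j\<in>J. c j * cnj (c j))"
    using J by (simp add: if_distrib cong: if_cong)
  also have "\<dots> = of_real (\<Sum>j\<in>J. (norm (c j))\<^sup>2)"
    by (simp add: complex_norm_square[symmetric] flip: of_real_power)
  finally have "(LINT x|lborel. (norm (?S x))\<^sup>2) = (\<Sum>j\<in>J. (norm (c j))\<^sup>2)"
    by (simp only: of_real_eq_iff)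
  then show ?thesis using L2_sq_eq[OF L2S] by simp
qed

text \<open>For fixed \<eta> the kernel is an orthogonal sum in \<xi> with coefficients
  \<open>lam j * cnj (G j \<eta>)\<close>. Pythagoras there, followed by the unit norms in \<eta>,
  gives the value. This is the place where orthonormality yields \<open>\<ell>\<^sup>2\<close>
  rather than \<open>\<ell>\<^sup>1\<close>.\<close>

lemma hilbert_schmidt_norm:
  fixes G :: "'i \<Rightarrow> 'a::euclidean_space \<Rightarrow> complex"
  assumes J: "finite J" and G: "\<And>j. j \<in> J \<Longrightarrow> L2_fun (G j)"
    and orth: "\<And>j k. j \<in> J \<Longrightarrow> k \<in> J \<Longrightarrow> (LINT x|lborel. G j x * cnj (G k x)) = (if j = k then 1 else 0)"
  shows "(\<integral>\<^sup>+ \<eta>. \<integral>\<^sup>+ \<xi>. ennreal ((norm (\<Sum>j\<in>J. of_real (lam j) * (G j \<xi> * cnj (G j \<eta>))))\<^sup>2) \<partial>lborel \<partial>lborel)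
    = ennreal (\<Sum>j\<in>J. (lam j)\<^sup>2)"
proof -
  have nG: "(\<integral>\<^sup>+ \<eta>. ennreal ((norm (G j \<eta>))\<^sup>2) \<partial>lborel) = 1" if "j \<in> J" for j
    using pythagoras[of "{j}" G "\<lambda>_. 1"] G orth that by simp
  have "(\<integral>\<^sup>+ \<xi>. ennreal ((norm (\<Sum>j\<in>J. of_real (lam j) * (G j \<xi> * cnj (G j \<eta>))))\<^sup>2) \<partial>lborel)
      = (\<Sum>j\<in>J. ennreal ((lam j)\<^sup>2) * ennreal ((norm (G j \<eta>))\<^sup>2))" for \<eta>
    using pythagoras[OF J G orth, of "\<lambda>j. of_real (lam j) * cnj (G j \<eta>)"]
    by (simp add: mult_ac norm_mult power_mult_distrib sum_ennreal[symmetric] ennreal_mult)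
  then have "(\<integral>\<^sup>+ \<eta>. \<integral>\<^sup>+ \<xi>. ennreal ((norm (\<Sum>j\<in>J. of_real (lam j) * (G j \<xi> * cnj (G j \<eta>))))\<^sup>2) \<partial>lborel \<partial>lborel)
      = (\<integral>\<^sup>+ \<eta>. (\<Sum>j\<in>J. ennreal ((lam j)\<^sup>2) * ennreal ((norm (G j \<eta>))\<^sup>2)) \<partial>lborel)"
    by simp
  also have "\<dots> = (\<Sum>j\<in>J. ennreal ((lam j)\<^sup>2))"
    using L2_fun_measurable[OF G] by (simp add: nn_integral_sum nn_integral_cmult nG)
  finally show ?thesis by simp
qed

text \<open>The solution with frequencies restricted to \<open>norm \<xi> \<le> n\<close>.
  Reflecting the argument turns \<open>fourier\<close> into the inverse transform.\<close>

definition wave :: "real \<Rightarrow> nat \<Rightarrow> ('a::euclidean_space \<Rightarrow> complex) \<Rightarrow> real \<Rightarrow> 'a \<Rightarrow> complex" where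
  "wave s n G t x = fourier (truncate_fun n (evolved_symbol s t G)) (- x)"

lemma truncated_symbol_integrable:
  fixes G :: "'a::euclidean_space \<Rightarrow> complex" and s :: real
  assumes G: "L2_fun G" and s: "0 \<le> s" "2 * s < DIM('a)"
  shows "integrable lborel (truncate_fun n (evolved_symbol s 0 G))"
proof -
  note [measurable] = L2_fun_measurable[OF G]
  from L2_mult(1)[OF L2_fun_powr_cball[OF s, of "real n"] G] show ?thesis
    by (rule back_subst[of "integrable lborel"]) (auto simp: truncate_fun_def evolved_symbol_def fun_eq_iff)
qed

lemma wave_eq:
  fixes G :: "'a::euclidean_space \<Rightarrow> complex"
  shows "wave s n G t x = of_real (fourier_const TYPE('a)) *
    (LINT \<xi>|lborel. cis (x \<bullet> \<xi> - t * (norm \<xi>)\<^sup>2) * truncate_fun n (evolved_symbol s 0 G) \<xi>)"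
proof -
  have "cis (- (\<xi> \<bullet> - x)) * truncate_fun n (evolved_symbol s t G) \<xi> = cis (x \<bullet> \<xi> - t * (norm \<xi>)\<^sup>2) * truncate_fun n (evolved_symbol s 0 G) \<xi>" for \<xi>
  proof -
    have "cis (x \<bullet> \<xi> - t * (norm \<xi>)\<^sup>2) = cis (- (\<xi> \<bullet> - x)) * cis (- t * (norm \<xi>)\<^sup>2)"
      by (simp add: cis_mult inner_commute)
    then show ?thesis by (simp add: truncate_fun_def evolved_symbol_def)
  qed
  then show ?thesis unfolding wave_def fourier_def by (simp only:)
qed

text \<open>With \<open>\<xi> = \<zeta> + \<eta>\<close> the phase \<open>(norm \<xi>)\<^sup>2 - (norm \<eta>)\<^sup>2\<close> becomes affine in \<open>\<eta>\<close>.\<close>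

definition density_symbol :: "real \<Rightarrow> ('a::euclidean_space \<Rightarrow> complex) \<Rightarrow> 'a \<Rightarrow> complex" where
  "density_symbol t a \<zeta> = (LINT \<eta>|lborel. cis (- t * ((norm \<zeta>)\<^sup>2 + 2 * (\<zeta> \<bullet> \<eta>))) * (a (\<zeta> + \<eta>) * cnj (a \<eta>)))"

text \<open>Tonelli and translation invariance give the square of the \<open>L\<^sup>1\<close> norm
  of \<open>a\<close>.\<close>

lemma integrable_shifted_tensor:
  fixes a :: "'a::euclidean_space \<Rightarrow> complex"
  assumes a: "integrable lborel a"
  shows "integrable (lborel \<Otimes>\<^sub>M lborel) (\<lambda>p. a (fst p + snd p) * cnj (a (snd p)))"
proof (rule integrableI_bounded)
  have [measurable]: "a \<in> borel_measurable borel" using a by auto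
  have shift: "(\<integral>\<^sup>+ \<zeta>. ennreal (norm (a (\<zeta> + \<eta>))) \<partial>lborel) = (\<integral>\<^sup>+ \<zeta>. ennreal (norm (a \<zeta>)) \<partial>lborel)" for \<eta>
    using nn_integral_lborel_affine[of 1 "\<lambda>x. ennreal (norm (a x))" \<eta>] by (simp add: add.commute)
  have "(\<integral>\<^sup>+ p. ennreal (norm (a (fst p + snd p) * cnj (a (snd p)))) \<partial>(lborel \<Otimes>\<^sub>M lborel))
     = (\<integral>\<^sup>+ \<eta>. \<integral>\<^sup>+ \<zeta>. ennreal (norm (a (\<zeta> + \<eta>))) * ennreal (norm (a \<eta>)) \<partial>lborel \<partial>lborel)"
    by (subst lborel_pair.nn_integral_snd[symmetric]) (auto simp: norm_mult ennreal_mult)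
  also have "\<dots> = (\<integral>\<^sup>+ \<zeta>. ennreal (norm (a \<zeta>)) \<partial>lborel) * (\<integral>\<^sup>+ \<eta>. ennreal (norm (a \<eta>)) \<partial>lborel)"
    by (simp add: nn_integral_multc nn_integral_cmult shift)
  also have "\<dots> < \<infinity>" using a by (auto simp: integrable_iff_bounded ennreal_mult_less_top)
  finally show "(\<integral>\<^sup>+ p. ennreal (norm (a (fst p + snd p) * cnj (a (snd p)))) \<partial>(lborel \<Otimes>\<^sub>M lborel)) < \<infinity>" .
qed (use a in measurable)

lemma density_symbol_kernel_integrable:
  fixes a :: "'a::euclidean_space \<Rightarrow> complex"
  assumes a: "integrable lborel a"
  shows "integrable (lborel \<Otimes>\<^sub>M lborel) (\<lambda>p. cis (- t * ((norm (fst p))\<^sup>2 + 2 * (fst p \<bullet> snd p))) * (a (fst p + snd p) * cnj (a (snd p))))"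
proof -
  have [measurable]: "a \<in> borel_measurable borel" using a by auto
  show ?thesis
    by (rule Bochner_Integration.integrable_bound[OF integrable_shifted_tensor[OF a]]) (auto simp: norm_mult)
qed

lemma density_symbol_integrable:
  fixes a :: "'a::euclidean_space \<Rightarrow> complex"
  assumes a: "integrable lborel a"
  shows "integrable lborel (density_symbol t a)"
  unfolding density_symbol_def
  using lborel_pair.integrable_fst'[OF density_symbol_kernel_integrable[OF a, of t]] by simp

text \<open>The squared modulus is a double integral over two frequencies; shifting the first by the
  second makes their difference \<zeta> the variable dual to \<open>x\<close>, and Fubini moves it
  outside.\<close>

lemma density_symbol_eq:
  fixes a :: "'a::euclidean_space \<Rightarrow> complex"
  assumes a: "integrable lborel a"
  shows "of_real ((norm (LINT \<xi>|lborel. cis (x \<bullet> \<xi> - t * (norm \<xi>)\<^sup>2) * a \<xi>))\<^sup>2) = (LINT \<zeta>|lborel. cis (x \<bullet> \<zeta>) * density_symbol t a \<zeta>)"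
proof -
  have [measurable]: "a \<in> borel_measurable borel" using a by auto
  let ?e = "\<lambda>\<xi>. cis (x \<bullet> \<xi> - t * (norm \<xi>)\<^sup>2)"
  let ?A = "LINT \<xi>|lborel. ?e \<xi> * a \<xi>"
  let ?k = "\<lambda>p. cis (- t * ((norm (fst p))\<^sup>2 + 2 * (fst p \<bullet> snd p))) * (a (fst p + snd p) * cnj (a (snd p)))"
  have ik: "integrable (lborel \<Otimes>\<^sub>M lborel) (\<lambda>p. cis (x \<bullet> fst p) * ?k p)"
    by (rule Bochner_Integration.integrable_bound[OF density_symbol_kernel_integrable[OF a, of t]]) (auto simp: norm_mult)
  have "of_real ((norm ?A)\<^sup>2) = ?A * cnj ?A" by (rule complex_norm_square)
  also have "cnj ?A = (LINT \<eta>|lborel. cnj (?e \<eta> * a \<eta>))"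
    by (rule Bochner_Integration.integral_cnj[symmetric])
  also have "?A * \<dots> = (LINT \<eta>|lborel. ?A * cnj (?e \<eta> * a \<eta>))"
    by (rule integral_mult_right_zero[symmetric])
  also have "\<dots> = (LINT \<eta>|lborel. LINT \<zeta>|lborel. cis (x \<bullet> \<zeta>) * ?k (\<zeta>, \<eta>))"
  proof (intro Bochner_Integration.integral_cong refl)
    fix \<eta> :: 'a
    have "?A = (LINT \<zeta>|lborel. ?e (\<zeta> + \<eta>) * a (\<zeta> + \<eta>))"
      using integral_lborel_affine[of 1 "\<lambda>\<xi>. ?e \<xi> * a \<xi>" \<eta>] by (simp add: add.commute)
    then have "?A * cnj (?e \<eta> * a \<eta>) = (LINT \<zeta>|lborel. ?e (\<zeta> + \<eta>) * a (\<zeta> + \<eta>) * cnj (?e \<eta> * a \<eta>))"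
      by (simp only: integral_mult_left_zero)
    also have "\<dots> = (LINT \<zeta>|lborel. cis (x \<bullet> \<zeta>) * ?k (\<zeta>, \<eta>))"
    proof (intro Bochner_Integration.integral_cong refl)
      fix \<zeta> :: 'a
      have n: "(norm (\<zeta> + \<eta>))\<^sup>2 = (norm \<zeta>)\<^sup>2 + 2 * (\<zeta> \<bullet> \<eta>) + (norm \<eta>)\<^sup>2"
        by (simp add: power2_norm_eq_inner inner_add_left inner_add_right inner_commute)
      have "?e (\<zeta> + \<eta>) * cnj (?e \<eta>) = cis (x \<bullet> \<zeta>) * cis (- t * ((norm \<zeta>)\<^sup>2 + 2 * (\<zeta> \<bullet> \<eta>)))"
        unfolding cis_cnj cis_mult n by (rule arg_cong[where f = cis]) (simp add: inner_add_right algebra_simps)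
      moreover have "?e (\<zeta> + \<eta>) * a (\<zeta> + \<eta>) * cnj (?e \<eta> * a \<eta>) = (?e (\<zeta> + \<eta>) * cnj (?e \<eta>)) * (a (\<zeta> + \<eta>) * cnj (a \<eta>))"
        by (simp only: complex_cnj_mult mult_ac)
      ultimately show "?e (\<zeta> + \<eta>) * a (\<zeta> + \<eta>) * cnj (?e \<eta> * a \<eta>) = cis (x \<bullet> \<zeta>) * ?k (\<zeta>, \<eta>)"
        by (simp only: fst_conv snd_conv mult.assoc)
    qed
    finally show "?A * cnj (?e \<eta> * a \<eta>) = (LINT \<zeta>|lborel. cis (x \<bullet> \<zeta>) * ?k (\<zeta>, \<eta>))" .
  qed
  also have "\<dots> = (LINT \<zeta>|lborel. LINT \<eta>|lborel. cis (x \<bullet> \<zeta>) * ?k (\<zeta>, \<eta>))"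
    using lborel_pair.Fubini_integral[of "\<lambda>\<zeta> \<eta>. cis (x \<bullet> \<zeta>) * ?k (\<zeta>, \<eta>)"] ik by (simp add: case_prod_beta')
  also have "\<dots> = (LINT \<zeta>|lborel. cis (x \<bullet> \<zeta>) * density_symbol t a \<zeta>)"
    unfolding density_symbol_def by (simp only: integral_mult_right_zero fst_conv snd_conv)
  finally show ?thesis .
qed

text \<open>The part of the phase independent of \<eta> drops out of the modulus, and what remains
  is a one-dimensional phase. The general Plancherel inequality applies with the two singular powers
  as weight \<open>w\<close>, and the slab estimate with a Gaussian for \<Phi> supplies a
  \<open>B\<close> independent of width and centre.\<close>

lemma density_time_estimate:
  fixes s :: real
  assumes s: "2 * s < real DIM('a) - 1" "real DIM('a) - 1 < 4 * s"
  obtains C where "C > 0" "\<And>(\<zeta>::'a::euclidean_space) k \<kappa>. \<zeta> \<noteq> 0 \<Longrightarrow> integrable lborel k \<Longrightarrow> \<kappa> \<in> borel_measurable borel \<Longrightarrow>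
      (\<And>\<eta>. 0 \<le> \<kappa> \<eta>) \<Longrightarrow> (\<And>\<eta>. norm (k \<eta>) \<le> norm (\<zeta> + \<eta>) powr (- s) * norm \<eta> powr (- s) * \<kappa> \<eta>) \<Longrightarrow>
      (\<integral>\<^sup>+ t. ennreal ((norm (LINT \<eta>|lborel. cis (- t * ((norm \<zeta>)\<^sup>2 + 2 * (\<zeta> \<bullet> \<eta>))) * k \<eta>))\<^sup>2) \<partial>lborel)
      \<le> ennreal (C * norm \<zeta> powr (real DIM('a) - 2 - 4 * s)) * (\<integral>\<^sup>+ \<eta>. ennreal ((\<kappa> \<eta>)\<^sup>2) \<partial>lborel)"
proof -
  obtain C where C: "C > 0" and slab: "\<And>(\<zeta>::'a) \<Phi>. \<zeta> \<noteq> 0 \<Longrightarrow> \<Phi> \<in> borel_measurable borel \<Longrightarrow>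
    (\<integral>\<^sup>+ \<eta>. ennreal ((norm (\<zeta> + \<eta>) powr (- s) * norm \<eta> powr (- s))\<^sup>2) * \<Phi> (2 * (\<zeta> \<bullet> \<eta>)) \<partial>lborel)
      \<le> ennreal (C * norm \<zeta> powr (real DIM('a) - 2 - 4 * s)) * (\<integral>\<^sup>+ y. \<Phi> y \<partial>lborel)"
    using slab_weight_estimate[OF s] by blast
  show thesis
  proof
    show "2 * pi * C > 0" using C by simp
    fix \<zeta> :: 'a and k :: "'a \<Rightarrow> complex" and \<kappa> :: "'a \<Rightarrow> real"
    assume \<zeta>: "\<zeta> \<noteq> 0" and k: "integrable lborel k" and [measurable]: "\<kappa> \<in> borel_measurable borel"
      and \<kappa>: "\<And>\<eta>. 0 \<le> \<kappa> \<eta>" and le: "\<And>\<eta>. norm (k \<eta>) \<le> norm (\<zeta> + \<eta>) powr (- s) * norm \<eta> powr (- s) * \<kappa> \<eta>"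
    let ?B = "ennreal (C * norm \<zeta> powr (real DIM('a) - 2 - 4 * s))"
    have "(\<integral>\<^sup>+ t. ennreal ((norm (LINT \<eta>|lborel. cis (t \<bullet> (- (2 * (\<zeta> \<bullet> \<eta>)))) * k \<eta>))\<^sup>2) \<partial>lborel)
      \<le> ennreal ((2 * pi) ^ DIM(real)) * ?B * (\<integral>\<^sup>+ \<eta>. ennreal ((\<kappa> \<eta>)\<^sup>2) \<partial>lborel)"
    proof (rule nn_integral_norm_fourier_le[OF lborel.sigma_finite_measure_axioms _ _ _ k _ \<kappa> le])
      fix a y :: real assume a: "a > 0"
      have "(\<integral>\<^sup>+ \<eta>. ennreal ((norm (\<zeta> + \<eta>) powr (- s) * norm \<eta> powr (- s))\<^sup>2) * ennreal (gauss a (- (2 * (\<zeta> \<bullet> \<eta>)) - y)) \<partial>lborel)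
        \<le> ?B * (\<integral>\<^sup>+ z. ennreal (gauss a (- z - y)) \<partial>lborel)"
        using slab[OF \<zeta>, of "\<lambda>z. ennreal (gauss a (- z - y))"] by simp
      also have "(\<integral>\<^sup>+ z. ennreal (gauss a (- z - y)) \<partial>lborel) = 1"
      proof -
        have "gauss a (- z - y) = gauss a (z - (- y))" for z
          using gauss_even[of a "- z - y"] by (simp add: add.commute)
        then show ?thesis using nn_integral_gauss_diff[OF a, of "- y"] by (simp only:)
      qed
      finally show "(\<integral>\<^sup>+ \<eta>. ennreal ((norm (\<zeta> + \<eta>) powr (- s) * norm \<eta> powr (- s))\<^sup>2) * ennreal (gauss a (- (2 * (\<zeta> \<bullet> \<eta>)) - y)) \<partial>lborel) \<le> ?B"
        by simp
    qed auto
    moreover have "norm (LINT \<eta>|lborel. cis (- t * ((norm \<zeta>)\<^sup>2 + 2 * (\<zeta> \<bullet> \<eta>))) * k \<eta>)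
        = norm (LINT \<eta>|lborel. cis (t \<bullet> (- (2 * (\<zeta> \<bullet> \<eta>)))) * k \<eta>)" for t
    proof -
      have "cis (- t * ((norm \<zeta>)\<^sup>2 + 2 * (\<zeta> \<bullet> \<eta>))) * k \<eta> = cis (- t * (norm \<zeta>)\<^sup>2) * (cis (t \<bullet> (- (2 * (\<zeta> \<bullet> \<eta>)))) * k \<eta>)" for \<eta>
      proof -
        have "cis (- t * ((norm \<zeta>)\<^sup>2 + 2 * (\<zeta> \<bullet> \<eta>))) = cis (- t * (norm \<zeta>)\<^sup>2) * cis (t \<bullet> (- (2 * (\<zeta> \<bullet> \<eta>))))"
          unfolding cis_mult by (rule arg_cong[where f = cis]) (simp add: distrib_left)
        then show ?thesis by (simp only: mult.assoc)
      qed
      then have "(LINT \<eta>|lborel. cis (- t * ((norm \<zeta>)\<^sup>2 + 2 * (\<zeta> \<bullet> \<eta>))) * k \<eta>)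
          = cis (- t * (norm \<zeta>)\<^sup>2) * (LINT \<eta>|lborel. cis (t \<bullet> (- (2 * (\<zeta> \<bullet> \<eta>)))) * k \<eta>)"
        by (simp only: integral_mult_right_zero)
      then show ?thesis by (simp only: norm_mult norm_cis mult_1_left)
    qed
    moreover have "ennreal ((2 * pi) ^ DIM(real)) * ?B = ennreal (2 * pi * C * norm \<zeta> powr (real DIM('a) - 2 - 4 * s))"
      using C by (simp add: mult.assoc flip: ennreal_mult)
    ultimately show "(\<integral>\<^sup>+ t. ennreal ((norm (LINT \<eta>|lborel. cis (- t * ((norm \<zeta>)\<^sup>2 + 2 * (\<zeta> \<bullet> \<eta>))) * k \<eta>))\<^sup>2) \<partial>lborel)
      \<le> ennreal (2 * pi * C * norm \<zeta> powr (real DIM('a) - 2 - 4 * s)) * (\<integral>\<^sup>+ \<eta>. ennreal ((\<kappa> \<eta>)\<^sup>2) \<partial>lborel)"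
      by simp
  qed
qed

lemma wave_measurable [measurable (raw)]:
  fixes G :: "'a::euclidean_space \<Rightarrow> complex"
  assumes [measurable]: "G \<in> borel_measurable borel" "f \<in> borel_measurable M" "g \<in> borel_measurable M"
  shows "(\<lambda>z. wave s n G (f z) (g z)) \<in> borel_measurable M"
proof -
  have [measurable]: "evolved_symbol s 0 G \<in> borel_measurable borel" unfolding evolved_symbol_def by measurable
  show ?thesis unfolding wave_eq by measurable
qed

lemma density_symbol_measurable [measurable (raw)]:
  fixes a :: "'a::euclidean_space \<Rightarrow> complex"
  assumes [measurable]: "a \<in> borel_measurable borel" "f \<in> borel_measurable M" "g \<in> borel_measurable M"
  shows "(\<lambda>z. density_symbol (f z) a (g z)) \<in> borel_measurable M"
  unfolding density_symbol_def by measurable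

lemma sobolev_embedding_ennreal:
  fixes \<alpha> p :: real
  assumes \<alpha>: "0 < \<alpha>" "\<alpha> < DIM('a) / 2" and p: "p * (DIM('a) / 2 - \<alpha>) = DIM('a)"
  obtains C where "C > 0" "\<And>R :: 'a::euclidean_space \<Rightarrow> complex. integrable lborel R \<Longrightarrow>
    ennreal_powr (\<integral>\<^sup>+ x. ennreal (norm (LINT \<zeta>|lborel. cis (x \<bullet> \<zeta>) * R \<zeta>) powr p) \<partial>lborel) (2 / p)
      \<le> ennreal C * (\<integral>\<^sup>+ \<zeta>. ennreal (norm \<zeta> powr (2 * \<alpha>) * (norm (R \<zeta>))\<^sup>2) \<partial>lborel)"
proof -
  have "0 < p * (DIM('a) / 2 - \<alpha>)" unfolding p by simp
  then have p0: "p > 0" by (rule zero_less_mult_pos2) (use \<alpha>(2) in simp)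
  obtain C where C: "C > 0" and sob: "\<And>(R :: 'a \<Rightarrow> complex) N. integrable lborel R \<Longrightarrow> N > 0 \<Longrightarrow>
    (\<integral>\<^sup>+ \<zeta>. ennreal (norm \<zeta> powr (2 * \<alpha>) * (norm (R \<zeta>))\<^sup>2) \<partial>lborel) \<le> ennreal (N\<^sup>2) \<Longrightarrow>
    (\<integral>\<^sup>+ x. ennreal (norm (LINT \<zeta>|lborel. cis (x \<bullet> \<zeta>) * R \<zeta>) powr p) \<partial>lborel) \<le> ennreal (C * N powr p)"
    using sobolev_embedding[OF \<alpha> p] by blast
  show thesis
  proof
    show C': "C powr (2 / p) > 0" using C by simp
    fix R :: "'a \<Rightarrow> complex" assume R: "integrable lborel R"
    let ?A = "\<integral>\<^sup>+ x. ennreal (norm (LINT \<zeta>|lborel. cis (x \<bullet> \<zeta>) * R \<zeta>) powr p) \<partial>lborel"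
    let ?I = "\<integral>\<^sup>+ \<zeta>. ennreal (norm \<zeta> powr (2 * \<alpha>) * (norm (R \<zeta>))\<^sup>2) \<partial>lborel"
    show "ennreal_powr ?A (2 / p) \<le> ennreal (C powr (2 / p)) * ?I"
    proof (cases ?I)
      case (real i)
      show ?thesis
      proof (rule ennreal_le_epsilon)
        fix e :: real assume e: "0 < e"
        \<comment> \<open>The embedding asks for a strictly positive bound on the Sobolev norm;
          enlarging its square by this amount covers the value 0 and costs exactly \<open>e\<close>
          in the conclusion.\<close>
        define N where "N = sqrt (i + e / C powr (2 / p))"
        have pos: "0 < i + e / C powr (2 / p)" using real(1) e C' by (simp add: add_nonneg_pos)
        then have N: "N > 0" "N\<^sup>2 = i + e / C powr (2 / p)" by (auto simp: N_def)
        have "?I \<le> ennreal (N\<^sup>2)" unfolding real(2) N(2) using e C' by (intro ennreal_leI) simp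
        from sob[OF R N(1) this] have "ennreal_powr ?A (2 / p) \<le> ennreal_powr (ennreal (C * N powr p)) (2 / p)"
          using p0 by (intro ennreal_powr_mono) auto
        also have "\<dots> = ennreal (C powr (2 / p) * N\<^sup>2)"
        proof -
          have "(C * N powr p) powr (2 / p) = C powr (2 / p) * N\<^sup>2"
            using C N(1) p0 by (simp add: powr_mult powr_powr)
          then show ?thesis using C by simp
        qed
        also have "C powr (2 / p) * N\<^sup>2 = C powr (2 / p) * i + e"
          unfolding N(2) using C' by (simp add: distrib_left)
        also have "ennreal (C powr (2 / p) * i + e) = ennreal (C powr (2 / p)) * ?I + ennreal e"
          using real e by (simp add: ennreal_mult)
        finally show "ennreal_powr ?A (2 / p) \<le> ennreal (C powr (2 / p)) * ?I + ennreal e" .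
      qed
    next
      case top
      then show ?thesis using C' by (simp add: ennreal_mult_top)
    qed
  qed
qed

text \<open>The Sobolev embedding acts at fixed \<open>t\<close>, the time estimate at fixed
  \<zeta>, and Tonelli in \<open>t\<close> and \<zeta> joins them. Nonnegative \<open>lam\<close>
  makes the density its own modulus, and the constant is independent of \<open>n\<close> because the
  cut-off only shrinks the kernel.\<close>

lemma strichartz_truncated:
  fixes s p :: real
  assumes s: "2 * s < real DIM('a) - 1" "real DIM('a) - 1 < 4 * s" and p: "p * (real DIM('a) - 1 - 2 * s) = real DIM('a)"
  obtains C where "C > 0" "\<And>(J :: 'i set) (G :: 'i \<Rightarrow> 'a::euclidean_space \<Rightarrow> complex) lam n. finite J \<Longrightarrow>
    (\<And>j. j \<in> J \<Longrightarrow> L2_fun (G j)) \<Longrightarrow>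
    (\<And>j k. j \<in> J \<Longrightarrow> k \<in> J \<Longrightarrow> (LINT x|lborel. G j x * cnj (G k x)) = (if j = k then 1 else 0)) \<Longrightarrow>
    (\<And>j. lam j \<ge> 0) \<Longrightarrow>
    (\<integral>\<^sup>+ t. ennreal_powr (\<integral>\<^sup>+ x. ennreal_powr (ennreal (\<Sum>j\<in>J. lam j * (norm (wave s n (G j) t x))\<^sup>2)) p \<partial>lborel) (2 / p) \<partial>lborel)
      \<le> ennreal (C * (\<Sum>j\<in>J. (lam j)\<^sup>2))"
proof -
  \<comment> \<open>Equal to \<open>d / 2 - d / p\<close>, since
    \<open>d - 1 - 2 * s = d / p\<close>; its double is the negative of the exponent
    \<open>d - 2 - 4 * s\<close> in the time estimate.\<close>
  define \<alpha> where "\<alpha> = 2 * s + 1 - real DIM('a) / 2"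
  have \<alpha>: "0 < \<alpha>" "\<alpha> < DIM('a) / 2" "p * (DIM('a) / 2 - \<alpha>) = DIM('a)"
    using s p by (auto simp: \<alpha>_def field_simps)
  have s0: "0 \<le> s" "2 * s < DIM('a)" using s DIM_positive[where 'a='a] by linarith+
  obtain C1 where C1: "C1 > 0" and sob: "\<And>R :: 'a \<Rightarrow> complex. integrable lborel R \<Longrightarrow>
    ennreal_powr (\<integral>\<^sup>+ x. ennreal (norm (LINT \<zeta>|lborel. cis (x \<bullet> \<zeta>) * R \<zeta>) powr p) \<partial>lborel) (2 / p)
      \<le> ennreal C1 * (\<integral>\<^sup>+ \<zeta>. ennreal (norm \<zeta> powr (2 * \<alpha>) * (norm (R \<zeta>))\<^sup>2) \<partial>lborel)"
    using sobolev_embedding_ennreal[OF \<alpha>] by blast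
  obtain C2 where C2: "C2 > 0" and time: "\<And>(\<zeta>::'a) k \<kappa>. \<zeta> \<noteq> 0 \<Longrightarrow> integrable lborel k \<Longrightarrow> \<kappa> \<in> borel_measurable borel \<Longrightarrow>
      (\<And>\<eta>. 0 \<le> \<kappa> \<eta>) \<Longrightarrow> (\<And>\<eta>. norm (k \<eta>) \<le> norm (\<zeta> + \<eta>) powr (- s) * norm \<eta> powr (- s) * \<kappa> \<eta>) \<Longrightarrow>
      (\<integral>\<^sup>+ t. ennreal ((norm (LINT \<eta>|lborel. cis (- t * ((norm \<zeta>)\<^sup>2 + 2 * (\<zeta> \<bullet> \<eta>))) * k \<eta>))\<^sup>2) \<partial>lborel)
      \<le> ennreal (C2 * norm \<zeta> powr (real DIM('a) - 2 - 4 * s)) * (\<integral>\<^sup>+ \<eta>. ennreal ((\<kappa> \<eta>)\<^sup>2) \<partial>lborel)"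
    using density_time_estimate[OF s] by blast
  let ?c = "fourier_const TYPE('a)"
  have c: "?c > 0" by simp
  show thesis
  proof
    show "C1 * (?c ^ 4 * C2) > 0" using C1 C2 c by (intro mult_pos_pos zero_less_power)
    fix J :: "'i set" and G :: "'i \<Rightarrow> 'a \<Rightarrow> complex" and lam :: "'i \<Rightarrow> real" and n :: nat
    assume J: "finite J" and G: "\<And>j. j \<in> J \<Longrightarrow> L2_fun (G j)"
      and orth: "\<And>j k. j \<in> J \<Longrightarrow> k \<in> J \<Longrightarrow> (LINT x|lborel. G j x * cnj (G k x)) = (if j = k then 1 else 0)"
      and lam: "\<And>j. lam j \<ge> 0"
    have Gm [measurable]: "G j \<in> borel_measurable borel" if "j \<in> J" for j using G[OF that] by (rule L2_fun_measurable)
    define a where "a j = truncate_fun n (evolved_symbol s 0 (G j))" for j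
    have ia: "integrable lborel (a j)" if "j \<in> J" for j
      unfolding a_def by (rule truncated_symbol_integrable[OF G[OF that] s0])
    have am [measurable]: "a j \<in> borel_measurable borel" if "j \<in> J" for j using ia[OF that] by auto
    \<comment> \<open>The spatial transform of the density, up to normalization; each of the two
      wave factors contributes one constant \<open>?c\<close>.\<close>
    define R where "R t \<zeta> = of_real (?c\<^sup>2) * (\<Sum>j\<in>J. of_real (lam j) * density_symbol t (a j) \<zeta>)" for t \<zeta>
    have [measurable]: "(\<lambda>q. R (fst q) (snd q)) \<in> borel_measurable (borel \<Otimes>\<^sub>M borel)" unfolding R_def by measurable
    have [measurable]: "(\<lambda>q. R (snd q) (fst q)) \<in> borel_measurable (borel \<Otimes>\<^sub>M borel)" unfolding R_def by measurable
    have [measurable]: "(\<lambda>t. R t x) \<in> borel_measurable borel" for x unfolding R_def by measurable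
    have iR: "integrable lborel (R t)" for t
      unfolding R_def by (intro integrable_mult_right Bochner_Integration.integrable_sum density_symbol_integrable ia)
    define \<rho> where "\<rho> t x = (\<Sum>j\<in>J. lam j * (norm (wave s n (G j) t x))\<^sup>2)" for t x
    have \<rho>0: "\<rho> t x \<ge> 0" for t x unfolding \<rho>_def by (intro sum_nonneg mult_nonneg_nonneg lam) simp
    have \<rho>_eq: "of_real (\<rho> t x) = (LINT \<zeta>|lborel. cis (x \<bullet> \<zeta>) * R t \<zeta>)" for t x
    proof -
      have w: "of_real ((norm (wave s n (G j) t x))\<^sup>2) = of_real (?c\<^sup>2) * (LINT \<zeta>|lborel. cis (x \<bullet> \<zeta>) * density_symbol t (a j) \<zeta>)" if "j \<in> J" for j
        unfolding wave_eq a_def[symmetric] norm_mult power_mult_distrib of_real_mult density_symbol_eq[OF ia[OF that]]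
        by simp
      have "of_real (\<rho> t x) = (\<Sum>j\<in>J. of_real (lam j) * of_real ((norm (wave s n (G j) t x))\<^sup>2))"
        unfolding \<rho>_def by (simp only: of_real_sum of_real_mult)
      also have "\<dots> = (\<Sum>j\<in>J. LINT \<zeta>|lborel. (of_real (lam j) * of_real (?c\<^sup>2)) * (cis (x \<bullet> \<zeta>) * density_symbol t (a j) \<zeta>))"
        by (intro sum.cong refl) (simp only: w integral_mult_right_zero mult.assoc)
      also have "\<dots> = (LINT \<zeta>|lborel. (\<Sum>j\<in>J. (of_real (lam j) * of_real (?c\<^sup>2)) * (cis (x \<bullet> \<zeta>) * density_symbol t (a j) \<zeta>)))"
        by (intro Bochner_Integration.integral_sum[symmetric] integrable_mult_right integrable_cis_mult density_symbol_integrable ia) measurable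
      also have "\<dots> = (LINT \<zeta>|lborel. cis (x \<bullet> \<zeta>) * R t \<zeta>)"
        unfolding R_def sum_distrib_left by (simp only: mult_ac)
      finally show ?thesis .
    qed
    let ?I = "\<lambda>t. \<integral>\<^sup>+ \<zeta>. ennreal (norm \<zeta> powr (2 * \<alpha>) * (norm (R t \<zeta>))\<^sup>2) \<partial>lborel"
    have step: "ennreal_powr (\<integral>\<^sup>+ x. ennreal_powr (ennreal (\<rho> t x)) p \<partial>lborel) (2 / p) \<le> ennreal C1 * ?I t" for t
    proof -
      have "norm (LINT \<zeta>|lborel. cis (x \<bullet> \<zeta>) * R t \<zeta>) = \<rho> t x" for x
        unfolding \<rho>_eq[symmetric] norm_of_real using \<rho>0 by simp
      then show ?thesis using sob[OF iR[of t]] \<rho>0 by simp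
    qed
    define \<gamma> where "\<gamma> \<xi> \<eta> = (\<Sum>j\<in>J. of_real (lam j) * (G j \<xi> * cnj (G j \<eta>)))" for \<xi> \<eta>
    have \<gamma>m [measurable]: "(\<lambda>q. \<gamma> (f q) (g q)) \<in> borel_measurable M"
      if [measurable]: "f \<in> borel_measurable M" "g \<in> borel_measurable M" for f g and M :: "'q measure"
      unfolding \<gamma>_def by measurable
    have \<gamma>m' [measurable]: "(\<lambda>q. \<gamma> (fst q + snd q) (snd q)) \<in> borel_measurable (borel \<Otimes>\<^sub>M borel)"
      unfolding \<gamma>_def by measurable
    \<comment> \<open>Integrability of the kernel in \<eta> holds for almost every \<zeta> only, and
      is needed to interchange the finite sum with the Bochner integral.\<close>
    have AE_int: "AE \<zeta> in lborel. \<forall>j\<in>J. integrable lborel (\<lambda>\<eta>. a j (\<zeta> + \<eta>) * cnj (a j \<eta>))"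
    proof (rule AE_finite_allI[OF J])
      fix j assume "j \<in> J"
      from lborel_pair.AE_integrable_fst'[OF integrable_shifted_tensor[OF ia[OF this]]]
      show "AE \<zeta> in lborel. integrable lborel (\<lambda>\<eta>. a j (\<zeta> + \<eta>) * cnj (a j \<eta>))" by simp
    qed
    have R_time: "AE \<zeta> in lborel. ennreal (norm \<zeta> powr (2 * \<alpha>)) * (\<integral>\<^sup>+ t. ennreal ((norm (R t \<zeta>))\<^sup>2) \<partial>lborel)
        \<le> ennreal (?c ^ 4 * C2) * (\<integral>\<^sup>+ \<eta>. ennreal ((norm (\<gamma> (\<zeta> + \<eta>) \<eta>))\<^sup>2) \<partial>lborel)"
      using AE_int AE_lborel_singleton[of "0::'a"]
    proof eventually_elim
      case (elim \<zeta>)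
      let ?k = "\<lambda>\<eta>. \<Sum>j\<in>J. of_real (lam j) * (a j (\<zeta> + \<eta>) * cnj (a j \<eta>))"
      let ?e = "\<lambda>t \<eta>. cis (- t * ((norm \<zeta>)\<^sup>2 + 2 * (\<zeta> \<bullet> \<eta>)))"
      have ik: "integrable lborel ?k" using elim(1) by (intro Bochner_Integration.integrable_sum integrable_mult_right) auto
      have [measurable]: "(\<lambda>\<eta>. norm (\<gamma> (\<zeta> + \<eta>) \<eta>)) \<in> borel_measurable borel"
        unfolding \<gamma>_def by measurable
      \<comment> \<open>The kernel without cut-off serves as \<kappa>, so that its norm is exactly
        the Hilbert--Schmidt norm.\<close>
      have k_le: "norm (?k \<eta>) \<le> norm (\<zeta> + \<eta>) powr (- s) * norm \<eta> powr (- s) * norm (\<gamma> (\<zeta> + \<eta>) \<eta>)" for \<eta>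
      proof (cases "norm (\<zeta> + \<eta>) \<le> real n \<and> norm \<eta> \<le> real n")
        case True
        then have "a j (\<zeta> + \<eta>) * cnj (a j \<eta>) = of_real (norm (\<zeta> + \<eta>) powr (- s) * norm \<eta> powr (- s)) * (G j (\<zeta> + \<eta>) * cnj (G j \<eta>))" for j
          by (simp add: a_def truncate_fun_def evolved_symbol_def)
        then have "?k \<eta> = of_real (norm (\<zeta> + \<eta>) powr (- s) * norm \<eta> powr (- s)) * \<gamma> (\<zeta> + \<eta>) \<eta>"
          unfolding \<gamma>_def sum_distrib_left by (simp only: mult_ac)
        then have "norm (?k \<eta>) = norm (\<zeta> + \<eta>) powr (- s) * norm \<eta> powr (- s) * norm (\<gamma> (\<zeta> + \<eta>) \<eta>)"
          by (simp only: norm_mult norm_of_real) simp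
        then show ?thesis by simp
      next
        case False
        then have "a j (\<zeta> + \<eta>) * cnj (a j \<eta>) = 0" for j
          by (auto simp: a_def truncate_fun_def)
        then have "?k \<eta> = 0" by (simp only: mult_zero_right sum.neutral_const)
        then show ?thesis by simp
      qed
      have R_eq: "R t \<zeta> = of_real (?c\<^sup>2) * (LINT \<eta>|lborel. ?e t \<eta> * ?k \<eta>)" for t
      proof -
        have "(LINT \<eta>|lborel. ?e t \<eta> * ?k \<eta>) = (LINT \<eta>|lborel. (\<Sum>j\<in>J. of_real (lam j) * (?e t \<eta> * (a j (\<zeta> + \<eta>) * cnj (a j \<eta>)))))"
          by (simp only: sum_distrib_left mult.left_commute)
        also have "\<dots> = (\<Sum>j\<in>J. LINT \<eta>|lborel. of_real (lam j) * (?e t \<eta> * (a j (\<zeta> + \<eta>) * cnj (a j \<eta>))))"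
          using elim(1) by (intro Bochner_Integration.integral_sum integrable_mult_right integrable_cis_mult) auto
        also have "\<dots> = (\<Sum>j\<in>J. of_real (lam j) * density_symbol t (a j) \<zeta>)"
          unfolding density_symbol_def by (simp only: integral_mult_right_zero)
        finally show ?thesis unfolding R_def by simp
      qed
      have "(\<integral>\<^sup>+ t. ennreal ((norm (R t \<zeta>))\<^sup>2) \<partial>lborel) = (\<integral>\<^sup>+ t. ennreal (?c ^ 4) * ennreal ((norm (LINT \<eta>|lborel. ?e t \<eta> * ?k \<eta>))\<^sup>2) \<partial>lborel)"
      proof (rule nn_integral_cong)
        fix t
        have "(norm (R t \<zeta>))\<^sup>2 = ?c ^ 4 * (norm (LINT \<eta>|lborel. ?e t \<eta> * ?k \<eta>))\<^sup>2"
          unfolding R_eq norm_mult power_mult_distrib norm_of_real by simp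
        then show "ennreal ((norm (R t \<zeta>))\<^sup>2) = ennreal (?c ^ 4) * ennreal ((norm (LINT \<eta>|lborel. ?e t \<eta> * ?k \<eta>))\<^sup>2)"
          by (simp only: ennreal_mult zero_le_power2 zero_le_power less_imp_le[OF c])
      qed
      also have "\<dots> = ennreal (?c ^ 4) * (\<integral>\<^sup>+ t. ennreal ((norm (LINT \<eta>|lborel. ?e t \<eta> * ?k \<eta>))\<^sup>2) \<partial>lborel)"
        by (rule nn_integral_cmult) measurable
      also have "\<dots> \<le> ennreal (?c ^ 4) * (ennreal (C2 * norm \<zeta> powr (real DIM('a) - 2 - 4 * s)) * (\<integral>\<^sup>+ \<eta>. ennreal ((norm (\<gamma> (\<zeta> + \<eta>) \<eta>))\<^sup>2) \<partial>lborel))"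
        using elim(2) by (intro mult_left_mono time ik k_le) auto
      finally have "ennreal (norm \<zeta> powr (2 * \<alpha>)) * (\<integral>\<^sup>+ t. ennreal ((norm (R t \<zeta>))\<^sup>2) \<partial>lborel)
        \<le> ennreal (norm \<zeta> powr (2 * \<alpha>)) * (ennreal (?c ^ 4) * (ennreal (C2 * norm \<zeta> powr (real DIM('a) - 2 - 4 * s)) * (\<integral>\<^sup>+ \<eta>. ennreal ((norm (\<gamma> (\<zeta> + \<eta>) \<eta>))\<^sup>2) \<partial>lborel)))"
        by (rule mult_left_mono) simp
      also have "\<dots> = ennreal (?c ^ 4 * C2) * (\<integral>\<^sup>+ \<eta>. ennreal ((norm (\<gamma> (\<zeta> + \<eta>) \<eta>))\<^sup>2) \<partial>lborel)"
      proof -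
        have eq: "norm \<zeta> powr (2 * \<alpha>) * norm \<zeta> powr (real DIM('a) - 2 - 4 * s) = 1"
          using elim(2) by (simp add: \<alpha>_def flip: powr_add)
        have "norm \<zeta> powr (2 * \<alpha>) * (?c ^ 4 * (C2 * norm \<zeta> powr (real DIM('a) - 2 - 4 * s))) = ?c ^ 4 * C2"
        proof -
          have "norm \<zeta> powr (2 * \<alpha>) * (?c ^ 4 * (C2 * norm \<zeta> powr (real DIM('a) - 2 - 4 * s)))
            = ?c ^ 4 * C2 * (norm \<zeta> powr (2 * \<alpha>) * norm \<zeta> powr (real DIM('a) - 2 - 4 * s))"
            by (simp only: mult_ac)
          then show ?thesis unfolding eq by (simp only: mult_1_right)
        qed
        moreover have "ennreal (norm \<zeta> powr (2 * \<alpha>)) * (ennreal (?c ^ 4) * ennreal (C2 * norm \<zeta> powr (real DIM('a) - 2 - 4 * s)))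
            = ennreal (norm \<zeta> powr (2 * \<alpha>) * (?c ^ 4 * (C2 * norm \<zeta> powr (real DIM('a) - 2 - 4 * s))))"
        proof -
          have "ennreal x * (ennreal y * ennreal z) = ennreal (x * (y * z))" if "0 \<le> x" "0 \<le> y" "0 \<le> z" for x y z :: real
            using that by (simp add: ennreal_mult)
          then show ?thesis using C2 c by simp
        qed
        ultimately show ?thesis by (simp only: mult.assoc[symmetric])
      qed
      finally show ?case .
    qed
    have "(\<integral>\<^sup>+ t. ennreal_powr (\<integral>\<^sup>+ x. ennreal_powr (ennreal (\<rho> t x)) p \<partial>lborel) (2 / p) \<partial>lborel) \<le> (\<integral>\<^sup>+ t. ennreal C1 * ?I t \<partial>lborel)"
      by (intro nn_integral_mono step)
    also have "\<dots> = ennreal C1 * (\<integral>\<^sup>+ t. ?I t \<partial>lborel)"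
      by (rule nn_integral_cmult) measurable
    also have "(\<integral>\<^sup>+ t. ?I t \<partial>lborel) = (\<integral>\<^sup>+ \<zeta>. \<integral>\<^sup>+ t. ennreal (norm \<zeta> powr (2 * \<alpha>) * (norm (R t \<zeta>))\<^sup>2) \<partial>lborel \<partial>lborel)"
      by (rule lborel_pair.Fubini') measurable
    also have "\<dots> = (\<integral>\<^sup>+ \<zeta>. ennreal (norm \<zeta> powr (2 * \<alpha>)) * (\<integral>\<^sup>+ t. ennreal ((norm (R t \<zeta>))\<^sup>2) \<partial>lborel) \<partial>lborel)"
      by (intro nn_integral_cong, subst nn_integral_cmult[symmetric]) (auto simp: ennreal_mult)
    also have "\<dots> \<le> (\<integral>\<^sup>+ \<zeta>. ennreal (?c ^ 4 * C2) * (\<integral>\<^sup>+ \<eta>. ennreal ((norm (\<gamma> (\<zeta> + \<eta>) \<eta>))\<^sup>2) \<partial>lborel) \<partial>lborel)"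
      by (rule nn_integral_mono_AE[OF R_time])
    also have "\<dots> = ennreal (?c ^ 4 * C2) * (\<integral>\<^sup>+ \<zeta>. \<integral>\<^sup>+ \<eta>. ennreal ((norm (\<gamma> (\<zeta> + \<eta>) \<eta>))\<^sup>2) \<partial>lborel \<partial>lborel)"
      by (rule nn_integral_cmult) measurable
    also have "(\<integral>\<^sup>+ \<zeta>. \<integral>\<^sup>+ \<eta>. ennreal ((norm (\<gamma> (\<zeta> + \<eta>) \<eta>))\<^sup>2) \<partial>lborel \<partial>lborel) = (\<integral>\<^sup>+ \<eta>. \<integral>\<^sup>+ \<zeta>. ennreal ((norm (\<gamma> (\<zeta> + \<eta>) \<eta>))\<^sup>2) \<partial>lborel \<partial>lborel)"
      by (rule lborel_pair.Fubini') measurable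
    also have "\<dots> = (\<integral>\<^sup>+ \<eta>. \<integral>\<^sup>+ \<xi>. ennreal ((norm (\<gamma> \<xi> \<eta>))\<^sup>2) \<partial>lborel \<partial>lborel)"
    proof (rule nn_integral_cong)
      fix \<eta> :: 'a
      have "(\<lambda>\<xi>. ennreal ((norm (\<gamma> \<xi> \<eta>))\<^sup>2)) \<in> borel_measurable borel" unfolding \<gamma>_def by measurable
      from nn_integral_lborel_affine[OF _ this, of 1 \<eta>]
      show "(\<integral>\<^sup>+ \<zeta>. ennreal ((norm (\<gamma> (\<zeta> + \<eta>) \<eta>))\<^sup>2) \<partial>lborel) = (\<integral>\<^sup>+ \<xi>. ennreal ((norm (\<gamma> \<xi> \<eta>))\<^sup>2) \<partial>lborel)"
        by (simp add: add.commute)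
    qed
    also have "\<dots> = ennreal (\<Sum>j\<in>J. (lam j)\<^sup>2)"
      unfolding \<gamma>_def by (rule hilbert_schmidt_norm[OF J G orth])
    finally have "(\<integral>\<^sup>+ t. ennreal_powr (\<integral>\<^sup>+ x. ennreal_powr (ennreal (\<rho> t x)) p \<partial>lborel) (2 / p) \<partial>lborel)
        \<le> ennreal C1 * (ennreal (?c ^ 4 * C2) * ennreal (\<Sum>j\<in>J. (lam j)\<^sup>2))" by (simp add: mult_left_mono)
    also have "\<dots> = ennreal (C1 * (?c ^ 4 * C2) * (\<Sum>j\<in>J. (lam j)\<^sup>2))"
      using C1 C2 c by (simp add: mult.assoc sum_nonneg flip: ennreal_mult)
    finally show "(\<integral>\<^sup>+ t. ennreal_powr (\<integral>\<^sup>+ x. ennreal_powr (ennreal (\<Sum>j\<in>J. lam j * (norm (wave s n (G j) t x))\<^sup>2)) p \<partial>lborel) (2 / p) \<partial>lborel)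
      \<le> ennreal (C1 * (?c ^ 4 * C2) * (\<Sum>j\<in>J. (lam j)\<^sup>2))" unfolding \<rho>_def .
  qed
qed

section \<open>Passage to the limit\<close>

text \<open>A single sequence \<open>u\<close>, the sum of the squared differences over the finite
  set \<open>K\<close>, tends to 0 in \<open>L\<^sup>1\<close>; one subsequence therefore works for
  all indices at once.\<close>

lemma L2_AE_subsequence:
  fixes F :: "'i \<Rightarrow> nat \<Rightarrow> 'a::euclidean_space \<Rightarrow> complex"
  assumes K: "finite K" and Fm: "\<And>j n. j \<in> K \<Longrightarrow> F j n \<in> borel_measurable borel"
    and vm: "\<And>j. j \<in> K \<Longrightarrow> v j \<in> borel_measurable borel"
    and lim: "\<And>j. j \<in> K \<Longrightarrow> (\<lambda>n. L2_sq (\<lambda>x. F j n x - v j x)) \<longlonglongrightarrow> 0"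
  obtains r :: "nat \<Rightarrow> nat" where "strict_mono r" "AE x in lborel. \<forall>j\<in>K. (\<lambda>k. F j (r k) x) \<longlonglongrightarrow> v j x"
proof -
  define u where "u n x = (\<Sum>j\<in>K. (norm (F j n x - v j x))\<^sup>2)" for n x
  have um [measurable]: "u n \<in> borel_measurable borel" for n
    unfolding u_def using Fm vm by (intro borel_measurable_sum) measurable
  have u0: "u n x \<ge> 0" for n x unfolding u_def by (intro sum_nonneg) simp
  have iu: "(\<integral>\<^sup>+ x. ennreal (u n x) \<partial>lborel) = (\<Sum>j\<in>K. L2_sq (\<lambda>x. F j n x - v j x))" for n
  proof -
    have "(\<integral>\<^sup>+ x. ennreal (u n x) \<partial>lborel) = (\<integral>\<^sup>+ x. (\<Sum>j\<in>K. ennreal ((norm (F j n x - v j x))\<^sup>2)) \<partial>lborel)"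
      by (simp add: u_def sum_ennreal)
    also have "\<dots> = (\<Sum>j\<in>K. L2_sq (\<lambda>x. F j n x - v j x))"
      by (rule nn_integral_sum) (use Fm vm in measurable)
    finally show ?thesis .
  qed
  have lim_u: "(\<lambda>n. \<integral>\<^sup>+ x. ennreal (u n x) \<partial>lborel) \<longlonglongrightarrow> 0"
    unfolding iu using tendsto_sum[of K "\<lambda>j n. L2_sq (\<lambda>x. F j n x - v j x)" "\<lambda>_. 0" sequentially] lim by simp
  then have "\<forall>\<^sub>F n in sequentially. (\<integral>\<^sup>+ x. ennreal (u n x) \<partial>lborel) < 1"
    by (rule order_tendstoD) simp
  then obtain N where N: "\<And>n. n \<ge> N \<Longrightarrow> (\<integral>\<^sup>+ x. ennreal (u n x) \<partial>lborel) < 1"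
    by (auto simp: eventually_sequentially)
  \<comment> \<open>The shift by \<open>N\<close> discards the initial indices at which
    \<open>u n\<close> may fail to be integrable.\<close>
  have int: "integrable lborel (u (n + N))" for n
    using N[of "n + N"] u0 by (intro integrableI_nonneg) (auto intro: less_trans)
  have "(\<lambda>n. ennreal (LINT x|lborel. norm (u (n + N) x))) \<longlonglongrightarrow> ennreal 0"
  proof -
    have "ennreal (LINT x|lborel. norm (u (n + N) x)) = (\<integral>\<^sup>+ x. ennreal (u (n + N) x) \<partial>lborel)" for n
      using nn_integral_eq_integral[OF int[of n]] u0 by simp
    then show ?thesis using LIMSEQ_ignore_initial_segment[OF lim_u, of N] by simp
  qed
  then have "(\<lambda>n. LINT x|lborel. norm (u (n + N) x)) \<longlonglongrightarrow> 0"
    by (subst (asm) tendsto_ennreal_iff) auto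
  from tendsto_L1_AE_subseq[OF int this] obtain r :: "nat \<Rightarrow> nat"
    where r: "strict_mono r" "AE x in lborel. (\<lambda>k. u (r k + N) x) \<longlonglongrightarrow> 0" by auto
  show thesis
  proof (rule that[of "\<lambda>k. r k + N"])
    show "strict_mono (\<lambda>k. r k + N)" using r(1) by (simp add: strict_mono_def)
    show "AE x in lborel. \<forall>j\<in>K. (\<lambda>k. F j (r k + N) x) \<longlonglongrightarrow> v j x"
      using r(2)
    proof eventually_elim
      case (elim x)
      show ?case
      proof
        fix j assume j: "j \<in> K"
        have "(\<lambda>k. (norm (F j (r k + N) x - v j x))\<^sup>2) \<longlonglongrightarrow> 0"
        proof (rule tendsto_sandwich[OF _ _ tendsto_const elim])
          show "\<forall>\<^sub>F k in sequentially. (norm (F j (r k + N) x - v j x))\<^sup>2 \<le> u (r k + N) x"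
            unfolding u_def using K j by (intro always_eventually allI member_le_sum) auto
        qed simp
        from tendsto_real_sqrt[OF this] have "(\<lambda>k. norm (F j (r k + N) x - v j x)) \<longlonglongrightarrow> 0" by simp
        then show "(\<lambda>k. F j (r k + N) x) \<longlonglongrightarrow> v j x"
          by (simp only: tendsto_norm_zero_iff LIM_zero_iff)
      qed
    qed
  qed
qed

text \<open>The index \<open>n\<close> is both the frequency cut-off and the number of terms. A
  first subsequence collects the indices where the bound holds, a second gives convergence almost
  everywhere, and Fatou concludes.\<close>

lemma nn_integral_density_le_frequently:
  fixes F :: "nat \<Rightarrow> nat \<Rightarrow> 'a::euclidean_space \<Rightarrow> complex" and lam :: "nat \<Rightarrow> real" and p :: real
  assumes lam: "\<And>j. lam j \<ge> 0" and p: "p > 0"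
    and Fm: "\<And>j n. j \<in> J \<Longrightarrow> F j n \<in> borel_measurable borel"
    and vm: "\<And>j. j \<in> J \<Longrightarrow> v j \<in> borel_measurable borel"
    and lim: "\<And>j. j \<in> J \<Longrightarrow> (\<lambda>n. L2_sq (\<lambda>x. F j n x - v j x)) \<longlonglongrightarrow> 0"
    and inf: "infinite {n. (\<integral>\<^sup>+ x. ennreal_powr (ennreal (\<Sum>j\<in>J \<inter> {..<n}. lam j * (norm (F j n x))\<^sup>2)) p \<partial>lborel) \<le> b}"
  shows "(\<integral>\<^sup>+ x. ennreal_powr (ennreal (\<Sum>j\<in>J \<inter> {..<K}. lam j * (norm (v j x))\<^sup>2)) p \<partial>lborel) \<le> b"
proof -
  define \<rho> where "\<rho> n x = (\<Sum>j\<in>J \<inter> {..<n}. lam j * (norm (F j n x))\<^sup>2)" for n x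
  let ?S = "{n. (\<integral>\<^sup>+ x. ennreal_powr (ennreal (\<rho> n x)) p \<partial>lborel) \<le> b}"
  have infS: "infinite ?S" using inf unfolding \<rho>_def .
  define r0 where "r0 = enumerate ?S"
  have r0: "strict_mono r0" unfolding r0_def by (rule strict_mono_enumerate[OF infS])
  have r0S: "(\<integral>\<^sup>+ x. ennreal_powr (ennreal (\<rho> (r0 k) x)) p \<partial>lborel) \<le> b" for k
    using enumerate_in_set[OF infS, of k] unfolding r0_def by simp
  have [measurable]: "F j n \<in> borel_measurable borel" if "j \<in> J \<inter> {..<n}" for j n
    using Fm that by auto
  have [measurable]: "\<rho> n \<in> borel_measurable borel" for n
    unfolding \<rho>_def by measurable
  let ?K = "J \<inter> {..<K}"
  have sub: "(\<lambda>k. L2_sq (\<lambda>x. F j (r0 k) x - v j x)) \<longlonglongrightarrow> 0" if "j \<in> ?K" for j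
    using LIMSEQ_subseq_LIMSEQ[OF lim r0, of j] that by (simp add: o_def)
  obtain r1 :: "nat \<Rightarrow> nat" where r1: "strict_mono r1" and conv: "AE x in lborel. \<forall>j\<in>?K. (\<lambda>k. F j (r0 (r1 k)) x) \<longlonglongrightarrow> v j x"
    by (rule L2_AE_subsequence[of ?K "\<lambda>j k. F j (r0 k)" v]) (use Fm vm sub in auto)
  let ?r = "\<lambda>k. r0 (r1 k)"
  have r_ge: "k \<le> ?r k" for k
    using seq_suble[OF strict_mono_o[OF r0 r1], of k] by simp
  let ?f = "\<lambda>x. \<Sum>j\<in>?K. lam j * (norm (v j x))\<^sup>2"
  have "(\<integral>\<^sup>+ x. ennreal_powr (ennreal (?f x)) p \<partial>lborel) \<le> (\<integral>\<^sup>+ x. liminf (\<lambda>k. ennreal_powr (ennreal (\<rho> (?r k) x)) p) \<partial>lborel)"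
  proof (rule nn_integral_mono_AE)
    show "AE x in lborel. ennreal_powr (ennreal (?f x)) p \<le> liminf (\<lambda>k. ennreal_powr (ennreal (\<rho> (?r k) x)) p)"
      using conv
    proof eventually_elim
      case (elim x)
      let ?g = "\<lambda>k. \<Sum>j\<in>?K. lam j * (norm (F j (?r k) x))\<^sup>2"
      have nn: "?f x \<ge> 0" "?g k \<ge> 0" for k by (auto intro!: sum_nonneg mult_nonneg_nonneg lam)
      have "?g \<longlonglongrightarrow> ?f x"
        using elim by (intro tendsto_sum tendsto_mult tendsto_const tendsto_power tendsto_norm) auto
      then have "(\<lambda>k. ennreal (?g k powr p)) \<longlonglongrightarrow> ennreal (?f x powr p)"
        using p nn by (intro tendsto_ennrealI tendsto_powr') auto
      then have "liminf (\<lambda>k. ennreal (?g k powr p)) = ennreal (?f x powr p)"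
        by (rule lim_imp_Liminf[rotated]) simp
      then have "ennreal_powr (ennreal (?f x)) p = liminf (\<lambda>k. ennreal (?g k powr p))"
        using nn(1) by simp
      also have "\<dots> \<le> liminf (\<lambda>k. ennreal_powr (ennreal (\<rho> (?r k) x)) p)"
      proof (rule Liminf_mono, rule eventually_sequentiallyI[of K])
        fix k assume "K \<le> k"
        \<comment> \<open>For large \<open>k\<close> the fixed range of \<open>K\<close> terms is
          contained in the growing one, and the additional terms are nonnegative.\<close>
        then have "?K \<subseteq> J \<inter> {..<?r k}" using r_ge[of k] by auto
        then have "?g k \<le> \<rho> (?r k) x"
          unfolding \<rho>_def by (intro sum_mono2) (auto intro!: mult_nonneg_nonneg lam)
        then have "ennreal_powr (ennreal (?g k)) p \<le> ennreal_powr (ennreal (\<rho> (?r k) x)) p"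
          using p by (intro ennreal_powr_mono ennreal_leI)
        then show "ennreal (?g k powr p) \<le> ennreal_powr (ennreal (\<rho> (?r k) x)) p"
          using nn(2) by simp
      qed
      finally show ?case .
    qed
  qed
  also have "\<dots> \<le> liminf (\<lambda>k. \<integral>\<^sup>+ x. ennreal_powr (ennreal (\<rho> (?r k) x)) p \<partial>lborel)"
    by (rule nn_integral_liminf) measurable
  also have "\<dots> \<le> b"
    by (intro Liminf_le always_eventually allI r0S) simp_all
  finally show ?thesis .
qed

text \<open>The powers \<open>p\<close> and \<open>1 / p\<close> are mutually inverse monotone maps,
  so it is enough to bound each \<open>f k\<close>.\<close>

lemma ennreal_powr_SUP_le:
  fixes f :: "nat \<Rightarrow> ennreal"
  assumes p: "p > 0"
  shows "ennreal_powr (SUP k. f k) p \<le> (SUP k. ennreal_powr (f k) p)"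
proof -
  let ?S = "SUP k. ennreal_powr (f k) p"
  have one: "ennreal_powr x 1 = x" for x
    by (cases x) (auto simp: ennreal_powr_def)
  have "f k \<le> ennreal_powr ?S (1 / p)" for k
  proof -
    have "f k = ennreal_powr (ennreal_powr (f k) p) (1 / p)"
      using p by (simp add: ennreal_powr_powr one)
    also have "\<dots> \<le> ennreal_powr ?S (1 / p)"
      using p by (intro ennreal_powr_mono SUP_upper) auto
    finally show ?thesis .
  qed
  then have "ennreal_powr (SUP k. f k) p \<le> ennreal_powr (ennreal_powr ?S (1 / p)) p"
    using p by (intro ennreal_powr_mono SUP_least) auto
  then show ?thesis using p by (simp add: ennreal_powr_powr one)
qed

text \<open>Any \<open>q\<close> above the limit inferior bounds infinitely many of the truncated
  norms, hence every partial density; monotone convergence in \<open>K\<close> reaches the full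
  series. In the application the good indices depend on the time, whereas the limit inferior stays
  measurable in it.\<close>

lemma Lp_density_le_liminf:
  fixes F :: "nat \<Rightarrow> nat \<Rightarrow> 'a::euclidean_space \<Rightarrow> complex" and lam :: "nat \<Rightarrow> real" and p :: real
  assumes lam: "\<And>j. lam j \<ge> 0" and p: "p > 0"
    and Fm: "\<And>j n. j \<in> J \<Longrightarrow> F j n \<in> borel_measurable borel"
    and vm: "\<And>j. j \<in> J \<Longrightarrow> v j \<in> borel_measurable borel"
    and lim: "\<And>j. j \<in> J \<Longrightarrow> (\<lambda>n. L2_sq (\<lambda>x. F j n x - v j x)) \<longlonglongrightarrow> 0"
  shows "ennreal_powr (\<integral>\<^sup>+ x. ennreal_powr (SUP K. ennreal (\<Sum>j\<in>J \<inter> {..<K}. lam j * (norm (v j x))\<^sup>2)) p \<partial>lborel) (2 / p)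
    \<le> liminf (\<lambda>n. ennreal_powr (\<integral>\<^sup>+ x. ennreal_powr (ennreal (\<Sum>j\<in>J \<inter> {..<n}. lam j * (norm (F j n x))\<^sup>2)) p \<partial>lborel) (2 / p))"
    (is "ennreal_powr ?V _ \<le> liminf (\<lambda>n. ennreal_powr (?A n) _)")
proof (rule dense_ge)
  fix q assume q: "liminf (\<lambda>n. ennreal_powr (?A n) (2 / p)) < q"
  have one: "ennreal_powr x 1 = x" for x
    by (cases x) (auto simp: ennreal_powr_def)
  \<comment> \<open>The exponent \<open>p / 2\<close> inverts \<open>2 / p\<close>.\<close>
  define b where "b = ennreal_powr q (p / 2)"
  have "infinite {n. ennreal_powr (?A n) (2 / p) < q}"
  proof
    assume "finite {n. ennreal_powr (?A n) (2 / p) < q}"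
    then obtain m where m: "\<And>n. ennreal_powr (?A n) (2 / p) < q \<Longrightarrow> n < m"
      by (auto simp: finite_nat_set_iff_bounded)
    have "q \<le> liminf (\<lambda>n. ennreal_powr (?A n) (2 / p))"
      by (intro Liminf_bounded eventually_sequentiallyI[of m]) (use m in \<open>force simp: not_less[symmetric]\<close>)
    with q show False by simp
  qed
  moreover have "{n. ennreal_powr (?A n) (2 / p) < q} \<subseteq> {n. ?A n \<le> b}"
  proof safe
    fix n assume "ennreal_powr (?A n) (2 / p) < q"
    then have "ennreal_powr (ennreal_powr (?A n) (2 / p)) (p / 2) \<le> b"
      unfolding b_def using p by (intro ennreal_powr_mono) auto
    then show "?A n \<le> b" using p by (simp add: ennreal_powr_powr one)
  qed
  ultimately have inf: "infinite {n. ?A n \<le> b}" by (meson finite_subset)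
  let ?f = "\<lambda>K x. \<Sum>j\<in>J \<inter> {..<K}. lam j * (norm (v j x))\<^sup>2"
  have [measurable]: "v j \<in> borel_measurable borel" if "j \<in> J \<inter> {..<K}" for j K
    using vm that by auto
  have fm [measurable]: "?f K \<in> borel_measurable borel" for K
    by measurable
  have f_mono: "?f K x \<le> ?f L x" if "K \<le> L" for K L x
    using that by (intro sum_mono2) (auto intro!: mult_nonneg_nonneg lam)
  have "?V \<le> (\<integral>\<^sup>+ x. (SUP K. ennreal_powr (ennreal (?f K x)) p) \<partial>lborel)"
    using p by (intro nn_integral_mono ennreal_powr_SUP_le)
  also have "\<dots> = (SUP K. \<integral>\<^sup>+ x. ennreal_powr (ennreal (?f K x)) p \<partial>lborel)"
    using p by (intro nn_integral_monotone_convergence_SUP) (auto simp: incseq_def le_fun_def intro!: ennreal_powr_mono ennreal_leI f_mono)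
  also have "\<dots> \<le> b"
    by (intro SUP_least nn_integral_density_le_frequently[OF lam p Fm vm lim inf])
  finally have "ennreal_powr ?V (2 / p) \<le> ennreal_powr b (2 / p)"
    using p by (intro ennreal_powr_mono) auto
  then show "ennreal_powr ?V (2 / p) \<le> q"
    unfolding b_def using p by (simp add: ennreal_powr_powr one)
qed

section \<open>Unconditional sums controlled by partial sums\<close>

lemma summable_on_nat_bounded:
  fixes f :: "nat \<Rightarrow> complex"
  assumes B: "(SUP K. ennreal (\<Sum>j\<in>J \<inter> {..<K}. norm (f j))) < \<infinity>"
  shows "f summable_on J"
proof -
  obtain b where b: "b \<ge> 0" "(SUP K. ennreal (\<Sum>j\<in>J \<inter> {..<K}. norm (f j))) = ennreal b"
    using B by (cases "SUP K. ennreal (\<Sum>j\<in>J \<inter> {..<K}. norm (f j))") auto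
  have fin: "(\<Sum>j\<in>F. norm (f j)) \<le> b" if F: "finite F" "F \<subseteq> J" for F
  proof -
    obtain K where "F \<subseteq> {..<K}" using F(1) finite_nat_iff_bounded by blast
    then have "(\<Sum>j\<in>F. norm (f j)) \<le> (\<Sum>j\<in>J \<inter> {..<K}. norm (f j))"
      using F by (intro sum_mono2) auto
    moreover have "ennreal (\<Sum>j\<in>J \<inter> {..<K}. norm (f j)) \<le> ennreal b"
      unfolding b(2)[symmetric] by (rule SUP_upper) simp
    ultimately show ?thesis using b(1) by (simp add: ennreal_le_iff)
  qed
  have "(\<lambda>j. norm (f j)) summable_on J"
    by (rule nonneg_bdd_above_summable_on) (auto intro!: bdd_aboveI2[where M = b] fin)
  then show ?thesis by (rule abs_summable_summable)
qed

text \<open>A finite supremum forces summability, and an infinite one makes the bound trivial; so it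
  holds at every point, including those where the series diverges.\<close>

lemma norm_infsum_nat_le:
  fixes f :: "nat \<Rightarrow> complex"
  shows "ennreal (norm (\<Sum>\<^sub>\<infinity>j\<in>J. f j)) \<le> (SUP K. ennreal (\<Sum>j\<in>J \<inter> {..<K}. norm (f j)))"
proof (cases "(SUP K. ennreal (\<Sum>j\<in>J \<inter> {..<K}. norm (f j)))")
  case (real b)
  have fin: "norm (\<Sum>j\<in>F. f j) \<le> b" if F: "finite F" "F \<subseteq> J" for F
  proof -
    obtain K where "F \<subseteq> {..<K}" using F(1) finite_nat_iff_bounded by blast
    then have "(\<Sum>j\<in>F. norm (f j)) \<le> (\<Sum>j\<in>J \<inter> {..<K}. norm (f j))"
      using F by (intro sum_mono2) auto
    moreover have "ennreal (\<Sum>j\<in>J \<inter> {..<K}. norm (f j)) \<le> ennreal b"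
      unfolding real(2)[symmetric] by (rule SUP_upper) simp
    ultimately show ?thesis using real(1) norm_sum[of f F] by (simp add: ennreal_le_iff)
  qed
  have "f summable_on J" by (rule summable_on_nat_bounded) (simp add: real)
  then have "(f has_sum (\<Sum>\<^sub>\<infinity>j\<in>J. f j)) J" by (rule has_sum_infsum)
  then have "((\<lambda>F. norm (sum f F)) \<longlongrightarrow> norm (\<Sum>\<^sub>\<infinity>j\<in>J. f j)) (finite_subsets_at_top J)"
    unfolding has_sum_def by (rule tendsto_norm)
  then have "norm (\<Sum>\<^sub>\<infinity>j\<in>J. f j) \<le> b"
    by (rule tendsto_upperbound) (auto intro!: eventually_finite_subsets_at_top_weakI fin)
  then show ?thesis unfolding real(2) by (rule ennreal_leI)
next
  case top
  show ?thesis unfolding top by simp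
qed

theorem strichartz_orthonormal:
  fixes s p :: real
  assumes s: "2 * s < real DIM('a) - 1" "real DIM('a) - 1 < 4 * s" and p: "p * (real DIM('a) - 1 - 2 * s) = real DIM('a)"
  obtains C where "C > 0" "\<And>(J :: nat set) (f :: nat \<Rightarrow> 'a::euclidean_space \<Rightarrow> complex) lam.
    orthonormal_L2 J f \<Longrightarrow> (\<lambda>j. (norm (lam j))\<^sup>2) summable_on J \<Longrightarrow>
    (\<integral>\<^sup>+ t. ennreal_powr (\<integral>\<^sup>+ x. ennreal_powr (SUP K. ennreal (\<Sum>j\<in>J \<inter> {..<K}.
        norm (lam j * of_real ((norm (schrodinger t (riesz_potential s (f j)) x))\<^sup>2) :: complex))) p \<partial>lborel) (2 / p) \<partial>lborel)
    \<le> ennreal (C * (\<Sum>\<^sub>\<infinity>j\<in>J. (norm (lam j))\<^sup>2))"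
    "\<And>(J :: nat set) (f :: nat \<Rightarrow> 'a::euclidean_space \<Rightarrow> complex) lam.
    orthonormal_L2 J f \<Longrightarrow> (\<lambda>j. (norm (lam j))\<^sup>2) summable_on J \<Longrightarrow>
    AE t in lborel. AE x in lborel. (SUP K. ennreal (\<Sum>j\<in>J \<inter> {..<K}.
        norm (lam j * of_real ((norm (schrodinger t (riesz_potential s (f j)) x))\<^sup>2) :: complex))) < \<infinity>"
proof -
  have s0: "0 \<le> s" "2 * s < DIM('a)" using s DIM_positive[where 'a='a] by linarith+
  have "0 < p * (real DIM('a) - 1 - 2 * s)" unfolding p by simp
  then have p0: "p > 0" by (rule zero_less_mult_pos2) (use s in simp)
  obtain C where C: "C > 0" and trunc: "\<And>(J :: nat set) (G :: nat \<Rightarrow> 'a \<Rightarrow> complex) lam n. finite J \<Longrightarrow>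
    (\<And>j. j \<in> J \<Longrightarrow> L2_fun (G j)) \<Longrightarrow>
    (\<And>j k. j \<in> J \<Longrightarrow> k \<in> J \<Longrightarrow> (LINT x|lborel. G j x * cnj (G k x)) = (if j = k then 1 else 0)) \<Longrightarrow>
    (\<And>j. lam j \<ge> 0) \<Longrightarrow>
    (\<integral>\<^sup>+ t. ennreal_powr (\<integral>\<^sup>+ x. ennreal_powr (ennreal (\<Sum>j\<in>J. lam j * (norm (wave s n (G j) t x))\<^sup>2)) p \<partial>lborel) (2 / p) \<partial>lborel)
      \<le> ennreal (C * (\<Sum>j\<in>J. (lam j)\<^sup>2))"
    using strichartz_truncated[OF s p, where 'i = nat] by blast
  \<comment> \<open>The norm in \<open>x\<close> is not shown to be measurable in \<open>t\<close>,
    while finiteness almost everywhere is to be deduced from a finite integral of a measurable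
    function. Hence the measurable majorant \<open>Q\<close>.\<close>
  have main: "\<exists>Q\<in>borel_measurable lborel. (\<forall>t. ennreal_powr (\<integral>\<^sup>+ x. ennreal_powr (SUP K. ennreal (\<Sum>j\<in>J \<inter> {..<K}.
        norm (lam j * of_real ((norm (schrodinger t (riesz_potential s (f j)) x))\<^sup>2)))) p \<partial>lborel) (2 / p) \<le> Q t) \<and>
      (\<integral>\<^sup>+ t. Q t \<partial>lborel) \<le> ennreal (C * (\<Sum>\<^sub>\<infinity>j\<in>J. (norm (lam j))\<^sup>2)) \<and>
      (\<forall>j\<in>J. \<forall>t. schrodinger t (riesz_potential s (f j)) \<in> borel_measurable borel)"
    if f: "orthonormal_L2 J f" and sum: "(\<lambda>j. (norm (lam j))\<^sup>2) summable_on J"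
    for J and f :: "nat \<Rightarrow> 'a \<Rightarrow> complex" and lam :: "nat \<Rightarrow> complex"
  proof -
    have L2f: "L2_fun (f j)" if "j \<in> J" for j using f that by (simp add: orthonormal_L2_def)
    have "\<forall>j\<in>J. \<exists>g. has_fourier (f j) g" using has_fourier_L2_exists[OF L2f] by metis
    then obtain G where G: "\<And>j. j \<in> J \<Longrightarrow> has_fourier (f j) (G j)" by metis
    have L2G: "L2_fun (G j)" if "j \<in> J" for j by (rule plancherel(1)[OF L2f[OF that] G[OF that]])
    have orth: "(LINT x|lborel. G j x * cnj (G k x)) = (if j = k then 1 else 0)" if "j \<in> J" "k \<in> J" for j k
      using plancherel_inner[OF L2f[OF that(1)] L2f[OF that(2)] G[OF that(1)] G[OF that(2)]] f that
      by (simp add: orthonormal_L2_def)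
    have Gm [measurable]: "G j \<in> borel_measurable borel" if "j \<in> J" for j using L2G[OF that] by (rule L2_fun_measurable)
    let ?v = "\<lambda>t j. schrodinger t (riesz_potential s (f j))"
    have vm: "?v t j \<in> borel_measurable borel" if "j \<in> J" for j t
      by (rule schrodinger_riesz_limit(1)[OF L2f[OF that] G[OF that] s0])
    have lim: "(\<lambda>n. L2_sq (\<lambda>x. wave s n (G j) t x - ?v t j x)) \<longlonglongrightarrow> 0" if "j \<in> J" for j t
      unfolding wave_def by (rule schrodinger_riesz_limit(2)[OF L2f[OF that] G[OF that] s0])
    define A where "A n t = ennreal_powr (\<integral>\<^sup>+ x. ennreal_powr (ennreal (\<Sum>j\<in>J \<inter> {..<n}. norm (lam j) * (norm (wave s n (G j) t x))\<^sup>2)) p \<partial>lborel) (2 / p)" for n t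
    have [measurable]: "A n \<in> borel_measurable lborel" for n
      unfolding A_def by measurable
    define Q where "Q t = liminf (\<lambda>n. A n t)" for t
    have Qm: "Q \<in> borel_measurable lborel" unfolding Q_def by measurable
    have le: "ennreal_powr (\<integral>\<^sup>+ x. ennreal_powr (SUP K. ennreal (\<Sum>j\<in>J \<inter> {..<K}. norm (lam j) * (norm (?v t j x))\<^sup>2)) p \<partial>lborel) (2 / p) \<le> Q t" for t
      unfolding Q_def A_def
    proof (rule Lp_density_le_liminf[OF _ p0 _ vm lim])
      fix j n assume "j \<in> J"
      then show "wave s n (G j) t \<in> borel_measurable borel" by measurable
    qed auto
    have "(\<integral>\<^sup>+ t. Q t \<partial>lborel) \<le> liminf (\<lambda>n. \<integral>\<^sup>+ t. A n t \<partial>lborel)"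
      unfolding Q_def by (rule nn_integral_liminf) measurable
    also have "\<dots> \<le> ennreal (C * (\<Sum>\<^sub>\<infinity>j\<in>J. (norm (lam j))\<^sup>2))"
    proof (intro Liminf_le always_eventually allI)
      fix n
      have "(\<integral>\<^sup>+ t. A n t \<partial>lborel) \<le> ennreal (C * (\<Sum>j\<in>J \<inter> {..<n}. (norm (lam j))\<^sup>2))"
        unfolding A_def by (rule trunc) (use L2G orth in auto)
      also have "\<dots> \<le> ennreal (C * (\<Sum>\<^sub>\<infinity>j\<in>J. (norm (lam j))\<^sup>2))"
        using C by (intro ennreal_leI mult_left_mono finite_sum_le_infsum sum) auto
      finally show "(\<integral>\<^sup>+ t. A n t \<partial>lborel) \<le> ennreal (C * (\<Sum>\<^sub>\<infinity>j\<in>J. (norm (lam j))\<^sup>2))" .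
    qed simp
    finally have "(\<integral>\<^sup>+ t. Q t \<partial>lborel) \<le> ennreal (C * (\<Sum>\<^sub>\<infinity>j\<in>J. (norm (lam j))\<^sup>2))" .
    moreover have "norm (lam j * of_real ((norm (?v t j x))\<^sup>2)) = norm (lam j) * (norm (?v t j x))\<^sup>2" for j t x
      by (simp add: norm_mult norm_power)
    ultimately show ?thesis
      using le vm Qm by (intro bexI[of _ Q]) simp_all
  qed
  show thesis
  proof (rule that[OF C])
    fix J and f :: "nat \<Rightarrow> 'a \<Rightarrow> complex" and lam :: "nat \<Rightarrow> complex"
    assume f: "orthonormal_L2 J f" and sum: "(\<lambda>j. (norm (lam j))\<^sup>2) summable_on J"
    let ?F = "\<lambda>t x. SUP K. ennreal (\<Sum>j\<in>J \<inter> {..<K}. norm (lam j * of_real ((norm (schrodinger t (riesz_potential s (f j)) x))\<^sup>2)))"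
    obtain Q where Qm: "Q \<in> borel_measurable lborel"
      and Q: "\<And>t. ennreal_powr (\<integral>\<^sup>+ x. ennreal_powr (?F t x) p \<partial>lborel) (2 / p) \<le> Q t"
      and le: "(\<integral>\<^sup>+ t. Q t \<partial>lborel) \<le> ennreal (C * (\<Sum>\<^sub>\<infinity>j\<in>J. (norm (lam j))\<^sup>2))"
      and vm: "\<And>j t. j \<in> J \<Longrightarrow> schrodinger t (riesz_potential s (f j)) \<in> borel_measurable borel"
      using main[OF f sum] by (elim bexE conjE) simp
    show "(\<integral>\<^sup>+ t. ennreal_powr (\<integral>\<^sup>+ x. ennreal_powr (?F t x) p \<partial>lborel) (2 / p) \<partial>lborel) \<le> ennreal (C * (\<Sum>\<^sub>\<infinity>j\<in>J. (norm (lam j))\<^sup>2))"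
      by (rule order_trans[OF nn_integral_mono le]) (rule Q)
    have "(\<integral>\<^sup>+ t. Q t \<partial>lborel) \<noteq> \<infinity>" using le by (auto simp: top_unique)
    then have "AE t in lborel. Q t \<noteq> \<infinity>" by (rule nn_integral_PInf_AE[OF Qm])
    then show "AE t in lborel. AE x in lborel. ?F t x < \<infinity>"
    proof eventually_elim
      case (elim t)
      have Fm [measurable]: "(\<lambda>x. ?F t x) \<in> borel_measurable lborel"
      proof (rule borel_measurable_SUP)
        fix K
        have [measurable]: "schrodinger t (riesz_potential s (f j)) \<in> borel_measurable lborel" if "j \<in> J \<inter> {..<K}" for j
          using vm[of j t] that by simp
        show "(\<lambda>x. ennreal (\<Sum>j\<in>J \<inter> {..<K}. norm (lam j * of_real ((norm (schrodinger t (riesz_potential s (f j)) x))\<^sup>2)))) \<in> borel_measurable lborel"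
          by measurable
      qed simp
      have "(\<integral>\<^sup>+ x. ennreal_powr (?F t x) p \<partial>lborel) \<noteq> \<infinity>"
      proof
        assume "(\<integral>\<^sup>+ x. ennreal_powr (?F t x) p \<partial>lborel) = \<infinity>"
        with Q[of t] elim show False by (simp add: ennreal_powr_def top_unique)
      qed
      then have "AE x in lborel. ennreal_powr (?F t x) p \<noteq> \<infinity>"
        by (intro nn_integral_PInf_AE) measurable
      moreover have "y < \<infinity>" if "ennreal_powr y p \<noteq> \<infinity>" for y
        using that by (cases y) (auto simp: ennreal_powr_def)
      ultimately show ?case by (rule eventually_mono)
    qed
  qed
qed

text \<open>The summability clause accompanies the estimate because \<open>infsum\<close> is 0 by
  convention where a series fails to converge, so the norm bound alone would not express
  convergence.\<close>

theorem theorem1p3: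
  fixes r s :: real
  assumes "CARD('n::finite) \<ge> 2"
    and "4 * real CARD('n) / (real CARD('n) - 1) < r"
    and "s = real CARD('n) / 2 - real CARD('n) / r - 1 / 2"
  shows "\<exists>C>0. \<forall>(J :: nat set) (f :: nat \<Rightarrow> real ^ 'n \<Rightarrow> complex) (lam :: nat \<Rightarrow> complex).
    orthonormal_L2 J f \<longrightarrow> (\<lambda>j. (norm (lam j))\<^sup>2) summable_on J \<longrightarrow>
      (AE t in lborel. AE x in lborel.
         (\<lambda>j. lam j * of_real ((norm (schrodinger t (riesz_potential s (f j)) x))\<^sup>2)) summable_on J) \<and>
      mixed_norm 2 (r / 2)
         (\<lambda>t x. \<Sum>\<^sub>\<infinity>j\<in>J. lam j * of_real ((norm (schrodinger t (riesz_potential s (f j)) x))\<^sup>2))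
       \<le> ennreal (C * sqrt (\<Sum>\<^sub>\<infinity>j\<in>J. (norm (lam j))\<^sup>2))"
proof -
  define d where "d = real CARD('n)"
  define p where "p = r / 2"
  have d: "d \<ge> 2" "real DIM(real ^ 'n) = d" using assms(1) by (auto simp: d_def)
  have r: "4 * d < r * (d - 1)" using assms(2) d(1) by (simp add: d_def divide_less_eq split: if_splits)
  have r0: "r > 0"
  proof (rule ccontr)
    assume "\<not> r > 0"
    then have "r * (d - 1) \<le> 0" using d(1) by (intro mult_nonpos_nonneg) auto
    then show False using r d(1) by linarith
  qed
  then have p0: "p > 0" by (simp add: p_def)
  have dr: "d / r < (d - 1) / 4" "d / r > 0" using r r0 d(1) by (auto simp: field_simps)
  have "s = d / 2 - d / r - 1 / 2" unfolding d_def by (rule assms(3))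
  then have s: "2 * s = d - 2 * (d / r) - 1" by linarith
  \<comment> \<open>With \<open>2 * s = d - 1 - 2 * (d / r)\<close>, the first bound is
    \<open>d / r > 0\<close> and the second is \<open>d / r < (d - 1) / 4\<close>, the lower bound
    assumed for \<open>r\<close>.\<close>
  have s1: "2 * s < real DIM(real ^ 'n) - 1" "real DIM(real ^ 'n) - 1 < 4 * s"
    using s dr unfolding d(2) by simp_all
  \<comment> \<open>Both sides compare through
    \<open>d - 1 - 2 * s = 2 * d / r = d / p\<close>.\<close>
  have ps: "p * (real DIM(real ^ 'n) - 1 - 2 * s) = real DIM(real ^ 'n)"
    unfolding d(2) s p_def using r0 by (simp add: field_simps)
  obtain C where C: "C > 0" and norm_le: "\<And>(J :: nat set) (f :: nat \<Rightarrow> real ^ 'n \<Rightarrow> complex) lam.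
    orthonormal_L2 J f \<Longrightarrow> (\<lambda>j. (norm (lam j))\<^sup>2) summable_on J \<Longrightarrow>
    (\<integral>\<^sup>+ t. ennreal_powr (\<integral>\<^sup>+ x. ennreal_powr (SUP K. ennreal (\<Sum>j\<in>J \<inter> {..<K}.
        norm (lam j * of_real ((norm (schrodinger t (riesz_potential s (f j)) x))\<^sup>2) :: complex))) p \<partial>lborel) (2 / p) \<partial>lborel)
    \<le> ennreal (C * (\<Sum>\<^sub>\<infinity>j\<in>J. (norm (lam j))\<^sup>2))"
    and finite: "\<And>(J :: nat set) (f :: nat \<Rightarrow> real ^ 'n \<Rightarrow> complex) lam.
    orthonormal_L2 J f \<Longrightarrow> (\<lambda>j. (norm (lam j))\<^sup>2) summable_on J \<Longrightarrow>
    AE t in lborel. AE x in lborel. (SUP K. ennreal (\<Sum>j\<in>J \<inter> {..<K}.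
        norm (lam j * of_real ((norm (schrodinger t (riesz_potential s (f j)) x))\<^sup>2) :: complex))) < \<infinity>"
    using strichartz_orthonormal[OF s1 ps] by blast
  show ?thesis
  \<comment> \<open>The constant \<open>C\<close> bounds the square of the mixed norm.\<close>
  proof (intro exI[of _ "sqrt C"] conjI allI impI)
    show "sqrt C > 0" using C by simp
    fix J and f :: "nat \<Rightarrow> real ^ 'n \<Rightarrow> complex" and lam :: "nat \<Rightarrow> complex"
    assume f: "orthonormal_L2 J f" and sum: "(\<lambda>j. (norm (lam j))\<^sup>2) summable_on J"
    let ?g = "\<lambda>t x j. lam j * of_real ((norm (schrodinger t (riesz_potential s (f j)) x))\<^sup>2)"
    let ?F = "\<lambda>t x. SUP K. ennreal (\<Sum>j\<in>J \<inter> {..<K}. norm (?g t x j))"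
    show "AE t in lborel. AE x in lborel. (\<lambda>j. ?g t x j) summable_on J"
      using finite[OF f sum]
    proof eventually_elim
      case (elim t)
      then show ?case by eventually_elim (rule summable_on_nat_bounded)
    qed
    let ?S = "\<Sum>\<^sub>\<infinity>j\<in>J. (norm (lam j))\<^sup>2"
    have S0: "?S \<ge> 0" by (rule infsum_nonneg) simp
    have "ennreal_powr (Lp_norm p (\<lambda>x. ennreal (norm (\<Sum>\<^sub>\<infinity>j\<in>J. ?g t x j)))) 2
        \<le> ennreal_powr (\<integral>\<^sup>+ x. ennreal_powr (?F t x) p \<partial>lborel) (2 / p)" for t
    proof -
      have "Lp_norm p (\<lambda>x. ennreal (norm (\<Sum>\<^sub>\<infinity>j\<in>J. ?g t x j))) \<le> ennreal_powr (\<integral>\<^sup>+ x. ennreal_powr (?F t x) p \<partial>lborel) (1 / p)"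
        unfolding Lp_norm_def using p0 by (intro ennreal_powr_mono nn_integral_mono norm_infsum_nat_le) auto
      then have "ennreal_powr (Lp_norm p (\<lambda>x. ennreal (norm (\<Sum>\<^sub>\<infinity>j\<in>J. ?g t x j)))) 2
          \<le> ennreal_powr (ennreal_powr (\<integral>\<^sup>+ x. ennreal_powr (?F t x) p \<partial>lborel) (1 / p)) 2"
        by (intro ennreal_powr_mono) auto
      then show ?thesis by (simp add: ennreal_powr_powr)
    qed
    then have "mixed_norm 2 p (\<lambda>t x. \<Sum>\<^sub>\<infinity>j\<in>J. ?g t x j)
        \<le> ennreal_powr (\<integral>\<^sup>+ t. ennreal_powr (\<integral>\<^sup>+ x. ennreal_powr (?F t x) p \<partial>lborel) (2 / p) \<partial>lborel) (1 / 2)"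
      unfolding mixed_norm_def Lp_norm_def[of 2] by (intro ennreal_powr_mono nn_integral_mono) auto
    also have "\<dots> \<le> ennreal_powr (ennreal (C * ?S)) (1 / 2)"
      by (intro ennreal_powr_mono norm_le[OF f sum]) simp
    also have "\<dots> = ennreal (sqrt C * sqrt ?S)"
      using C S0 by (simp add: powr_half_sqrt real_sqrt_mult)
    finally show "mixed_norm 2 (r / 2) (\<lambda>t x. \<Sum>\<^sub>\<infinity>j\<in>J. ?g t x j) \<le> ennreal (sqrt C * sqrt ?S)"
      unfolding p_def .
  qed
qed

end
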